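(* Let $H$ be a self-adjoint operator on $L^2(\mathbf{R}^d,dx)$, bounded from below and satisfying assumptions (a)--(d) of the context, with ground state $\varphi_0$. The following hold. (i) If the semigroup $\{e^{-tH}: t \geq 0\}$ is ISC and there exists $\delta \in (0,1)$ such that $\varphi_0^{1-\delta} \in L^1(\mathbf{R}^d,dx)$, then for every $p \in (2,\infty)$ the semigroup $\{e^{-tH}: t \geq 0\}$ is $L^p$-GSD. (ii) If for every $p \in (2,\infty)$ the semigroup $\{e^{-tH}: t \geq 0\}$ is $L^p$-GSD and for every $t>0$ the operator $e^{-tH}:L^2(\mathbf{R}^d,dx) \to L^{\infty}(\mathbf{R}^d,dx)$ is bounded (i.e. the semigroup $\{e^{-tH}: t \geq 0\}$ is ultracontractive), then the semigroup $\{e^{-tH}: t \geq 0\}$ is ISC.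
   Context: Setting: $H$ is a self-adjoint operator on $L^2(\mathbf{R}^d,dx)$, bounded from below, such that: (a) $\lambda_0:=\inf\mathrm{Spec}\, H$ is a non-degenerate eigenvalue; (b) $e^{-tH}$ is positivity improving for every $t>0$, i.e. $e^{-tH} f > 0$ on $\mathbf{R}^d$ (as an element of $L^2$) for every $f \in L^2(\mathbf{R}^d,dx)$ with $f \geq 0$ a.e. and $f$ not a.e. zero; (c) $e^{-tH}$ is bounded on $L^{\infty}(\mathbf{R}^d,dx)$ for all $t > 0$, and $|e^{-tH} f(x)| \leq e^{-tH} \mathbf{1}(x) \|f\|_{\infty}$ for a.e. $x \in \mathbf{R}^d$ and every $f \in L^{\infty}(\mathbf{R}^d,dx)$; (d) there exists $t_{\rm b} >0$ such that $e^{-t_{\rm b} H}$ is bounded from $L^2(\mathbf{R}^d,dx)$ to $L^{\infty}(\mathbf{R}^d,dx)$. Here $\mathbf{1}$ is the constant function $1$ on $\mathbf{R}^d$, and the action of $e^{-tH}$ on $L^\infty$ is the extension of the $L^2$ action by monotone limits: $e^{-tH}f=\lim_{n} e^{-tH}(f\mathbf{1}_{B(0,n)})$ a.e. for $0\le f\in L^\infty$, extended linearly. The ground state $\varphi_0$ is the $L^2$-normalized, strictly positive eigenfunction of $H$ for the eigenvalue $\lambda_0$ (it lies in $L^\infty$). Put $\mu(dx)=\varphi_0^2(x)dx$, a probability measure. The ground state-transformed semigroup is $$e^{-t\widetilde{H}} f(x) = \frac{e^{\lambda_0 t}}{\varphi_0(x)} e^{-tH}(f \varphi_0)(x), \quad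 f \in L^2(\mathbf{R}^d, \mu),\ t \geq 0.$$ Definitions, for $p\in(2,\infty)$: - The operator $e^{-tH}$ is $L^p$-GSD ($L^p$-ground state dominated) if $\frac{e^{-tH}\mathbf{1}}{\varphi_0}\in L^p(\mathbf{R}^d,\mu)$. The semigroup $\{e^{-tH}:t\ge0\}$ is $L^p$-GSD if the operator $e^{-tH}$ is $L^p$-GSD for every $t>0$. - The semigroup $\{e^{-tH}:t\ge0\}$ is ISC (intrinsically supercontractive) if for every $p\in(2,\infty)$ and every $t>0$ the operator $e^{-t\widetilde H}$ is bounded from $L^2(\mathbf{R}^d,\mu)$ to $L^p(\mathbf{R}^d,\mu)$. *)

theory Defs
  imports "HOL-Probability.Essential_Supremum" "HOL-Library.Complex_Order"
begin

text \<open>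
  Elements of the Lebesgue spaces are represented by functions, and identities between them hold
  almost everywhere. The spaces are complex. The order on complex numbers is the one of
  \<^theory>\<open>HOL-Library.Complex_Order\<close>: \<open>0 \<le> z\<close> means that \<open>z\<close> is real and nonnegative.
\<close>

section \<open>Lebesgue spaces and bounded operators\<close>

definition Lp :: "'a measure \<Rightarrow> real \<Rightarrow> ('a \<Rightarrow> complex) set" where
  "Lp M p = {f \<in> borel_measurable M. integrable M (\<lambda>x. norm (f x) powr p)}"

definition Lp_norm :: "'a measure \<Rightarrow> real \<Rightarrow> ('a \<Rightarrow> complex) \<Rightarrow> real" where
  "Lp_norm M p f = (LINT x|M. norm (f x) powr p) powr (1 / p)"

definition Linf :: "'a measure \<Rightarrow> ('a \<Rightarrow> complex) set" where
  "Linf M = {f \<in> borel_measurable M. esssup M (\<lambda>x. ennreal (norm (f x))) < \<infinity>}"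

definition Linf_norm :: "'a measure \<Rightarrow> ('a \<Rightarrow> complex) \<Rightarrow> real" where
  "Linf_norm M f = enn2real (esssup M (\<lambda>x. ennreal (norm (f x))))"

definition bounded_map ::
  "'f set \<Rightarrow> ('f \<Rightarrow> real) \<Rightarrow> 'g set \<Rightarrow> ('g \<Rightarrow> real) \<Rightarrow> ('f \<Rightarrow> 'g) \<Rightarrow> bool" where
  "bounded_map X normX Y normY A \<longleftrightarrow> (\<exists>C. \<forall>f\<in>X. A f \<in> Y \<and> normY (A f) \<le> C * normX f)"

type_synonym 'n fn = "real ^ 'n \<Rightarrow> complex"

abbreviation L2 :: "('n::finite) fn set" where
  "L2 \<equiv> Lp lborel 2"

abbreviation L2_norm :: "('n::finite) fn \<Rightarrow> real" where
  "L2_norm \<equiv> Lp_norm lborel 2"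

definition L2_inner :: "('n::finite) fn \<Rightarrow> 'n fn \<Rightarrow> complex" where
  "L2_inner f g = (LINT x|lborel. f x * cnj (g x))"


section \<open>Unbounded operators on the space of square-integrable functions\<close>

text \<open>
  An unbounded operator is represented by its graph: \<open>(f, g) \<in> H\<close> means that \<open>f\<close> is in the
  domain of \<open>H\<close> and that \<open>H f = g\<close> almost everywhere.
\<close>

type_synonym 'n graph = "('n fn \<times> 'n fn) set"

definition densely_defined :: "('n::finite) graph \<Rightarrow> bool" where
  "densely_defined H \<longleftrightarrow>
     (\<forall>f\<in>L2. \<forall>\<epsilon>>0. \<exists>u\<in>Domain H. L2_norm (\<lambda>x. f x - u x) < \<epsilon>)"

definition adjoint_graph :: "('n::finite) graph \<Rightarrow> 'n graph" where
  "adjoint_graph H =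
     {(f, g). f \<in> L2 \<and> g \<in> L2 \<and> (\<forall>(u, v)\<in>H. L2_inner v f = L2_inner u g)}"

text \<open>
  The equality \<open>H = H\<^sup>*\<close> of graphs already makes \<open>H\<close> a linear subspace of pairs of
  square-integrable functions that is saturated for almost everywhere equality; density of the
  domain makes it single-valued up to null sets.
\<close>

definition self_adjoint :: "('n::finite) graph \<Rightarrow> bool" where
  "self_adjoint H \<longleftrightarrow> densely_defined H \<and> adjoint_graph H = H"

definition bounded_from_below :: "('n::finite) graph \<Rightarrow> bool" where
  "bounded_from_below H \<longleftrightarrow>
     (\<exists>c::real. \<forall>(f, g)\<in>H. complex_of_real (c * (L2_norm f)\<^sup>2) \<le> L2_inner g f)"

text \<open>
  \<open>z\<close> is in the resolvent set if \<open>H - z\<close> is a bijection from its domain onto the whole space,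
  with bounded inverse. Injectivity is part of the norm estimate.
\<close>

definition resolvent_set :: "('n::finite) graph \<Rightarrow> complex set" where
  "resolvent_set H =
     {z. (\<forall>k\<in>L2. \<exists>f. (f, \<lambda>x. k x + z * f x) \<in> H) \<and>
         (\<exists>C. \<forall>(f, g)\<in>H. L2_norm f \<le> C * L2_norm (\<lambda>x. g x - z * f x))}"

definition spectrum :: "('n::finite) graph \<Rightarrow> complex set" where
  "spectrum H = - resolvent_set H"

definition inf_spectrum :: "('n::finite) graph \<Rightarrow> real" where
  "inf_spectrum H = Inf {r. complex_of_real r \<in> spectrum H}"

definition eigenspace :: "('n::finite) graph \<Rightarrow> complex \<Rightarrow> 'n fn set" where
  "eigenspace H z = {f. (f, \<lambda>x. z * f x) \<in> H}"

definition nondegenerate_eigenvalue :: "('n::finite) graph \<Rightarrow> complex \<Rightarrow> bool" where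
  "nondegenerate_eigenvalue H z \<longleftrightarrow>
     (\<exists>f\<in>eigenspace H z. \<not> (AE x in lborel. f x = 0) \<and>
        (\<forall>g\<in>eigenspace H z. \<exists>c. AE x in lborel. g x = c * f x))"


section \<open>The semigroup generated by a self-adjoint operator\<close>

definition L2_linear :: "(('n::finite) fn \<Rightarrow> 'n fn) \<Rightarrow> bool" where
  "L2_linear A \<longleftrightarrow>
     (\<forall>f\<in>L2. \<forall>g\<in>L2. \<forall>a b. AE x in lborel. A (\<lambda>y. a * f y + b * g y) x = a * A f x + b * A g x)"

definition C0_semigroup :: "(real \<Rightarrow> ('n::finite) fn \<Rightarrow> 'n fn) \<Rightarrow> bool" where
  "C0_semigroup T \<longleftrightarrow>
     (\<forall>t\<ge>0. L2_linear (T t) \<and> bounded_map L2 L2_norm L2 L2_norm (T t)) \<and>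
     (\<forall>f\<in>L2. AE x in lborel. T 0 f x = f x) \<and>
     (\<forall>f\<in>L2. \<forall>s\<ge>0. \<forall>t\<ge>0. AE x in lborel. T (s + t) f x = T s (T t f) x) \<and>
     (\<forall>f\<in>L2. ((\<lambda>h. L2_norm (\<lambda>x. T h f x - f x)) \<longlongrightarrow> 0) (at_right 0))"

definition generator :: "(real \<Rightarrow> ('n::finite) fn \<Rightarrow> 'n fn) \<Rightarrow> 'n graph" where
  "generator T =
     {(f, g). f \<in> L2 \<and> g \<in> L2 \<and>
        ((\<lambda>h. L2_norm (\<lambda>x. (T h f x - f x) / complex_of_real h - g x)) \<longlongrightarrow> 0) (at_right 0)}"

definition neg_graph :: "('n::finite) graph \<Rightarrow> 'n graph" where
  "neg_graph H = {(f, \<lambda>x. - g x) | f g. (f, g) \<in> H}"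

text \<open>
  \<open>exp_semigroup H t\<close> is \<open>e\<^bsup>-tH\<^esup>\<close>, the strongly continuous semigroup with generator \<open>-H\<close>. For a
  self-adjoint \<open>H\<close> bounded from below it exists and is unique (up to the choice of
  representatives), and agrees with the functional calculus of \<open>H\<close>.
\<close>

definition exp_semigroup :: "('n::finite) graph \<Rightarrow> real \<Rightarrow> 'n fn \<Rightarrow> 'n fn" where
  "exp_semigroup H = (SOME T. C0_semigroup T \<and> generator T = neg_graph H)"

definition positivity_improving :: "(('n::finite) fn \<Rightarrow> 'n fn) \<Rightarrow> bool" where
  "positivity_improving A \<longleftrightarrow>
     (\<forall>f\<in>L2. (AE x in lborel. 0 \<le> f x) \<and> \<not> (AE x in lborel. f x = 0) \<longrightarrow>
        (AE x in lborel. 0 < A f x))"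


section \<open>Action on bounded functions\<close>

definition truncate :: "nat \<Rightarrow> ('n::finite) fn \<Rightarrow> 'n fn" where
  "truncate n f = (\<lambda>x. f x * indicator (ball 0 (real n)) x)"

definition Linf_limits_exist :: "(('n::finite) fn \<Rightarrow> 'n fn) \<Rightarrow> bool" where
  "Linf_limits_exist A \<longleftrightarrow>
     (\<forall>f\<in>Linf lborel. (AE x in lborel. 0 \<le> f x) \<longrightarrow>
        (AE x in lborel. convergent (\<lambda>n. A (truncate n f) x)))"

definition nonneg_ext :: "(('n::finite) fn \<Rightarrow> 'n fn) \<Rightarrow> 'n fn \<Rightarrow> 'n fn" where
  "nonneg_ext A f = (\<lambda>x. lim (\<lambda>n. A (truncate n f) x))"

definition Linf_ext :: "(('n::finite) fn \<Rightarrow> 'n fn) \<Rightarrow> 'n fn \<Rightarrow> 'n fn" where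
  "Linf_ext A f = (\<lambda>x.
       nonneg_ext A (\<lambda>y. complex_of_real (max 0 (Re (f y)))) x
     - nonneg_ext A (\<lambda>y. complex_of_real (max 0 (- Re (f y)))) x
     + \<i> * (nonneg_ext A (\<lambda>y. complex_of_real (max 0 (Im (f y)))) x
          - nonneg_ext A (\<lambda>y. complex_of_real (max 0 (- Im (f y)))) x))"

text \<open>
  Boundedness on the space of essentially bounded functions includes that the defining monotone
  limits are finite almost everywhere.
\<close>

definition bounded_on_Linf :: "(('n::finite) fn \<Rightarrow> 'n fn) \<Rightarrow> bool" where
  "bounded_on_Linf A \<longleftrightarrow> Linf_limits_exist A \<and>
     bounded_map (Linf lborel) (Linf_norm lborel) (Linf lborel) (Linf_norm lborel) (Linf_ext A)"

definition dominated_by_one :: "(('n::finite) fn \<Rightarrow> 'n fn) \<Rightarrow> bool" where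
  "dominated_by_one A \<longleftrightarrow>
     (\<forall>f\<in>Linf lborel. AE x in lborel.
        complex_of_real (norm (Linf_ext A f x))
          \<le> Linf_ext A (\<lambda>_. 1) x * complex_of_real (Linf_norm lborel f))"

definition bounded_L2_Linf :: "(('n::finite) fn \<Rightarrow> 'n fn) \<Rightarrow> bool" where
  "bounded_L2_Linf A \<longleftrightarrow> bounded_map L2 L2_norm (Linf lborel) (Linf_norm lborel) A"


section \<open>Ground state, ground state domination and intrinsic supercontractivity\<close>

definition ground_state :: "('n::finite) graph \<Rightarrow> (real ^ 'n \<Rightarrow> real) \<Rightarrow> bool" where
  "ground_state H \<phi> \<longleftrightarrow>
     (\<lambda>x. complex_of_real (\<phi> x)) \<in> eigenspace H (complex_of_real (inf_spectrum H)) \<and>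
     L2_norm (\<lambda>x. complex_of_real (\<phi> x)) = 1 \<and>
     (AE x in lborel. 0 < \<phi> x)"

definition gs_measure :: "(real ^ ('n::finite) \<Rightarrow> real) \<Rightarrow> (real ^ 'n) measure" where
  "gs_measure \<phi> = density lborel (\<lambda>x. ennreal ((\<phi> x)\<^sup>2))"

definition gs_semigroup ::
  "('n::finite) graph \<Rightarrow> (real ^ 'n \<Rightarrow> real) \<Rightarrow> real \<Rightarrow> 'n fn \<Rightarrow> 'n fn" where
  "gs_semigroup H \<phi> t f = (\<lambda>x.
     complex_of_real (exp (inf_spectrum H * t) / \<phi> x)
       * exp_semigroup H t (\<lambda>y. f y * complex_of_real (\<phi> y)) x)"

definition Lp_GSD_op :: "real \<Rightarrow> ('n::finite) graph \<Rightarrow> (real ^ 'n \<Rightarrow> real) \<Rightarrow> real \<Rightarrow> bool" where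
  "Lp_GSD_op p H \<phi> t \<longleftrightarrow>
     (\<lambda>x. Linf_ext (exp_semigroup H t) (\<lambda>_. 1) x / complex_of_real (\<phi> x)) \<in> Lp (gs_measure \<phi>) p"

definition Lp_GSD :: "real \<Rightarrow> ('n::finite) graph \<Rightarrow> (real ^ 'n \<Rightarrow> real) \<Rightarrow> bool" where
  "Lp_GSD p H \<phi> \<longleftrightarrow> (\<forall>t>0. Lp_GSD_op p H \<phi> t)"

definition ISC :: "('n::finite) graph \<Rightarrow> (real ^ 'n \<Rightarrow> real) \<Rightarrow> bool" where
  "ISC H \<phi> \<longleftrightarrow>
     (\<forall>p>2. \<forall>t>0. bounded_map (Lp (gs_measure \<phi>) 2) (Lp_norm (gs_measure \<phi>) 2)
                              (Lp (gs_measure \<phi>) p) (Lp_norm (gs_measure \<phi>) p)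
                              (gs_semigroup H \<phi> t))"

definition ultracontractive :: "('n::finite) graph \<Rightarrow> bool" where
  "ultracontractive H \<longleftrightarrow> (\<forall>t>0. bounded_L2_Linf (exp_semigroup H t))"

end

theory Submission
  imports Defs "HOL-Analysis.Analysis"
begin

text \<open>
  Write \<open>T\<^sub>t\<close> for \<open>e\<^bsup>-tH\<^esup>\<close> and \<open>S\<^sub>t\<close> for the ground state-transformed semigroup. Division by \<open>\<phi>\<^sub>0\<close> is
  an isometry from \<open>L\<^sup>2(dx)\<close> to \<open>L\<^sup>2(\<mu>)\<close>, and \<open>S\<^sub>t (u/\<phi>\<^sub>0) = e\<^bsup>\<lambda>t\<^esup> (T\<^sub>t u)/\<phi>\<^sub>0\<close>, where \<open>\<lambda>\<close> is the ground
  state energy.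

  Supercontractivity with integrability implies domination. Put \<open>q = 1 + \<delta>\<close>, whose conjugate
  exponent \<open>q' = (1 + \<delta>)/\<delta>\<close> is larger than \<open>2\<close>. Symmetry of \<open>T\<^sub>s\<close> and Hoelder's inequality for
  \<open>\<mu>\<close> give
  \<open>\<parallel>T\<^sub>s u\<parallel>\<^sup>2 = \<langle>T\<^sub>s T\<^sub>s u, u\<rangle> \<le> \<parallel>(T\<^sub>s T\<^sub>s u)/\<phi>\<^sub>0\<parallel>\<^bsub>q'\<^esub> \<parallel>u/\<phi>\<^sub>0\<parallel>\<^bsub>q\<^esub> \<le> C \<parallel>T\<^sub>s u\<parallel> \<parallel>u/\<phi>\<^sub>0\<parallel>\<^bsub>q\<^esub>\<close>,
  the last step being supercontractivity with exponent \<open>q'\<close>. Thus \<open>\<parallel>T\<^sub>s u\<parallel> \<le> C \<parallel>u/\<phi>\<^sub>0\<parallel>\<^bsub>q\<^esub>\<close>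
  (\<open>ISC_dual\<close>), and supercontractivity with exponent \<open>p\<close> bounds \<open>(T\<^bsub>2s\<^esub> u)/\<phi>\<^sub>0\<close> in \<open>L\<^sup>p(\<mu>)\<close> by
  \<open>\<parallel>u/\<phi>\<^sub>0\<parallel>\<^bsub>q\<^esub>\<close>. For \<open>u\<close> the indicator of a ball, \<open>\<parallel>u/\<phi>\<^sub>0\<parallel>\<^bsub>q\<^esub>\<close> to the power \<open>q\<close> is at most
  \<open>\<integral> \<phi>\<^sub>0\<^bsup>2-q\<^esup> dx = \<integral> \<phi>\<^sub>0\<^bsup>1-\<delta>\<^esup> dx\<close>, uniformly in the radius, and Fatou's lemma gives
  \<open>(T\<^bsub>2s\<^esub> 1)/\<phi>\<^sub>0 \<in> L\<^sup>p(\<mu>)\<close>.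

  Domination with ultracontractivity implies supercontractivity. For \<open>f \<in> L\<^sup>2(\<mu>)\<close> and
  \<open>u = f \<phi>\<^sub>0\<close>, the function \<open>T\<^bsub>t/2\<^esub> u\<close> is bounded by a multiple of \<open>\<parallel>u\<parallel>\<close>, so
  \<open>\<bar>T\<^sub>t u\<bar> = \<bar>T\<^bsub>t/2\<^esub> T\<^bsub>t/2\<^esub> u\<bar> \<le> C \<parallel>u\<parallel> T\<^bsub>t/2\<^esub> 1\<close>. Dividing by \<open>\<phi>\<^sub>0\<close> leaves a multiple of
  \<open>(T\<^bsub>t/2\<^esub> 1)/\<phi>\<^sub>0 \<in> L\<^sup>p(\<mu>)\<close>. Here the action of \<open>T\<^bsub>t/2\<^esub>\<close> on bounded functions has to agree with the
  one on square-integrable functions, which is \<open>Linf_ext_eq\<close>.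

  Both arguments rest on \<open>T\<close> being a semigroup of symmetric operators, and this is the larger part of
  the work: \<open>exp_semigroup\<close> is chosen among the strongly continuous semigroups generated by
  \<open>-H\<close>, so such a semigroup has to be constructed, and symmetry has to be shown for every one of them.
  Both are done in an abstract real Hilbert space. Existence (\<open>semigroup_exists\<close>) is the Yosida
  approximation: \<open>H\<close> is replaced by the bounded operators \<open>n (1 - n (n + H)\<^sup>-\<^sup>1)\<close>, whose
  exponentials converge strongly. Symmetry (\<open>semigroup_symmetric_of_generator\<close>) holds because
  \<open>s \<mapsto> \<langle>T\<^bsub>t-s\<^esub> f, T\<^sub>s g\<rangle>\<close> has derivative zero. The results are carried over to
  functions through the quotient type \<open>l2\<close> of square-integrable functions modulo null sets, with
  the real part of the usual inner product; complex linearity of the semigroup is then the statement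
  that it commutes with multiplication by complex scalars.
\<close>

section \<open>Exponentials of bounded operators\<close>

text \<open>
  The mean value inequality, in the form in which it replaces the integral of a derivative.
\<close>

lemma norm_increment_le:
  fixes f :: "real \<Rightarrow> 'b::real_normed_vector"
  assumes "0 \<le> t"
    and der: "\<And>s. 0 \<le> s \<Longrightarrow> s \<le> t \<Longrightarrow> (f has_vector_derivative f' s) (at s within {0..t})"
    and bound: "\<And>s. 0 \<le> s \<Longrightarrow> s \<le> t \<Longrightarrow> norm (f' s) \<le> B"
  shows "norm (f t - f 0) \<le> B * t"
proof -
  have "norm (f t - f 0) \<le> B * norm (t - 0)"
  proof (rule differentiable_bound[where S = "{0..t}"])
    fix s assume s: "s \<in> {0..t}"
    show "(f has_derivative (\<lambda>h. h *\<^sub>R f' s)) (at s within {0..t})"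
      using der[of s] s by (simp add: has_vector_derivative_def)
    show "onorm (\<lambda>h. h *\<^sub>R f' s) \<le> B"
      using bound[of s] s by (intro onorm_le) (simp add: mult.commute[of B] mult_left_mono)
  qed (use assms in auto)
  then show ?thesis using \<open>0 \<le> t\<close> by simp
qed

text \<open>
  A copy of the bounded operators on a space, so that they form a Banach algebra and the library's
  exponential series and its differentiation rules apply to them. A nontrivial space is required for
  \<open>norm 1 = 1\<close>, whence the sort constraint \<open>perfect_space\<close>.
\<close>

typedef (overloaded) ('a::real_normed_vector) bop = "UNIV :: ('a \<Rightarrow>\<^sub>L 'a) set"
  by simp

setup_lifting type_definition_bop

instantiation bop :: ("{real_normed_vector,perfect_space}") real_normed_algebra_1
begin

lift_definition zero_bop :: "'a bop" is 0 .
lift_definition one_bop :: "'a bop" is id_blinfun .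
lift_definition plus_bop :: "'a bop \<Rightarrow> 'a bop \<Rightarrow> 'a bop" is "(+)" .
lift_definition minus_bop :: "'a bop \<Rightarrow> 'a bop \<Rightarrow> 'a bop" is "(-)" .
lift_definition uminus_bop :: "'a bop \<Rightarrow> 'a bop" is uminus .
lift_definition times_bop :: "'a bop \<Rightarrow> 'a bop \<Rightarrow> 'a bop" is blinfun_compose .
lift_definition scaleR_bop :: "real \<Rightarrow> 'a bop \<Rightarrow> 'a bop" is "scaleR" .
lift_definition norm_bop :: "'a bop \<Rightarrow> real" is norm .
definition dist_bop :: "'a bop \<Rightarrow> 'a bop \<Rightarrow> real" where "dist_bop A B = norm (A - B)"
definition sgn_bop :: "'a bop \<Rightarrow> 'a bop" where "sgn_bop A = scaleR (inverse (norm A)) A"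
definition uniformity_bop :: "('a bop \<times> 'a bop) filter" where
  "uniformity_bop = (INF e\<in>{0<..}. principal {(A, B). dist A B < e})"
definition open_bop :: "'a bop set \<Rightarrow> bool" where
  "open_bop U \<longleftrightarrow> (\<forall>A\<in>U. \<forall>\<^sub>F (A', B) in uniformity. A' = A \<longrightarrow> B \<in> U)"

instance
proof
  show "(0::'a bop) \<noteq> 1"
    by transfer (metis norm_blinfun_id norm_zero zero_neq_one)
qed (fact dist_bop_def sgn_bop_def uniformity_bop_def open_bop_def
    | (transfer, auto simp: norm_triangle_ineq norm_blinfun_compose norm_blinfun_id
        blinfun.bilinear_simps algebra_simps intro!: blinfun_eqI; fail))+

end

lift_definition bop_apply :: "('a::real_normed_vector) bop \<Rightarrow> 'a \<Rightarrow> 'a" is blinfun_apply .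

lemma bounded_bilinear_bop_apply [bounded_bilinear]:
  "bounded_bilinear (bop_apply :: 'a::{real_normed_vector,perfect_space} bop \<Rightarrow> _)"
proof
  fix A B :: "'a bop" and x y :: 'a and r :: real
  show "bop_apply (A + B) x = bop_apply A x + bop_apply B x"
    "bop_apply A (x + y) = bop_apply A x + bop_apply A y"
    "bop_apply (r *\<^sub>R A) x = r *\<^sub>R bop_apply A x"
    "bop_apply A (r *\<^sub>R x) = r *\<^sub>R bop_apply A x"
    by (transfer, simp add: blinfun.bilinear_simps)+
  have "norm (bop_apply A x) \<le> norm A * norm x * 1" for A :: "'a bop" and x
    by transfer (simp add: norm_blinfun)
  then show "\<exists>K. \<forall>A x. norm (bop_apply (A :: 'a bop) x) \<le> norm A * norm x * K"
    by blast
qed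

interpretation bop: bounded_bilinear "bop_apply :: 'a::{real_normed_vector,perfect_space} bop \<Rightarrow> _"
  by (rule bounded_bilinear_bop_apply)

lemma norm_bop_apply_le: "norm (bop_apply A x) \<le> norm A * norm x"
  for A :: "'a::{real_normed_vector,perfect_space} bop"
  by transfer (rule norm_blinfun)

lemma bop_apply_mult [simp]: "bop_apply (A * B) x = bop_apply A (bop_apply B x)"
  for A :: "'a::{real_normed_vector,perfect_space} bop"
  by transfer simp

lemma bop_apply_one [simp]: "bop_apply 1 x = x"
  for x :: "'a::{real_normed_vector,perfect_space}"
  by transfer simp

lemma bop_eqI: "(\<And>x. bop_apply A x = bop_apply B x) \<Longrightarrow> A = B"
  for A :: "'a::{real_normed_vector,perfect_space} bop"
  by transfer (rule blinfun_eqI)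

instance bop :: ("{banach,perfect_space}") banach
proof
  fix X :: "nat \<Rightarrow> 'a bop" assume "Cauchy X"
  have dist: "dist (Rep_bop A) (Rep_bop B) = dist A B" for A B :: "'a bop"
    by (simp add: dist_bop_def dist_norm norm_bop.rep_eq minus_bop.rep_eq)
  from \<open>Cauchy X\<close> have "Cauchy (\<lambda>n. Rep_bop (X n))"
    by (simp add: Cauchy_def dist)
  then obtain L where "(\<lambda>n. Rep_bop (X n)) \<longlonglongrightarrow> L"
    using Cauchy_convergent convergent_def by blast
  then have "X \<longlonglongrightarrow> Abs_bop L"
    by (simp add: lim_sequentially Abs_bop_inverse flip: dist)
  then show "convergent X" by (rule convergentI)
qed

definition bop_of :: "('a \<Rightarrow> 'a) \<Rightarrow> ('a::real_normed_vector) bop" where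
  "bop_of f = Abs_bop (Blinfun f)"

lemma bop_apply_bop_of: "bounded_linear f \<Longrightarrow> bop_apply (bop_of f) = f"
  by (simp add: bop_of_def bop_apply.rep_eq Abs_bop_inverse bounded_linear_Blinfun_apply)

lemma norm_bop_le: "0 \<le> b \<Longrightarrow> (\<And>x. norm (bop_apply A x) \<le> b * norm x) \<Longrightarrow> norm A \<le> b"
  for A :: "'a::{real_normed_vector,perfect_space} bop"
  by transfer (rule norm_blinfun_bound)

lemma exp_commutes:
  fixes A B :: "'a::{real_normed_algebra_1,banach}"
  assumes "A * B = B * A"
  shows "exp A * B = B * exp A"
proof -
  have pow: "A ^ n * B = B * A ^ n" for n
    by (induction n) (simp_all add: mult.assoc assms, metis assms mult.assoc)
  have "(\<lambda>n. (A ^ n /\<^sub>R fact n) * B) sums (exp A * B)"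
    by (intro sums_mult2 exp_converges)
  moreover have "(\<lambda>n. B * (A ^ n /\<^sub>R fact n)) sums (B * exp A)"
    by (intro sums_mult exp_converges)
  ultimately show ?thesis
    by (simp add: pow sums_unique2)
qed

text \<open>
  Powers of a symmetric operator are symmetric, and symmetry passes to the limit of the series.
\<close>

lemma exp_symmetric:
  fixes A :: "'a::{real_inner,banach,perfect_space} bop"
  assumes "\<And>x y. inner (bop_apply A x) y = inner x (bop_apply A y)"
  shows "inner (bop_apply (exp A) x) y = inner x (bop_apply (exp A) y)"
proof -
  have pow: "inner (bop_apply (A ^ n) x) y = inner x (bop_apply (A ^ n) y)" for n x y
  proof (induction n arbitrary: x y)
    case (Suc n)
    have "bop_apply (A ^ n) (bop_apply A y) = bop_apply A (bop_apply (A ^ n) y)"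
      by (metis bop_apply_mult power_commutes)
    then show ?case by (simp add: assms Suc)
  qed simp
  have lim: "(\<lambda>n. bop_apply (A ^ n /\<^sub>R fact n) x) sums bop_apply (exp A) x" for x
    by (intro bounded_linear.sums[OF bop.bounded_linear_left] exp_converges)
  have "(\<lambda>n. inner (bop_apply (A ^ n /\<^sub>R fact n) x) y) sums inner (bop_apply (exp A) x) y"
    by (intro bounded_linear.sums[OF bounded_linear_inner_left] lim)
  moreover have "(\<lambda>n. inner x (bop_apply (A ^ n /\<^sub>R fact n) y)) sums inner x (bop_apply (exp A) y)"
    by (intro bounded_linear.sums[OF bounded_linear_inner_right] lim)
  ultimately show ?thesis
    by (simp add: bop.scaleR_left pow sums_unique2)
qed

text \<open>
  The exponential factors as \<open>e\<^bsup>-r\<^esup> e\<^bsup>rJ\<^esup>\<close>, and the second factor has norm at most \<open>e\<^sup>r\<close>.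
\<close>

lemma norm_exp_dissipative_le:
  fixes J :: "'a::{real_normed_algebra_1,banach}"
  assumes "norm J \<le> 1" "0 \<le> r"
  shows "norm (exp (r *\<^sub>R (J - 1))) \<le> 1"
proof -
  have "exp (r *\<^sub>R (J - 1)) = exp (of_real (- r) + r *\<^sub>R J)"
    by (simp add: scaleR_diff_right of_real_def)
  also have "\<dots> = exp (of_real (- r)) * exp (r *\<^sub>R J)"
    by (rule exp_add_commuting) (simp add: of_real_def)
  finally have "norm (exp (r *\<^sub>R (J - 1))) \<le> exp (- r) * norm (exp (r *\<^sub>R J))"
    by (metis exp_of_real norm_mult_ineq norm_of_real abs_exp_cancel)
  also have "norm (exp (r *\<^sub>R J)) \<le> exp r"
    by (rule order_trans[OF norm_exp]) (use assms mult_left_mono[of "norm J" 1 r] in simp)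
  finally show ?thesis by (simp add: exp_minus)
qed

lemma exp_bop_has_vector_derivative:
  fixes A :: "'a::{banach,perfect_space} bop"
  shows "((\<lambda>t. bop_apply (exp (t *\<^sub>R A)) x) has_vector_derivative
     bop_apply (exp (t *\<^sub>R A)) (bop_apply A x)) (at t within S)"
proof -
  have "((\<lambda>t. bop_apply (exp (t *\<^sub>R A)) x) has_vector_derivative
     bop_apply (exp (t *\<^sub>R A) * A) x) (at t within S)"
    by (intro bounded_linear.has_vector_derivative[OF bop.bounded_linear_left]
        exp_scaleR_has_vector_derivative_right)
  then show ?thesis by simp
qed

text \<open>
  The path \<open>s \<mapsto> e\<^bsup>sA\<^esup> e\<^bsup>(t-s)B\<^esup> x\<close> joins the two vectors; because \<open>A\<close> and \<open>B\<close>
  commute, its derivative is \<open>e\<^bsup>sA\<^esup> e\<^bsup>(t-s)B\<^esup> (A - B) x\<close>, which the contractions keep no larger than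
  \<open>(A - B) x\<close>.
\<close>

lemma exp_contraction_diff_le:
  fixes A B :: "'a::{banach,perfect_space} bop"
  assumes comm: "A * B = B * A"
    and contr: "\<And>s. 0 \<le> s \<Longrightarrow> norm (exp (s *\<^sub>R A)) \<le> 1" "\<And>s. 0 \<le> s \<Longrightarrow> norm (exp (s *\<^sub>R B)) \<le> 1"
    and "0 \<le> t"
  shows "norm (bop_apply (exp (t *\<^sub>R A)) x - bop_apply (exp (t *\<^sub>R B)) x)
    \<le> t * norm (bop_apply A x - bop_apply B x)"
proof -
  have expc: "exp ((t - s) *\<^sub>R B) * A = A * exp ((t - s) *\<^sub>R B)" for s
    by (rule exp_commutes) (simp add: comm)
  have der: "((\<lambda>s. bop_apply (exp (s *\<^sub>R A) * exp ((t - s) *\<^sub>R B)) x) has_vector_derivative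
      bop_apply (exp (s *\<^sub>R A) * exp ((t - s) *\<^sub>R B) * (A - B)) x) (at s within {0..t})" for s
  proof -
    have 1: "((\<lambda>s. exp ((t - s) *\<^sub>R B)) has_vector_derivative (- 1) *\<^sub>R (exp ((t - s) *\<^sub>R B) * B))
       (at s within {0..t})"
      by (rule vector_diff_chain_within[where g = "\<lambda>u. exp (u *\<^sub>R B)" and f = "\<lambda>s. t - s", unfolded o_def])
        (auto intro!: derivative_eq_intros exp_scaleR_has_vector_derivative_right)
    have "((\<lambda>s. exp (s *\<^sub>R A) * exp ((t - s) *\<^sub>R B)) has_vector_derivative
        (exp (s *\<^sub>R A) * ((- 1) *\<^sub>R (exp ((t - s) *\<^sub>R B) * B))
         + (exp (s *\<^sub>R A) * A) * exp ((t - s) *\<^sub>R B))) (at s within {0..t})"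
      by (intro bounded_bilinear.has_vector_derivative[OF bounded_bilinear_mult] 1
          exp_scaleR_has_vector_derivative_right)
    also have "exp (s *\<^sub>R A) * ((- 1) *\<^sub>R (exp ((t - s) *\<^sub>R B) * B))
         + (exp (s *\<^sub>R A) * A) * exp ((t - s) *\<^sub>R B)
       = exp (s *\<^sub>R A) * exp ((t - s) *\<^sub>R B) * (A - B)"
      using expc[of s] by (simp add: algebra_simps)
    finally show ?thesis
      by (rule bounded_linear.has_vector_derivative[OF bop.bounded_linear_left])
  qed
  have "norm (bop_apply (exp (t *\<^sub>R A) * exp ((t - t) *\<^sub>R B)) x
      - bop_apply (exp (0 *\<^sub>R A) * exp ((t - 0) *\<^sub>R B)) x) \<le> norm (bop_apply (A - B) x) * t"
  proof (rule norm_increment_le[OF \<open>0 \<le> t\<close> der])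
    fix s assume s: "0 \<le> s" "s \<le> t"
    have contraction: "norm (bop_apply E y) \<le> norm y" if "norm E \<le> 1" for E :: "'a bop" and y
      using norm_bop_apply_le[of E y] mult_right_mono[OF that, of "norm y"] by simp
    have "norm (bop_apply (exp (s *\<^sub>R A)) (bop_apply (exp ((t - s) *\<^sub>R B)) (bop_apply (A - B) x)))
        \<le> norm (bop_apply (exp ((t - s) *\<^sub>R B)) (bop_apply (A - B) x))"
      by (rule contraction) (use contr s in auto)
    also have "\<dots> \<le> norm (bop_apply (A - B) x)"
      by (rule contraction) (use contr s in auto)
    finally show "norm (bop_apply (exp (s *\<^sub>R A) * exp ((t - s) *\<^sub>R B) * (A - B)) x)
        \<le> norm (bop_apply (A - B) x)" by simp
  qed
  then show ?thesis by (simp add: bop.diff_left mult.commute)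
qed

section \<open>Self-adjoint operators and their resolvents\<close>

text \<open>
  The projection argument: a minimizing sequence for the distance from the point to the subspace is
  Cauchy by the parallelogram law, and the difference of the point and the limit is orthogonal to the
  subspace.
\<close>

lemma exists_orthogonal_to_proper_closed_subspace:
  fixes M :: "'a::{real_inner,banach} set"
  assumes "closed M" "subspace M" "x \<notin> M"
  obtains y where "y \<noteq> 0" "\<And>z. z \<in> M \<Longrightarrow> inner y z = 0"
proof -
  define d where "d = infdist x M"
  have ne: "M \<noteq> {}" using subspace_0[OF \<open>subspace M\<close>] by blast
  have d0: "0 \<le> d" by (simp add: d_def infdist_nonneg)
  have lower: "d\<^sup>2 \<le> (norm (x - z))\<^sup>2" if "z \<in> M" for z
    using infdist_le[OF that, of x] d0 by (simp add: d_def dist_norm power_mono)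
  have "\<exists>m\<in>M. (norm (x - m))\<^sup>2 < d\<^sup>2 + inverse (real (Suc k))" for k
  proof -
    have "d < sqrt (d\<^sup>2 + inverse (real (Suc k)))"
      by (rule real_less_rsqrt) simp
    then obtain m where "m \<in> M" "dist x m < sqrt (d\<^sup>2 + inverse (real (Suc k)))"
      unfolding d_def infdist_notempty[OF ne] using ne by (subst (asm) cINF_less_iff) auto
    moreover from this have "(norm (x - m))\<^sup>2 < d\<^sup>2 + inverse (real (Suc k))"
      by (simp add: dist_norm real_less_lsqrt sqrt_ge_absD) (metis norm_ge_zero not_le real_le_lsqrt real_sqrt_le_iff real_sqrt_unique)
    ultimately show ?thesis by blast
  qed
  then obtain m where mM: "\<And>k. m k \<in> M"
    and m: "\<And>k. (norm (x - m k))\<^sup>2 < d\<^sup>2 + inverse (real (Suc k))"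
    by metis
  have parallelogram: "(norm (m k - m l))\<^sup>2 \<le> 2 * inverse (real (Suc k)) + 2 * inverse (real (Suc l))" for k l
  proof -
    have "(1/2) *\<^sub>R (m k + m l) \<in> M"
      using mM \<open>subspace M\<close> by (intro subspace_scale subspace_add) auto
    from lower[OF this] have "4 * d\<^sup>2 \<le> 4 * (norm (x - (1/2) *\<^sub>R (m k + m l)))\<^sup>2"
      by simp
    also have "\<dots> = 2 * (norm (x - m k))\<^sup>2 + 2 * (norm (x - m l))\<^sup>2 - (norm (m k - m l))\<^sup>2"
      by (simp add: power2_norm_eq_inner inner_diff inner_add inner_commute algebra_simps)
    finally show ?thesis using m[of k] m[of l] by linarith
  qed
  have "Cauchy m"
  proof (rule metric_CauchyI)
    fix e :: real assume "0 < e"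
    then obtain N where N: "inverse (real (Suc N)) < e\<^sup>2 / 4"
      using reals_Archimedean[of "e\<^sup>2/4"] by auto
    have "dist (m k) (m l) < e" if "N \<le> k" "N \<le> l" for k l
    proof -
      have "inverse (real (Suc i)) \<le> inverse (real (Suc N))" if "N \<le> i" for i
        using that by (simp add: le_imp_inverse_le)
      from this[OF \<open>N \<le> k\<close>] this[OF \<open>N \<le> l\<close>] have "(norm (m k - m l))\<^sup>2 < e\<^sup>2"
        using parallelogram[of k l] N by linarith
      then show ?thesis using \<open>0 < e\<close> by (simp add: dist_norm power_less_imp_less_base)
    qed
    then show "\<exists>N. \<forall>k\<ge>N. \<forall>l\<ge>N. dist (m k) (m l) < e" by blast
  qed
  then obtain p where p: "m \<longlonglongrightarrow> p"
    using Cauchy_convergent convergent_def by blast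
  have pM: "p \<in> M"
    using closed_sequentially[OF \<open>closed M\<close> _ p] mM by blast
  have "(norm (x - p))\<^sup>2 \<le> d\<^sup>2 + 0"
  proof (rule LIMSEQ_le)
    show "(\<lambda>k. (norm (x - m k))\<^sup>2) \<longlonglongrightarrow> (norm (x - p))\<^sup>2"
      by (intro tendsto_intros p)
    show "(\<lambda>k. d\<^sup>2 + inverse (real (Suc k))) \<longlonglongrightarrow> d\<^sup>2 + 0"
      by (intro tendsto_intros LIMSEQ_inverse_real_of_nat)
  qed (use m less_imp_le in blast)
  then have minimal: "(norm (x - p))\<^sup>2 \<le> (norm (x - p - z))\<^sup>2" if "z \<in> M" for z
  proof -
    have "d\<^sup>2 \<le> (norm (x - (p + z)))\<^sup>2"
      using that pM \<open>subspace M\<close> by (intro lower subspace_add)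
    then show ?thesis
      using \<open>(norm (x - p))\<^sup>2 \<le> d\<^sup>2 + 0\<close> by (simp only: diff_diff_eq add_0_right)
  qed
  show thesis
  proof
    show "x - p \<noteq> 0" using pM \<open>x \<notin> M\<close> by auto
    fix z assume "z \<in> M"
    show "inner (x - p) z = 0"
    proof (cases "z = 0")
      case False
      define t where "t = inner (x - p) z / inner z z"
      have "(norm (x - p))\<^sup>2 \<le> (norm (x - p - t *\<^sub>R z))\<^sup>2"
        using \<open>z \<in> M\<close> \<open>subspace M\<close> by (intro minimal subspace_scale)
      also have "\<dots> = (norm (x - p))\<^sup>2 - 2 * t * inner (x - p) z + t\<^sup>2 * inner z z"
        unfolding power2_norm_eq_inner by (simp add: inner_diff inner_commute power2_eq_square algebra_simps)
      also have "\<dots> = (norm (x - p))\<^sup>2 - (inner (x - p) z)\<^sup>2 / inner z z"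
        using False by (simp add: t_def power2_eq_square field_simps)
      finally have "(inner (x - p) z)\<^sup>2 / inner z z \<le> 0" by simp
      moreover have "0 < inner z z" using False by simp
      ultimately show ?thesis by (simp add: divide_le_0_iff)
    qed simp
  qed
qed

text \<open>
  Operators are given by their graphs. In a real Hilbert space the equation \<open>G = G\<^sup>*\<close> makes \<open>G\<close> a
  closed linear subspace, as the lemmas of this locale show.
\<close>

locale self_adjoint_graph =
  fixes G :: "('a::{real_inner,banach,perfect_space} \<times> 'a) set"
  assumes mem_iff: "(f, g) \<in> G \<longleftrightarrow> (\<forall>(u, v)\<in>G. inner v f = inner u g)"
    and dense: "closure (Domain G) = UNIV"
begin

lemma symmetric: "(f, g) \<in> G \<Longrightarrow> (u, v) \<in> G \<Longrightarrow> inner v f = inner u g"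
  using mem_iff by blast

lemma memI: "(\<And>u v. (u, v) \<in> G \<Longrightarrow> inner v f = inner u g) \<Longrightarrow> (f, g) \<in> G"
  using mem_iff by blast

lemma zero: "(0, 0) \<in> G"
  by (rule memI) simp

lemma add: "(f, g) \<in> G \<Longrightarrow> (f', g') \<in> G \<Longrightarrow> (f + f', g + g') \<in> G"
  by (rule memI) (simp add: inner_add_right symmetric)

lemma scale: "(f, g) \<in> G \<Longrightarrow> (r *\<^sub>R f, r *\<^sub>R g) \<in> G"
  by (rule memI) (simp add: symmetric)

lemma diff: "(f, g) \<in> G \<Longrightarrow> (f', g') \<in> G \<Longrightarrow> (f - f', g - g') \<in> G"
  by (rule memI) (simp add: inner_diff_right symmetric)

lemma closed_limit:
  assumes "\<And>k. (f k, g k) \<in> G" "f \<longlonglongrightarrow> F" "g \<longlonglongrightarrow> K"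
  shows "(F, K) \<in> G"
proof (rule memI)
  fix u v assume "(u, v) \<in> G"
  then have eq: "inner v (f k) = inner u (g k)" for k
    using assms(1) symmetric by blast
  have "(\<lambda>k. inner v (f k)) \<longlonglongrightarrow> inner v F" "(\<lambda>k. inner u (g k)) \<longlonglongrightarrow> inner u K"
    by (intro tendsto_intros assms)+
  then show "inner v F = inner u K"
    unfolding eq using LIMSEQ_unique by blast
qed

lemma approximate_from_domain:
  assumes "0 < e"
  obtains f' g' where "(f', g') \<in> G" "norm (f - f') < e"
proof -
  have "f \<in> closure (Domain G)" by (simp add: dense)
  then obtain f' where "f' \<in> Domain G" "dist f' f < e"
    using assms closure_approachable by blast
  then show thesis using that by (auto simp: dist_norm norm_minus_commute)
qed

end

text \<open>
  The nonnegative case carries the construction of the semigroup; a lower bound other than zero is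
  dealt with by a shift afterwards.
\<close>

locale nonneg_self_adjoint_graph = self_adjoint_graph +
  assumes nonneg: "(f, g) \<in> G \<Longrightarrow> 0 \<le> inner g f"
begin

lemma coercive:
  assumes "0 < n" "(f, g) \<in> G"
  shows "n * norm f \<le> norm (g + n *\<^sub>R f)"
proof (cases "f = 0")
  case False
  have "n * norm f * norm f \<le> inner (g + n *\<^sub>R f) f"
    using nonneg[OF assms(2)] by (simp add: inner_add_left mult.assoc flip: power2_norm_eq_inner power2_eq_square)
  also have "\<dots> \<le> norm (g + n *\<^sub>R f) * norm f"
    by (rule norm_cauchy_schwarz)
  finally show ?thesis using False by simp
qed simp

text \<open>
  The range of \<open>n + G\<close> is closed because \<open>n + G\<close> is bounded from below and \<open>G\<close> is closed. A vector
  orthogonal to the range is in the domain of the adjoint, that is of \<open>G\<close>, and is annihilated by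
  \<open>n + G\<close>, so it is zero.
\<close>

lemma shifted_surjective:
  assumes "0 < n"
  shows "\<exists>f. (f, h - n *\<^sub>R f) \<in> G"
proof -
  define M where "M = {h. \<exists>f. (f, h - n *\<^sub>R f) \<in> G}"
  have "subspace M"
    unfolding subspace_def
  proof (intro conjI ballI allI)
    show "0 \<in> M" unfolding M_def using zero by (auto intro: exI[of _ 0])
  next
    fix x y assume "x \<in> M" "y \<in> M"
    then obtain f f' where "(f, x - n *\<^sub>R f) \<in> G" "(f', y - n *\<^sub>R f') \<in> G"
      unfolding M_def by blast
    from add[OF this] show "x + y \<in> M"
      unfolding M_def by (intro CollectI exI[of _ "f + f'"]) (simp add: algebra_simps)
  next
    fix c x assume "x \<in> M"
    then obtain f where "(f, x - n *\<^sub>R f) \<in> G"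
      unfolding M_def by blast
    from scale[OF this, of c] show "c *\<^sub>R x \<in> M"
      unfolding M_def by (intro CollectI exI[of _ "c *\<^sub>R f"]) (simp add: algebra_simps)
  qed
  moreover have "closed M"
    unfolding closed_sequential_limits
  proof (intro allI impI)
    fix X l assume X: "(\<forall>k. X k \<in> M) \<and> X \<longlonglongrightarrow> l"
    then have "\<forall>k. \<exists>f. (f, X k - n *\<^sub>R f) \<in> G"
      unfolding M_def by blast
    then obtain F where F: "\<And>k. (F k, X k - n *\<^sub>R F k) \<in> G" by metis
    have estimate: "n * dist (F k) (F j) \<le> dist (X k) (X j)" for k j
      using coercive[OF assms diff[OF F[of k] F[of j]]] by (simp add: dist_norm algebra_simps)
    have "Cauchy F"
    proof (rule metric_CauchyI)
      fix e :: real assume "0 < e"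
      then have "0 < n * e" using assms by simp
      moreover have "Cauchy X" using X LIMSEQ_imp_Cauchy by blast
      ultimately obtain N where "\<forall>k\<ge>N. \<forall>j\<ge>N. dist (X k) (X j) < n * e"
        using metric_CauchyD by blast
      then have "\<forall>k\<ge>N. \<forall>j\<ge>N. n * dist (F k) (F j) < n * e"
        using estimate le_less_trans by blast
      then show "\<exists>N. \<forall>k\<ge>N. \<forall>j\<ge>N. dist (F k) (F j) < e"
        using assms by auto
    qed
    then obtain f where f: "F \<longlonglongrightarrow> f"
      using Cauchy_convergent convergent_def by blast
    have "(f, l - n *\<^sub>R f) \<in> G"
      using X f by (intro closed_limit[OF F]) (auto intro!: tendsto_intros)
    then show "l \<in> M" unfolding M_def by blast
  qed
  moreover have "y = 0" if orth: "\<And>z. z \<in> M \<Longrightarrow> inner y z = 0" for y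
  proof -
    have "(y, - (n *\<^sub>R y)) \<in> G"
    proof (rule memI)
      fix u v assume "(u, v) \<in> G"
      then have "v + n *\<^sub>R u \<in> M" unfolding M_def by (auto intro: exI[of _ u])
      from orth[OF this] show "inner v y = inner u (- (n *\<^sub>R y))"
        by (simp add: inner_add_right inner_commute)
    qed
    from coercive[OF assms this] assms show ?thesis
      by (simp add: mult_le_0_iff)
  qed
  ultimately have "h \<in> M"
    using exists_orthogonal_to_proper_closed_subspace by blast
  then show ?thesis unfolding M_def by blast
qed

text \<open>
  The resolvent \<open>(n + G)\<^sup>-\<^sup>1\<close>.
\<close>

definition res :: "real \<Rightarrow> 'a \<Rightarrow> 'a" where
  "res n h = (SOME f. (f, h - n *\<^sub>R f) \<in> G)"

lemma res_mem: "0 < n \<Longrightarrow> (res n h, h - n *\<^sub>R res n h) \<in> G"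
  unfolding res_def by (rule someI_ex[OF shifted_surjective])

lemma res_eqI:
  assumes "0 < n" "(f, h - n *\<^sub>R f) \<in> G"
  shows "res n h = f"
  using coercive[OF assms(1) diff[OF res_mem[OF assms(1), of h] assms(2)]] assms(1)
  by (simp add: algebra_simps mult_le_0_iff)

lemma res_symmetric: "0 < n \<Longrightarrow> inner (res n h) k = inner h (res n k)"
  using symmetric[OF res_mem[of n h] res_mem[of n k]] by (simp add: inner_diff inner_commute)

lemma norm_res_le: "0 < n \<Longrightarrow> n * norm (res n h) \<le> norm h"
  using coercive[OF _ res_mem[of n h], of n] by simp

lemma bounded_linear_res: "0 < n \<Longrightarrow> bounded_linear (res n)"
proof (rule bounded_linear_intro)
  assume n: "0 < n"
  show "res n (x + y) = res n x + res n y" for x y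
    using add[OF res_mem[OF n, of x] res_mem[OF n, of y]]
    by (intro res_eqI n) (simp add: algebra_simps)
  show "res n (r *\<^sub>R x) = r *\<^sub>R res n x" for r x
    using scale[OF res_mem[OF n, of x], of r] by (intro res_eqI n) (simp add: algebra_simps)
  show "norm (res n x) \<le> norm x * inverse n" for x
    using norm_res_le[OF n, of x] n by (simp add: field_simps)
qed

lemma res_commutes:
  assumes "bounded_linear J" "\<And>f g. (f, g) \<in> G \<Longrightarrow> (J f, J g) \<in> G" "0 < n"
  shows "res n (J h) = J (res n h)"
  using assms(2)[OF res_mem[OF assms(3), of h]] assms(1,3)
  by (intro res_eqI) (simp_all add: linear_diff linear_scale bounded_linear.linear)

lemma res_image:
  assumes "0 < n" "(f, g) \<in> G"
  shows "res n g = f - n *\<^sub>R res n f"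
proof -
  have "res n (g + n *\<^sub>R f) = f"
    by (rule res_eqI) (use assms in auto)
  then show ?thesis
    using bounded_linear_res[OF assms(1)]
    by (simp add: linear_add linear_scale bounded_linear.linear eq_diff_eq)
qed

lemma res_res_commute:
  assumes "0 < m" "0 < n"
  shows "res m (res n h) = res n (res m h)"
proof (rule res_commutes[OF bounded_linear_res[OF assms(2)] _ assms(1), symmetric, THEN sym])
  fix f g assume fg: "(f, g) \<in> G"
  show "(res n f, res n g) \<in> G"
    using res_mem[OF assms(2), of f] by (simp add: res_image[OF assms(2) fg])
qed

text \<open>
  The contraction \<open>n (n + G)\<^sup>-\<^sup>1\<close> tends strongly to the identity as \<open>n\<close> grows, and
  \<open>yosida n\<close> is the bounded approximation of \<open>-G\<close>.
\<close>

definition contr :: "real \<Rightarrow> 'a bop" where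
  "contr n = bop_of (\<lambda>h. n *\<^sub>R res n h)"

definition yosida :: "real \<Rightarrow> 'a bop" where
  "yosida n = n *\<^sub>R (contr n - 1)"

lemma contr_apply: "0 < n \<Longrightarrow> bop_apply (contr n) h = n *\<^sub>R res n h"
  unfolding contr_def
  by (subst bop_apply_bop_of) (auto intro: bounded_linear_const_scaleR bounded_linear_res)

lemma norm_contr_apply_le: "0 < n \<Longrightarrow> norm (bop_apply (contr n) h) \<le> norm h"
  using norm_res_le[of n h] by (simp add: contr_apply)

lemma norm_contr_le: "0 < n \<Longrightarrow> norm (contr n) \<le> 1"
  by (rule norm_bop_le) (simp_all add: norm_contr_apply_le)

lemma yosida_apply: "0 < n \<Longrightarrow> bop_apply (yosida n) h = n *\<^sub>R (n *\<^sub>R res n h - h)"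
  by (simp add: yosida_def contr_apply bop.scaleR_left bop.diff_left)

text \<open>
  On the domain, \<open>yosida n\<close> is \<open>-G\<close> followed by the contraction.
\<close>

lemma yosida_graph: "0 < n \<Longrightarrow> (f, g) \<in> G \<Longrightarrow> bop_apply (yosida n) f = - bop_apply (contr n) g"
proof -
  assume n: "0 < n" and fg: "(f, g) \<in> G"
  show ?thesis
    using n by (simp add: yosida_apply contr_apply res_image[OF n fg] algebra_simps)
qed

lemma norm_yosida_graph_le: "0 < n \<Longrightarrow> (f, g) \<in> G \<Longrightarrow> norm (bop_apply (yosida n) f) \<le> norm g"
  using norm_contr_apply_le by (simp add: yosida_graph)

lemma yosida_symmetric: "0 < n \<Longrightarrow> inner (bop_apply (yosida n) x) y = inner x (bop_apply (yosida n) y)"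
  by (simp add: yosida_apply inner_diff res_symmetric)

lemma yosida_commute: "0 < m \<Longrightarrow> 0 < n \<Longrightarrow> yosida m * yosida n = yosida n * yosida m"
proof (rule bop_eqI)
  fix x assume "0 < m" "0 < n"
  then show "bop_apply (yosida m * yosida n) x = bop_apply (yosida n * yosida m) x"
    using bounded_linear_res[of n] bounded_linear_res[of m]
    by (simp add: yosida_apply linear_diff linear_scale bounded_linear.linear res_res_commute algebra_simps)
qed

text \<open>
  On the domain the difference to the identity is of order \<open>1/n\<close>; contractivity extends the
  convergence from the domain to its closure.
\<close>

lemma contr_tendsto: "(\<lambda>k. bop_apply (contr (real (Suc k))) g) \<longlonglongrightarrow> g"
proof (rule metric_LIMSEQ_I)
  fix e :: real assume "0 < e"
  then obtain g' k' where gk: "(g', k') \<in> G" and near: "norm (g - g') < e / 4"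
    using approximate_from_domain[of "e/4" g] by auto
  have pos: "0 < norm k' + 1" by (simp add: add_nonneg_pos)
  then obtain N where N: "inverse (real (Suc N)) < e / 2 / (norm k' + 1)"
    using \<open>0 < e\<close> reals_Archimedean[of "e / 2 / (norm k' + 1)"] by auto
  have "dist (bop_apply (contr (real (Suc k))) g) g < e" if "N \<le> k" for k
  proof -
    let ?n = "real (Suc k)"
    have "?n *\<^sub>R (bop_apply (contr ?n) g' - g') = - bop_apply (contr ?n) k'"
      using yosida_graph[OF _ gk, of ?n] by (simp add: yosida_def bop.scaleR_left bop.diff_left)
    then have "bop_apply (contr ?n) g' - g' = inverse ?n *\<^sub>R (- bop_apply (contr ?n) k')"
      by (metis of_nat_neq_0 inverse_nonzero_iff_nonzero left_inverse scaleR_one scaleR_scaleR)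
    then have "norm (bop_apply (contr ?n) g' - g') \<le> inverse ?n * norm k'"
      using norm_contr_apply_le[of ?n k'] by (simp add: mult_left_mono)
    also have "\<dots> \<le> inverse (real (Suc N)) * (norm k' + 1)"
      using that by (intro mult_mono) (auto intro: le_imp_inverse_le)
    also have "\<dots> < e / 2"
      using N pos by (simp only: pos_less_divide_eq)
    finally have 1: "norm (bop_apply (contr ?n) g' - g') < e / 2" .
    have "bop_apply (contr ?n) g - g
        = bop_apply (contr ?n) (g - g') + (bop_apply (contr ?n) g' - g') - (g - g')"
      by (simp add: bop.diff_right)
    also have "norm \<dots> \<le> norm (bop_apply (contr ?n) (g - g')) + norm (bop_apply (contr ?n) g' - g') + norm (g - g')"
      by (meson norm_triangle_ineq norm_triangle_ineq4 order_trans add_right_mono)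
    finally show ?thesis
      using norm_contr_apply_le[of ?n "g - g'"] near 1 by (simp add: dist_norm)
  qed
  then show "\<exists>N. \<forall>k\<ge>N. dist (bop_apply (contr (real (Suc k))) g) g < e" by blast
qed

end

section \<open>The semigroup generated by a self-adjoint operator\<close>

definition c0_semigroup :: "(real \<Rightarrow> 'a::real_normed_vector \<Rightarrow> 'a) \<Rightarrow> bool" where
  "c0_semigroup T \<longleftrightarrow>
     (\<forall>t\<ge>0. bounded_linear (T t)) \<and> (\<forall>f. T 0 f = f) \<and>
     (\<forall>s\<ge>0. \<forall>t\<ge>0. \<forall>f. T (s + t) f = T s (T t f)) \<and>
     (\<forall>f. ((\<lambda>h. T h f) \<longlongrightarrow> f) (at_right 0))"

definition c0_generator :: "(real \<Rightarrow> 'a::real_normed_vector \<Rightarrow> 'a) \<Rightarrow> ('a \<times> 'a) set" where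
  "c0_generator T = {(f, g). ((\<lambda>h. (T h f - f) /\<^sub>R h) \<longlongrightarrow> g) (at_right 0)}"

context nonneg_self_adjoint_graph
begin

text \<open>
  The Yosida approximations of the semigroup and their strong limit.
\<close>

definition approx :: "nat \<Rightarrow> real \<Rightarrow> 'a \<Rightarrow> 'a" where
  "approx k t = bop_apply (exp (t *\<^sub>R yosida (real (Suc k))))"

definition sgroup :: "real \<Rightarrow> 'a \<Rightarrow> 'a" where
  "sgroup t f = lim (\<lambda>k. approx k t f)"

lemma norm_exp_yosida_le: "0 < n \<Longrightarrow> 0 \<le> t \<Longrightarrow> norm (exp (t *\<^sub>R yosida n)) \<le> 1"
  using norm_exp_dissipative_le[OF norm_contr_le[of n], of "t * n"] by (simp add: yosida_def)

lemma norm_approx_le: "0 \<le> t \<Longrightarrow> norm (approx k t f) \<le> norm f"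
  using norm_bop_apply_le[of "exp (t *\<^sub>R yosida (real (Suc k)))" f]
    mult_right_mono[OF norm_exp_yosida_le[of "real (Suc k)" t], of "norm f"]
  by (simp add: approx_def)

lemma approx_diff: "approx k t (f - g) = approx k t f - approx k t g"
  by (simp add: approx_def bop.diff_right)

lemma approx_add_time: "approx k (s + t) f = approx k s (approx k t f)"
  by (simp add: approx_def scaleR_add_left exp_add_commuting)

lemma approx_dist_le:
  assumes "0 \<le> t" "(f, g) \<in> G"
  shows "norm (approx k t f - approx l t f)
    \<le> t * norm (bop_apply (contr (real (Suc k))) g - bop_apply (contr (real (Suc l))) g)"
proof -
  have "norm (approx k t f - approx l t f)
    \<le> t * norm (bop_apply (yosida (real (Suc k))) f - bop_apply (yosida (real (Suc l))) f)"
    unfolding approx_def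
    by (rule exp_contraction_diff_le) (use assms in \<open>auto intro: yosida_commute norm_exp_yosida_le\<close>)
  then show ?thesis
    using assms(2) by (simp add: yosida_graph norm_minus_commute)
qed

text \<open>
  For \<open>f\<close> in the domain, \<open>approx_dist_le\<close> bounds the distance of two approximations by the distance of
  two terms of the convergent sequence \<open>contr\<close>, so the approximations form a Cauchy sequence. General
  vectors are approximated from the domain, using that all operators involved are contractions.
\<close>

lemma approx_tendsto:
  assumes "0 \<le> t"
  shows "(\<lambda>k. approx k t f) \<longlonglongrightarrow> sgroup t f"
proof -
  have "Cauchy (\<lambda>k. approx k t f)"
  proof (rule metric_CauchyI)
    fix e :: real assume "0 < e"
    then obtain f' g' where fg: "(f', g') \<in> G" and near: "norm (f - f') < e / 4"
      using approximate_from_domain[of "e/4" f] by auto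
    define c where "c k = bop_apply (contr (real (Suc k))) g'" for k
    have pos: "0 < t + 1" using assms by simp
    have "Cauchy c"
      unfolding c_def using contr_tendsto by (rule LIMSEQ_imp_Cauchy)
    then obtain N where N: "\<And>k l. N \<le> k \<Longrightarrow> N \<le> l \<Longrightarrow> dist (c k) (c l) < e / 2 / (t + 1)"
      using metric_CauchyD[of c "e / 2 / (t + 1)"] \<open>0 < e\<close> pos by auto
    have "dist (approx k t f) (approx l t f) < e" if "N \<le> k" "N \<le> l" for k l
    proof -
      have "norm (approx k t f' - approx l t f') \<le> t * norm (c k - c l)"
        unfolding c_def by (rule approx_dist_le[OF assms fg])
      also have "\<dots> \<le> (t + 1) * norm (c k - c l)"
        by (intro mult_right_mono) auto
      also have "\<dots> < e / 2"
        using N[OF that] pos by (simp only: pos_less_divide_eq dist_norm mult.commute)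
      finally have 1: "norm (approx k t f' - approx l t f') < e / 2" .
      have "approx k t f - approx l t f
          = approx k t (f - f') + (approx k t f' - approx l t f') - approx l t (f - f')"
        by (simp add: approx_diff)
      also have "norm \<dots> \<le> norm (approx k t (f - f')) + norm (approx k t f' - approx l t f')
          + norm (approx l t (f - f'))"
        by (meson norm_triangle_ineq norm_triangle_ineq4 order_trans add_right_mono)
      finally show ?thesis
        using norm_approx_le[OF assms, of k "f - f'"] norm_approx_le[OF assms, of l "f - f'"] near 1
        by (simp add: dist_norm)
    qed
    then show "\<exists>N. \<forall>k\<ge>N. \<forall>l\<ge>N. dist (approx k t f) (approx l t f) < e" by blast
  qed
  then show ?thesis
    unfolding sgroup_def by (simp add: Cauchy_convergent convergent_LIMSEQ_iff[symmetric])
qed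

lemma norm_sgroup_le: "0 \<le> t \<Longrightarrow> norm (sgroup t f) \<le> norm f"
  by (rule LIMSEQ_le_const2[OF tendsto_norm[OF approx_tendsto]]) (auto intro: norm_approx_le)

lemma bounded_linear_sgroup:
  assumes "0 \<le> t"
  shows "bounded_linear (sgroup t)"
proof (rule bounded_linear_intro)
  show "sgroup t (x + y) = sgroup t x + sgroup t y" for x y
    using tendsto_add[OF approx_tendsto[OF assms, of x] approx_tendsto[OF assms, of y]]
      approx_tendsto[OF assms, of "x + y"]
    by (simp add: approx_def bop.add_right LIMSEQ_unique)
  show "sgroup t (r *\<^sub>R x) = r *\<^sub>R sgroup t x" for r x
    using tendsto_scaleR[OF tendsto_const approx_tendsto[OF assms, of x], of r]
      approx_tendsto[OF assms, of "r *\<^sub>R x"]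
    by (simp add: approx_def bop.scaleR_right LIMSEQ_unique)
  show "norm (sgroup t x) \<le> norm x * 1" for x
    using norm_sgroup_le[OF assms] by simp
qed

lemma sgroup_symmetric:
  assumes "0 \<le> t"
  shows "inner (sgroup t x) y = inner x (sgroup t y)"
proof -
  have "inner (approx k t x) y = inner x (approx k t y)" for k
    unfolding approx_def by (rule exp_symmetric) (simp add: bop.scaleR_left yosida_symmetric)
  moreover have "(\<lambda>k. inner (approx k t x) y) \<longlonglongrightarrow> inner (sgroup t x) y"
    "(\<lambda>k. inner x (approx k t y)) \<longlonglongrightarrow> inner x (sgroup t y)"
    by (intro tendsto_intros approx_tendsto assms)+
  ultimately show ?thesis by (simp add: LIMSEQ_unique)
qed

lemma sgroup_commutes:
  assumes J: "bounded_linear J" "\<And>f g. (f, g) \<in> G \<Longrightarrow> (J f, J g) \<in> G" and "0 \<le> t"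
  shows "sgroup t (J h) = J (sgroup t h)"
proof -
  have "approx k t (J h) = J (approx k t h)" for k
  proof -
    let ?A = "t *\<^sub>R yosida (real (Suc k))"
    have "?A * bop_of J = bop_of J * ?A"
      using J(1) by (intro bop_eqI)
        (simp add: bop_apply_bop_of bop.scaleR_left yosida_apply linear_diff linear_scale
          bounded_linear.linear res_commutes[OF J])
    from exp_commutes[OF this] have "bop_apply (exp ?A * bop_of J) h = bop_apply (bop_of J * exp ?A) h"
      by simp
    then show ?thesis by (simp add: approx_def bop_apply_bop_of[OF J(1)])
  qed
  moreover have "(\<lambda>k. J (approx k t h)) \<longlonglongrightarrow> J (sgroup t h)"
    by (intro bounded_linear.tendsto[OF J(1)] approx_tendsto assms)
  ultimately show ?thesis
    using approx_tendsto[OF \<open>0 \<le> t\<close>, of "J h"] by (simp add: LIMSEQ_unique)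
qed

lemma sgroup_zero: "sgroup 0 f = f"
  using approx_tendsto[of 0 f] by (simp add: approx_def LIMSEQ_const_iff)

lemma sgroup_add:
  assumes "0 \<le> s" "0 \<le> t"
  shows "sgroup (s + t) f = sgroup s (sgroup t f)"
proof -
  have "(\<lambda>k. approx k s (approx k t f - sgroup t f)) \<longlonglongrightarrow> 0"
  proof (rule Lim_null_comparison)
    show "\<forall>\<^sub>F k in sequentially. norm (approx k s (approx k t f - sgroup t f))
        \<le> norm (approx k t f - sgroup t f)"
      by (simp add: norm_approx_le assms)
    show "(\<lambda>k. norm (approx k t f - sgroup t f)) \<longlonglongrightarrow> 0"
      using approx_tendsto[OF assms(2), of f] by (simp add: LIM_zero tendsto_norm_zero)
  qed
  from tendsto_add[OF this approx_tendsto[OF assms(1), of "sgroup t f"]]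
  have "(\<lambda>k. approx k (s + t) f) \<longlonglongrightarrow> sgroup s (sgroup t f)"
    by (simp add: approx_diff approx_add_time)
  then show ?thesis
    using approx_tendsto[of "s + t" f] assms by (simp add: LIMSEQ_unique)
qed

text \<open>
  The bound is uniform in \<open>k\<close>, which gives strong continuity at zero of the limit.
\<close>

lemma approx_near_identity:
  assumes "0 \<le> s" "(g', k') \<in> G"
  shows "norm (approx k s g - g) \<le> 2 * norm (g - g') + s * norm k'"
proof -
  have "norm (approx k s g' - bop_apply (exp (s *\<^sub>R 0)) g')
      \<le> s * norm (bop_apply (yosida (real (Suc k))) g' - bop_apply 0 g')"
    unfolding approx_def
    by (rule exp_contraction_diff_le) (use assms in \<open>auto intro: norm_exp_yosida_le\<close>)
  also have "\<dots> \<le> s * norm k'"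
    using assms norm_yosida_graph_le[of "real (Suc k)" g' k'] by (simp add: bop.zero_left mult_left_mono)
  finally have 1: "norm (approx k s g' - g') \<le> s * norm k'" by simp
  have "approx k s g - g = approx k s (g - g') + (approx k s g' - g') - (g - g')"
    by (simp add: approx_diff)
  also have "norm \<dots> \<le> norm (approx k s (g - g')) + norm (approx k s g' - g') + norm (g - g')"
    by (meson norm_triangle_ineq norm_triangle_ineq4 order_trans add_right_mono)
  finally show ?thesis
    using norm_approx_le[OF assms(1), of k "g - g'"] 1 by simp
qed

lemma sgroup_near_identity:
  assumes "0 \<le> s" "(g', k') \<in> G"
  shows "norm (sgroup s g - g) \<le> 2 * norm (g - g') + s * norm k'"
  by (rule LIMSEQ_le_const2[where X = "\<lambda>k. norm (approx k s g - g)"])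
    (auto intro!: tendsto_intros approx_tendsto approx_near_identity assms)

text \<open>
  This is the differentiability of the limit semigroup at zero: the factor of \<open>h\<close> on the right becomes
  arbitrarily small when \<open>g'\<close> is chosen close to \<open>g\<close> and then \<open>h\<close> small. It is proved first for the
  approximations, where it is a mean value inequality.
\<close>

lemma sgroup_first_order:
  assumes "0 \<le> h" "(f, g) \<in> G" "(g', k') \<in> G"
  shows "norm (sgroup h f - f + h *\<^sub>R g) \<le> (2 * norm (g - g') + h * norm k') * h"
proof -
  define c where "c k = bop_apply (contr (real (Suc k))) g" for k
  have "norm (approx k h f - f + h *\<^sub>R g)
      \<le> (norm (c k - g) + 2 * norm (g - g') + h * norm k') * h" for k
  proof -
    have "norm ((approx k h f + h *\<^sub>R g) - (approx k 0 f + 0 *\<^sub>R g))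
      \<le> (norm (c k - g) + 2 * norm (g - g') + h * norm k') * h"
    proof (rule norm_increment_le[OF \<open>0 \<le> h\<close>, where f = "\<lambda>s. approx k s f + s *\<^sub>R g"])
      fix s assume s: "0 \<le> s" "s \<le> h"
      show "((\<lambda>s. approx k s f + s *\<^sub>R g) has_vector_derivative
          approx k s (bop_apply (yosida (real (Suc k))) f) + g) (at s within {0..h})"
        unfolding approx_def
        by (auto intro!: derivative_eq_intros exp_bop_has_vector_derivative)
      have "approx k s (bop_apply (yosida (real (Suc k))) f) = - approx k s (c k)"
        by (simp add: yosida_graph[OF _ assms(2)] c_def approx_def bop.minus_right)
      then have "approx k s (bop_apply (yosida (real (Suc k))) f) + g
          = - (approx k s (c k - g) + (approx k s g - g))"
        by (simp add: approx_diff)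
      then have "norm (approx k s (bop_apply (yosida (real (Suc k))) f) + g)
          \<le> norm (approx k s (c k - g)) + norm (approx k s g - g)"
        by (metis norm_minus_cancel norm_triangle_ineq)
      also have "\<dots> \<le> norm (c k - g) + (2 * norm (g - g') + s * norm k')"
        using s assms by (intro add_mono norm_approx_le approx_near_identity)
      also have "\<dots> \<le> norm (c k - g) + 2 * norm (g - g') + h * norm k'"
        using s by (simp add: mult_right_mono)
      finally show "norm (approx k s (bop_apply (yosida (real (Suc k))) f) + g)
          \<le> norm (c k - g) + 2 * norm (g - g') + h * norm k'" .
    qed
    then show ?thesis by (simp add: approx_def algebra_simps)
  qed
  moreover have "(\<lambda>k. norm (approx k h f - f + h *\<^sub>R g)) \<longlonglongrightarrow> norm (sgroup h f - f + h *\<^sub>R g)"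
    by (intro tendsto_intros approx_tendsto assms)
  moreover have "(\<lambda>k. (norm (c k - g) + 2 * norm (g - g') + h * norm k') * h)
      \<longlonglongrightarrow> (norm (g - g) + 2 * norm (g - g') + h * norm k') * h"
    unfolding c_def by (intro tendsto_intros contr_tendsto)
  ultimately show ?thesis
    using LIMSEQ_le[of "\<lambda>k. norm (approx k h f - f + h *\<^sub>R g)"] by auto
qed

lemma tendsto_0_by_approximation:
  assumes "\<And>h g' k'. 0 < h \<Longrightarrow> (g', k') \<in> G \<Longrightarrow> norm (F h) \<le> 2 * norm (g - g') + h * norm k'"
  shows "(F \<longlongrightarrow> 0) (at_right (0::real))"
proof (rule tendstoI)
  fix e :: real assume "0 < e"
  then obtain g' k' where gk: "(g', k') \<in> G" and near: "norm (g - g') < e / 4"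
    using approximate_from_domain[of "e/4" g] by auto
  have "((\<lambda>h. h * norm k') \<longlongrightarrow> 0 * norm k') (at_right (0::real))"
    by (intro tendsto_intros)
  then have "\<forall>\<^sub>F h in at_right (0::real). h * norm k' < e / 2"
    using \<open>0 < e\<close> by (intro order_tendstoD) auto
  moreover have "\<forall>\<^sub>F h in at_right (0::real). 0 < h"
    by (rule eventually_at_right_less)
  ultimately show "\<forall>\<^sub>F h in at_right (0::real). dist (F h) 0 < e"
  proof eventually_elim
    case (elim h)
    then show ?case using assms[OF _ gk, of h] near by simp
  qed
qed

lemma sgroup_strongly_continuous: "((\<lambda>h. sgroup h g) \<longlongrightarrow> g) (at_right 0)"
proof -
  have "((\<lambda>h. sgroup h g - g) \<longlongrightarrow> 0) (at_right 0)"
    by (rule tendsto_0_by_approximation) (rule sgroup_near_identity, auto)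
  then show ?thesis by (rule LIM_zero_cancel)
qed

lemma sgroup_derivative:
  assumes "(f, g) \<in> G"
  shows "((\<lambda>h. (sgroup h f - f) /\<^sub>R h) \<longlongrightarrow> - g) (at_right 0)"
proof -
  have "((\<lambda>h. (sgroup h f - f + h *\<^sub>R g) /\<^sub>R h) \<longlongrightarrow> 0) (at_right 0)"
  proof (rule tendsto_0_by_approximation)
    fix h :: real and g' k' assume h: "0 < h" and gk: "(g', k') \<in> G"
    show "norm ((sgroup h f - f + h *\<^sub>R g) /\<^sub>R h) \<le> 2 * norm (g - g') + h * norm k'"
      using sgroup_first_order[OF less_imp_le[OF h] assms gk] h
      by (simp add: divide_le_eq flip: divide_inverse_commute)
  qed
  moreover have "\<forall>\<^sub>F h in at_right (0::real). (sgroup h f - f + h *\<^sub>R g) /\<^sub>R h = (sgroup h f - f) /\<^sub>R h - - g"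
    using eventually_at_right_less[of "0::real"]
    by eventually_elim (simp add: scaleR_add_right)
  ultimately have "((\<lambda>h. (sgroup h f - f) /\<^sub>R h - - g) \<longlongrightarrow> 0) (at_right 0)"
    by (simp cong: tendsto_cong)
  then show ?thesis by (rule LIM_zero_cancel)
qed

end

text \<open>
  The generator of a symmetric semigroup is symmetric. Since it extends \<open>-G\<close>, it is contained in the
  adjoint of \<open>-G\<close>, which is \<open>-G\<close>: a self-adjoint operator has no proper symmetric extension.
\<close>

lemma (in self_adjoint_graph) generator_of_symmetric_semigroup:
  assumes sym: "\<And>t x y. 0 \<le> t \<Longrightarrow> inner (T t x) y = inner x (T t y)"
    and der: "\<And>f g. (f, g) \<in> G \<Longrightarrow> ((\<lambda>h. (T h f - f) /\<^sub>R h) \<longlongrightarrow> - g) (at_right 0)"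
  shows "(f, g) \<in> c0_generator T \<longleftrightarrow> (f, - g) \<in> G"
proof
  assume "(f, - g) \<in> G"
  from der[OF this] show "(f, g) \<in> c0_generator T" by (simp add: c0_generator_def)
next
  assume "(f, g) \<in> c0_generator T"
  then have lim: "((\<lambda>h. (T h f - f) /\<^sub>R h) \<longlongrightarrow> g) (at_right 0)"
    by (simp add: c0_generator_def)
  show "(f, - g) \<in> G"
  proof (rule memI)
    fix u v assume uv: "(u, v) \<in> G"
    have "((\<lambda>h. inner u ((T h f - f) /\<^sub>R h)) \<longlongrightarrow> inner u g) (at_right 0)"
      by (intro tendsto_intros lim)
    moreover have "\<forall>\<^sub>F h in at_right (0::real).
        inner u ((T h f - f) /\<^sub>R h) = inner ((T h u - u) /\<^sub>R h) f"
      using eventually_at_right_less[of "0::real"]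
      by eventually_elim (simp add: inner_diff sym)
    ultimately have "((\<lambda>h. inner ((T h u - u) /\<^sub>R h) f) \<longlongrightarrow> inner u g) (at_right 0)"
      by (rule Lim_transform_eventually)
    moreover have "((\<lambda>h. inner ((T h u - u) /\<^sub>R h) f) \<longlongrightarrow> inner (- v) f) (at_right 0)"
      by (intro tendsto_intros der uv)
    ultimately have "inner u g = inner (- v) f"
      using tendsto_unique trivial_limit_at_right_real by blast
    then show "inner v f = inner u (- g)" by simp
  qed
qed

text \<open>
  Subtracting the lower bound \<open>c\<close> leads to the nonnegative case; the semigroup obtained there is
  multiplied by \<open>e\<^bsup>-ct\<^esup>\<close>. The last conclusion says that the semigroup commutes with the bounded
  operators that commute with \<open>G\<close>; it is what makes the semigroup complex linear when \<open>G\<close> is.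
\<close>

theorem (in self_adjoint_graph) semigroup_exists:
  assumes bounded_below: "\<And>f g. (f, g) \<in> G \<Longrightarrow> c * (norm f)\<^sup>2 \<le> inner g f"
  obtains T where "c0_semigroup T"
    and "\<And>f g. (f, g) \<in> c0_generator T \<longleftrightarrow> (f, - g) \<in> G"
    and "\<And>J t h. bounded_linear J \<Longrightarrow> (\<And>f g. (f, g) \<in> G \<Longrightarrow> (J f, J g) \<in> G) \<Longrightarrow> 0 \<le> t
      \<Longrightarrow> T t (J h) = J (T t h)"
proof -
  define G' where "G' = {(f, g). (f, g + c *\<^sub>R f) \<in> G}"
  have G'_iff: "(f, g) \<in> G' \<longleftrightarrow> (f, g + c *\<^sub>R f) \<in> G" for f g by (simp add: G'_def)
  interpret G': nonneg_self_adjoint_graph G'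
  proof
    show "(f, g) \<in> G' \<longleftrightarrow> (\<forall>(u, v)\<in>G'. inner v f = inner u g)" for f g
    proof -
      have "(\<forall>(u, v)\<in>G'. inner v f = inner u g) \<longleftrightarrow> (\<forall>(u, v)\<in>G. inner v f = inner u (g + c *\<^sub>R f))"
      proof safe
        fix u v assume *: "\<forall>(u, v)\<in>G'. inner v f = inner u g" "(u, v) \<in> G"
        then have "(u, v - c *\<^sub>R u) \<in> G'" by (simp add: G'_iff)
        with * have "inner (v - c *\<^sub>R u) f = inner u g" by blast
        then show "inner v f = inner u (g + c *\<^sub>R f)" by (simp add: inner_diff inner_add algebra_simps)
      next
        fix u v assume *: "\<forall>(u, v)\<in>G. inner v f = inner u (g + c *\<^sub>R f)" "(u, v) \<in> G'"
        then have "inner (v + c *\<^sub>R u) f = inner u (g + c *\<^sub>R f)" using G'_iff by blast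
        then show "inner v f = inner u g" by (simp add: inner_diff inner_add algebra_simps)
      qed
      then show ?thesis unfolding G'_iff by (simp add: mem_iff)
    qed
    have "f \<in> Domain G'" if "(f, g) \<in> G" for f g
      using that by (auto simp: G'_iff Domain_iff intro: exI[of _ "g - c *\<^sub>R f"])
    moreover have "f \<in> Domain G" if "(f, g) \<in> G'" for f g
      using that by (auto simp: G'_iff)
    ultimately have "Domain G' = Domain G" by blast
    then show "closure (Domain G') = UNIV" by (simp add: dense)
    show "0 \<le> inner g f" if "(f, g) \<in> G'" for f g
      using bounded_below[of f "g + c *\<^sub>R f"] that by (simp add: G'_iff inner_add power2_norm_eq_inner)
  qed
  define T where "T t f = exp (- (c * t)) *\<^sub>R G'.sgroup t f" for t f
  have sym: "inner (T t x) y = inner x (T t y)" if "0 \<le> t" for t x y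
    by (simp add: T_def G'.sgroup_symmetric that)
  have der: "((\<lambda>h. (T h f - f) /\<^sub>R h) \<longlongrightarrow> - g) (at_right 0)" if fg: "(f, g) \<in> G" for f g
  proof -
    have "(f, g - c *\<^sub>R f) \<in> G'" using fg by (simp add: G'_iff)
    note S = G'.sgroup_derivative[OF this]
    have "((\<lambda>h. exp (- (c * h))) has_real_derivative - c) (at 0)"
      by (auto intro!: derivative_eq_intros)
    then have "((\<lambda>h. (exp (- (c * h)) - 1) / h) \<longlongrightarrow> - c) (at_right 0)"
      unfolding has_field_derivative_iff by (auto intro: tendsto_mono[rotated] simp: at_le)
    moreover have "((\<lambda>h. exp (- (c * h))) \<longlongrightarrow> exp (- (c * 0))) (at_right 0)"
      by (intro tendsto_intros)
    ultimately have "((\<lambda>h. exp (- (c * h)) *\<^sub>R ((G'.sgroup h f - f) /\<^sub>R h) + ((exp (- (c * h)) - 1) / h) *\<^sub>R f)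
        \<longlongrightarrow> exp (- (c * 0)) *\<^sub>R (- (g - c *\<^sub>R f)) + (- c) *\<^sub>R f) (at_right 0)"
      by (intro tendsto_intros S)
    moreover have "exp (- (c * h)) *\<^sub>R ((G'.sgroup h f - f) /\<^sub>R h) + ((exp (- (c * h)) - 1) / h) *\<^sub>R f
        = (T h f - f) /\<^sub>R h" for h
      by (simp add: T_def algebra_simps divide_inverse)
    ultimately show ?thesis by simp
  qed
  show thesis
  proof
    show "c0_semigroup T"
      unfolding c0_semigroup_def
    proof (intro conjI allI impI)
      show "bounded_linear (T t)" if "0 \<le> t" for t
        unfolding T_def by (intro bounded_linear_const_scaleR G'.bounded_linear_sgroup that)
      show "T 0 f = f" for f by (simp add: T_def G'.sgroup_zero)
      show "T (s + t) f = T s (T t f)" if "0 \<le> s" "0 \<le> t" for s t f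
        using that linear_scale[OF bounded_linear.linear[OF G'.bounded_linear_sgroup[of s]]]
        by (simp add: T_def G'.sgroup_add distrib_left exp_add[symmetric])
      have "((\<lambda>h. T h f) \<longlongrightarrow> exp (- (c * 0)) *\<^sub>R f) (at_right 0)" for f
        unfolding T_def by (intro tendsto_intros G'.sgroup_strongly_continuous)
      then show "((\<lambda>h. T h f) \<longlongrightarrow> f) (at_right 0)" for f by simp
    qed
    show "(f, g) \<in> c0_generator T \<longleftrightarrow> (f, - g) \<in> G" for f g
      by (rule generator_of_symmetric_semigroup[OF sym der])
    show "T t (J h) = J (T t h)"
      if "bounded_linear J" "\<And>f g. (f, g) \<in> G \<Longrightarrow> (J f, J g) \<in> G" "0 \<le> t" for J t h
    proof -
      have "(J f, J g) \<in> G'" if "(f, g) \<in> G'" for f g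
        using that \<open>\<And>f g. (f, g) \<in> G \<Longrightarrow> (J f, J g) \<in> G\<close>[of f "g + c *\<^sub>R f"]
        by (simp add: G'_iff linear_add linear_scale bounded_linear.linear[OF \<open>bounded_linear J\<close>])
      from G'.sgroup_commutes[OF that(1) this that(3)] show ?thesis
        by (simp add: T_def linear_scale bounded_linear.linear[OF \<open>bounded_linear J\<close>])
    qed
  qed
qed

section \<open>Symmetry of a semigroup with symmetric generator\<close>

text \<open>
  The Banach-Steinhaus theorem, from the Baire category theorem: one of the closed sets on which the
  pointwise bound is at most an integer contains a ball.
\<close>

lemma uniform_boundedness:
  fixes A :: "nat \<Rightarrow> 'a::banach \<Rightarrow> 'b::real_normed_vector"
  assumes lin: "\<And>n. bounded_linear (A n)"
    and pointwise: "\<And>x. \<exists>B. \<forall>n. norm (A n x) \<le> B"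
  obtains M where "\<And>n x. norm (A n x) \<le> M * norm x"
proof -
  define C where "C N = {x. \<forall>n. norm (A n x) \<le> real N}" for N
  have "closed (C N)" for N
  proof -
    have "C N = (\<Inter>n. {x. norm (A n x) \<le> real N})" by (auto simp: C_def)
    moreover have "closed {x. norm (A n x) \<le> real N}" for n
      by (intro closed_Collect_le continuous_intros bounded_linear.continuous_on[OF lin])
    ultimately show ?thesis by auto
  qed
  moreover have "(\<Union>N. C N) = UNIV"
  proof -
    have "\<exists>N. x \<in> C N" for x
    proof -
      obtain B where "\<forall>n. norm (A n x) \<le> B" using pointwise by blast
      moreover obtain N where "B \<le> real N" using real_arch_simple by blast
      ultimately show ?thesis by (auto simp: C_def intro: order_trans)
    qed
    then show ?thesis by blast
  qed
  ultimately have "\<exists>N. interior (C N) \<noteq> {}"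
    using Baire_category_alt[of "euclidean :: 'a topology" "range C"]
    by (auto simp: completely_metrizable_space_euclidean simp flip: closed_closedin)
  then obtain N x where "x \<in> interior (C N)" by blast
  then obtain r where "0 < r" and ball: "cball x r \<subseteq> C N"
    by (meson mem_interior_cball)
  have small: "norm (A n y) \<le> 2 * real N" if "norm y \<le> r" for n y
  proof -
    have "x + y \<in> C N" "x \<in> C N"
      using ball that \<open>0 < r\<close> by (auto simp: subset_eq dist_norm)
    then have "norm (A n (x + y)) \<le> real N" "norm (A n x) \<le> real N"
      by (auto simp: C_def)
    moreover have "A n y = A n (x + y) - A n x"
      by (simp add: linear_add bounded_linear.linear[OF lin])
    ultimately show ?thesis
      using norm_triangle_ineq4[of "A n (x + y)" "A n x"] by simp
  qed
  have "norm (A n y) \<le> (2 * real N / r) * norm y" for n y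
  proof (cases "y = 0")
    case False
    have "norm (A n ((r / norm y) *\<^sub>R y)) \<le> 2 * real N"
      using False \<open>0 < r\<close> by (intro small) simp
    then have "(r / norm y) * norm (A n y) \<le> 2 * real N"
      using \<open>0 < r\<close> by (simp add: linear_scale bounded_linear.linear[OF lin])
    then show ?thesis using False \<open>0 < r\<close> by (simp add: field_simps)
  qed (simp add: linear_0 bounded_linear.linear[OF lin])
  then show thesis using that by blast
qed

text \<open>
  Otherwise there are times tending to zero at which the operator norms are unbounded, although the
  operators converge pointwise to the identity along these times. The bound near zero is what yields
  continuity of the orbits from the left.
\<close>

lemma c0_semigroup_locally_bounded:
  fixes T :: "real \<Rightarrow> 'a::banach \<Rightarrow> 'a"
  assumes T: "c0_semigroup T"
  obtains \<epsilon> M where "0 < \<epsilon>" "0 \<le> M" "\<And>t f. 0 \<le> t \<Longrightarrow> t \<le> \<epsilon> \<Longrightarrow> norm (T t f) \<le> M * norm f"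
proof -
  have "\<exists>n. \<forall>t f. 0 \<le> t \<and> t \<le> inverse (real (Suc n)) \<longrightarrow> norm (T t f) \<le> real (Suc n) * norm f"
  proof (rule ccontr)
    assume "\<not> ?thesis"
    then obtain t f where t: "\<And>n. 0 \<le> t n" "\<And>n. t n \<le> inverse (real (Suc n))"
      and big: "\<And>n. real (Suc n) * norm (f n) < norm (T (t n) (f n))"
      by (simp only: not_ex not_all not_imp not_le) metis
    have pos: "0 < t n" for n
    proof (rule ccontr)
      assume "\<not> 0 < t n"
      then have "T (t n) (f n) = f n"
        using t(1)[of n] T by (simp add: c0_semigroup_def)
      then show False using big[of n] by (simp add: mult_less_cancel_right2)
    qed
    have "t \<longlonglongrightarrow> 0"
      by (rule real_tendsto_sandwich[OF _ _ tendsto_const LIMSEQ_inverse_real_of_nat])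
        (use t in auto)
    then have "filterlim t (at_right 0) sequentially"
      by (simp add: filterlim_at pos less_imp_neq[OF pos, symmetric])
    then have lim: "(\<lambda>n. T (t n) x) \<longlonglongrightarrow> x" for x
      using T filterlim_compose unfolding c0_semigroup_def by blast
    have "\<exists>B. \<forall>n. norm (T (t n) x) \<le> B" for x
      using convergent_imp_Bseq[OF convergentI[OF lim[of x]]] by (auto simp: Bseq_def)
    moreover have "bounded_linear (T (t n))" for n
      using T t by (simp add: c0_semigroup_def)
    ultimately obtain M where M: "\<And>n x. norm (T (t n) x) \<le> M * norm x"
      using uniform_boundedness[of "\<lambda>n. T (t n)"] by blast
    obtain n where "M < real n" using reals_Archimedean2 by blast
    then have "M * norm (f n) \<le> real (Suc n) * norm (f n)"
      by (intro mult_right_mono) auto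
    then show False using M[of n "f n"] big[of n] by simp
  qed
  then obtain n where "\<And>t f. 0 \<le> t \<Longrightarrow> t \<le> inverse (real (Suc n)) \<Longrightarrow> norm (T t f) \<le> real (Suc n) * norm f"
    by blast
  then show thesis by (intro that[of "inverse (real (Suc n))" "real (Suc n)"]) auto
qed

lemma c0_generator_commutes:
  assumes T: "c0_semigroup T" and "(f, g) \<in> c0_generator T" "0 \<le> s"
  shows "(T s f, T s g) \<in> c0_generator T"
proof -
  have lin: "bounded_linear (T s)" using assms by (simp add: c0_semigroup_def)
  have "((\<lambda>h. T s ((T h f - f) /\<^sub>R h)) \<longlongrightarrow> T s g) (at_right 0)"
    using assms by (intro bounded_linear.tendsto[OF lin]) (simp add: c0_generator_def)
  moreover have "\<forall>\<^sub>F h in at_right (0::real). T s ((T h f - f) /\<^sub>R h) = (T h (T s f) - T s f) /\<^sub>R h"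
    using eventually_at_right_less[of "0::real"]
  proof eventually_elim
    case (elim h)
    have "T h (T s f) = T (h + s) f" "T s (T h f) = T (s + h) f"
      using T elim \<open>0 \<le> s\<close> by (simp_all add: c0_semigroup_def)
    then show ?case
      by (simp add: linear_diff linear_scale bounded_linear.linear[OF lin] add.commute)
  qed
  ultimately have "((\<lambda>h. (T h (T s f) - T s f) /\<^sub>R h) \<longlongrightarrow> T s g) (at_right 0)"
    by (rule Lim_transform_eventually)
  then show ?thesis by (simp add: c0_generator_def)
qed

text \<open>
  The difference quotient between two times is the earlier semigroup operator applied to a difference
  quotient at zero. The local bound therefore controls increments on both sides of \<open>s\<close> by the same
  null function \<open>K\<close> of their length.
\<close>

lemma orbit_has_vector_derivative:
  assumes T: "c0_semigroup T" and gen: "(f, g) \<in> c0_generator T"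
    and M: "\<And>t x. 0 \<le> t \<Longrightarrow> t \<le> \<epsilon> \<Longrightarrow> norm (T t x) \<le> M * norm x"
    and "0 \<le> M" and s: "0 \<le> s" "s \<le> \<epsilon>"
  shows "((\<lambda>t. T t f) has_vector_derivative T s g) (at s within {0..\<epsilon>})"
proof -
  have lin: "bounded_linear (T t)" if "0 \<le> t" for t
    using T that by (simp add: c0_semigroup_def)
  have semi: "T (a + b) x = T a (T b x)" if "0 \<le> a" "0 \<le> b" for a b x
    using T that by (simp add: c0_semigroup_def)
  define K where "K h = M * norm ((T h f - f) /\<^sub>R h - g) + M * norm (T h g - g)" for h
  have "((\<lambda>h. (T h f - f) /\<^sub>R h) \<longlongrightarrow> g) (at_right 0)" "((\<lambda>h. T h g) \<longlongrightarrow> g) (at_right 0)"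
    using gen T by (simp_all add: c0_generator_def c0_semigroup_def)
  then have "(K \<longlongrightarrow> M * norm (g - g) + M * norm (g - g)) (at_right 0)"
    unfolding K_def by (intro tendsto_intros)
  then have K0: "(K \<longlongrightarrow> 0) (at_right 0)" by simp
  have abs: "filterlim (\<lambda>t. \<bar>t - s\<bar>) (at_right 0) (at s within {0..\<epsilon>})"
    unfolding filterlim_at
  proof
    show "\<forall>\<^sub>F t in at s within {0..\<epsilon>}. \<bar>t - s\<bar> \<in> {0<..} \<and> \<bar>t - s\<bar> \<noteq> 0"
      by (auto simp: eventually_at_filter)
    have "((\<lambda>t. \<bar>t - s\<bar>) \<longlongrightarrow> \<bar>s - s\<bar>) (at s within {0..\<epsilon>})"
      by (intro tendsto_intros)
    then show "((\<lambda>t. \<bar>t - s\<bar>) \<longlongrightarrow> 0) (at s within {0..\<epsilon>})" by simp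
  qed
  have "((\<lambda>t. T t f) has_derivative (\<lambda>h. h *\<^sub>R T s g)) (at s within {0..\<epsilon>})"
  proof (rule has_derivativeI_sandwich[of 1 _ _ _ _ "\<lambda>t. K \<bar>t - s\<bar>"])
    show "bounded_linear (\<lambda>h. h *\<^sub>R T s g)" by (rule bounded_linear_scaleR_left)
    show "((\<lambda>t. K \<bar>t - s\<bar>) \<longlongrightarrow> 0) (at s within {0..\<epsilon>})"
      by (rule filterlim_compose[OF K0 abs])
    fix t assume t: "t \<in> {0..\<epsilon>}" "t \<noteq> s"
    define h where "h = \<bar>t - s\<bar>"
    have "0 < h" using t by (simp add: h_def)
    have split: "norm (T h f - f - h *\<^sub>R g) = h * norm ((T h f - f) /\<^sub>R h - g)"
    proof -
      have "T h f - f - h *\<^sub>R g = h *\<^sub>R ((T h f - f) /\<^sub>R h - g)"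
        using \<open>0 < h\<close> by (simp add: scaleR_diff_right)
      then show ?thesis using \<open>0 < h\<close> by simp
    qed
    have "norm (T t f - T s f - (t - s) *\<^sub>R T s g) \<le> h * K h"
    proof (cases "s \<le> t")
      case True
      then have "t = s + h" by (simp add: h_def)
      then have "T t f - T s f - (t - s) *\<^sub>R T s g = T s (T h f - f - h *\<^sub>R g)"
        using \<open>0 < h\<close> s by (simp add: semi linear_diff linear_scale bounded_linear.linear[OF lin])
      also have "norm \<dots> \<le> M * norm (T h f - f - h *\<^sub>R g)"
        by (rule M[OF s])
      also have "\<dots> \<le> h * K h"
        using \<open>0 \<le> M\<close> \<open>0 < h\<close> unfolding split K_def by (simp add: distrib_left mult.left_commute)
      finally show ?thesis .
    next
      case False
      then have sth: "s = t + h" by (simp add: h_def)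
      have "T t f - T s f - (t - s) *\<^sub>R T s g = T t (h *\<^sub>R (T h g - g) - (T h f - f - h *\<^sub>R g))"
        using \<open>0 < h\<close> t unfolding sth
        by (simp add: semi linear_diff linear_scale bounded_linear.linear[OF lin] scaleR_diff_right)
      also have "norm \<dots> \<le> M * norm (h *\<^sub>R (T h g - g) - (T h f - f - h *\<^sub>R g))"
        using t by (intro M) auto
      also have "\<dots> \<le> M * (h * norm (T h g - g) + norm (T h f - f - h *\<^sub>R g))"
        using \<open>0 < h\<close> \<open>0 \<le> M\<close> norm_triangle_ineq4[of "h *\<^sub>R (T h g - g)" "T h f - f - h *\<^sub>R g"]
        by (intro mult_left_mono) auto
      also have "\<dots> = h * K h" unfolding split K_def by (simp add: distrib_left mult.left_commute)
      finally show ?thesis .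
    qed
    then show "norm (T t f - T s f - (t - s) *\<^sub>R T s g) / norm (t - s) \<le> K \<bar>t - s\<bar>"
      using \<open>0 < h\<close> by (simp add: divide_le_eq mult.commute flip: h_def)
  qed simp
  then show ?thesis by (simp add: has_vector_derivative_def)
qed

text \<open>
  For \<open>f\<close> and \<open>u\<close> in the domain of the generator the function \<open>s \<mapsto> \<langle>T\<^bsub>t-s\<^esub> f, T\<^sub>s u\<rangle>\<close> is
  constant, because the two terms of its derivative cancel by symmetry of the generator; its values
  at \<open>0\<close> and \<open>t\<close> are the two sides of the claim. The local bound makes the orbits differentiable on a short
  interval of times, and powers of the operators for these times reach all others.
\<close>

theorem semigroup_symmetric_of_generator:
  fixes T :: "real \<Rightarrow> 'a::{real_inner,banach} \<Rightarrow> 'a"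
  assumes T: "c0_semigroup T"
    and sym: "\<And>f g u v. (f, g) \<in> c0_generator T \<Longrightarrow> (u, v) \<in> c0_generator T \<Longrightarrow> inner g u = inner f v"
    and dense: "closure (Domain (c0_generator T)) = UNIV"
    and "0 \<le> t"
  shows "inner (T t x) y = inner x (T t y)"
proof -
  obtain \<epsilon> M where "0 < \<epsilon>" "0 \<le> M" and M: "\<And>t f. 0 \<le> t \<Longrightarrow> t \<le> \<epsilon> \<Longrightarrow> norm (T t f) \<le> M * norm f"
    using c0_semigroup_locally_bounded[OF T] by blast
  have lin: "bounded_linear (T t)" if "0 \<le> t" for t
    using T that by (simp add: c0_semigroup_def)
  have semi: "T (a + b) x = T a (T b x)" if "0 \<le> a" "0 \<le> b" for a b x
    using T that by (simp add: c0_semigroup_def)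
  have zero: "T 0 x = x" for x using T by (simp add: c0_semigroup_def)
  have on_domain: "inner (T t f) u = inner f (T t u)"
    if t: "0 \<le> t" "t \<le> \<epsilon>" and fg: "(f, g) \<in> c0_generator T" and uv: "(u, v) \<in> c0_generator T" for t f g u v
  proof -
    have "((\<lambda>s. inner (T (t - s) f) (T s u)) has_derivative (\<lambda>h. 0)) (at s within {0..t})"
      if s: "s \<in> {0..t}" for s
    proof -
      have M': "norm (T r x) \<le> M * norm x" if "0 \<le> r" "r \<le> t" for r x
        using M that t by simp
      have 1: "((\<lambda>s. T s u) has_vector_derivative T s v) (at s within {0..t})"
        using s by (intro orbit_has_vector_derivative[OF T uv M' \<open>0 \<le> M\<close>]) auto
      have 2: "((\<lambda>s. T s f) has_vector_derivative T (t - s) g) (at (t - s) within {0..t})"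
        using s by (intro orbit_has_vector_derivative[OF T fg M' \<open>0 \<le> M\<close>]) auto
      have 3: "((\<lambda>s. T (t - s) f) has_vector_derivative (- 1) *\<^sub>R T (t - s) g) (at s within {0..t})"
      proof (rule vector_diff_chain_within[where f = "\<lambda>s. t - s" and g = "\<lambda>r. T r f", unfolded o_def])
        show "((\<lambda>s. t - s) has_vector_derivative - 1) (at s within {0..t})"
          by (auto intro!: derivative_eq_intros)
        have "(\<lambda>s. t - s) ` {0..t} \<subseteq> {0..t}" by auto
        then show "((\<lambda>r. T r f) has_vector_derivative T (t - s) g)
            (at (t - s) within (\<lambda>s. t - s) ` {0..t})"
          by (rule has_vector_derivative_within_subset[OF 2])
      qed
      have "inner (T (t - s) g) (T s u) = inner (T (t - s) f) (T s v)"
        using s by (intro sym c0_generator_commutes[OF T] fg uv) auto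
      then show ?thesis
        using bounded_bilinear.has_vector_derivative[OF bounded_bilinear_inner 3 1]
        by (simp add: has_vector_derivative_def)
    qed
    then obtain c where "\<And>s. s \<in> {0..t} \<Longrightarrow> inner (T (t - s) f) (T s u) = c"
      using has_derivative_zero_constant[of "{0..t}" "\<lambda>s. inner (T (t - s) f) (T s u)"] by auto
    from this[of 0] this[of t] t show ?thesis by (simp add: zero)
  qed
  have sequence: "\<exists>f. (\<forall>k. f k \<in> Domain (c0_generator T)) \<and> f \<longlonglongrightarrow> z" for z
  proof -
    have "z \<in> closure (Domain (c0_generator T))" by (simp add: dense)
    then show ?thesis by (simp add: closure_sequential)
  qed
  have short: "inner (T t x) y = inner x (T t y)" if t: "0 \<le> t" "t \<le> \<epsilon>" for t x y
  proof -
    obtain f where f: "\<And>k. f k \<in> Domain (c0_generator T)" "f \<longlonglongrightarrow> x" using sequence by blast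
    obtain u where u: "\<And>k. u k \<in> Domain (c0_generator T)" "u \<longlonglongrightarrow> y" using sequence by blast
    have eq: "inner (T t (f k)) (u k) = inner (f k) (T t (u k))" for k
      using f(1)[of k] u(1)[of k] on_domain[OF t] by blast
    have "(\<lambda>k. inner (T t (f k)) (u k)) \<longlonglongrightarrow> inner (T t x) y"
      "(\<lambda>k. inner (f k) (T t (u k))) \<longlonglongrightarrow> inner x (T t y)"
      by (intro tendsto_intros f u bounded_linear.tendsto[OF lin] t)+
    then show ?thesis by (simp add: eq LIMSEQ_unique)
  qed
  obtain n where n: "t / \<epsilon> < real n" using reals_Archimedean2 by blast
  then have "0 < n" using \<open>0 < \<epsilon>\<close> \<open>0 \<le> t\<close> by (cases n) (auto simp: divide_less_0_iff)
  define \<tau> where "\<tau> = t / real n"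
  have \<tau>: "0 \<le> \<tau>" "\<tau> \<le> \<epsilon>"
    using n \<open>0 < n\<close> \<open>0 < \<epsilon>\<close> \<open>0 \<le> t\<close> by (auto simp: \<tau>_def field_simps)
  have "inner (T (real k * \<tau>) x) y = inner x (T (real k * \<tau>) y)" for k x y
  proof (induction k arbitrary: x y)
    case (Suc k)
    have "T (real (Suc k) * \<tau>) x = T \<tau> (T (real k * \<tau>) x)" for x
      using semi[of \<tau> "real k * \<tau>" x] \<tau> by (simp add: algebra_simps)
    moreover have "T (real (Suc k) * \<tau>) y = T (real k * \<tau>) (T \<tau> y)"
      using semi[of "real k * \<tau>" \<tau> y] \<tau> by (simp add: algebra_simps)
    ultimately show ?case by (simp only: short[OF \<tau>] Suc)
  qed (simp add: zero)
  from this[of n] show ?thesis using \<open>0 < n\<close> by (simp add: \<tau>_def)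
qed

section \<open>The Hilbert space of square-integrable functions\<close>

lemma Lp_2_iff: "f \<in> Lp M 2 \<longleftrightarrow> f \<in> borel_measurable M \<and> integrable M (\<lambda>x. (norm (f x))\<^sup>2)"
  by (simp add: Lp_def powr_numeral)

lemma Lp_norm_2: "Lp_norm M 2 f = sqrt (LINT x|M. (norm (f x))\<^sup>2)"
  by (simp add: Lp_norm_def powr_numeral powr_half_sqrt)

lemma Lp_2_measurable: "f \<in> Lp M 2 \<Longrightarrow> f \<in> borel_measurable M"
  by (simp add: Lp_2_iff)

lemma Lp_2_iff_nn_integral:
  "f \<in> Lp M 2 \<longleftrightarrow> f \<in> borel_measurable M \<and> (\<integral>\<^sup>+x. ennreal ((norm (f x))\<^sup>2) \<partial>M) < \<infinity>"
proof (cases "f \<in> borel_measurable M")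
  case True
  note [measurable] = True
  show ?thesis unfolding Lp_2_iff integrable_iff_bounded by simp
qed (simp add: Lp_2_iff)

lemma Lp_2_add:
  assumes "f \<in> Lp M 2" "g \<in> Lp M 2"
  shows "(\<lambda>x. f x + g x) \<in> Lp M 2"
  unfolding Lp_2_iff
proof
  note [measurable] = Lp_2_measurable[OF assms(1)] Lp_2_measurable[OF assms(2)]
  show "(\<lambda>x. f x + g x) \<in> borel_measurable M" by measurable
  have "integrable M (\<lambda>x. 2 * (norm (f x))\<^sup>2 + 2 * (norm (g x))\<^sup>2)"
    using assms by (auto simp: Lp_2_iff)
  then show "integrable M (\<lambda>x. (norm (f x + g x))\<^sup>2)"
  proof (rule Bochner_Integration.integrable_bound)
    have "(norm (a + b))\<^sup>2 \<le> 2 * (norm a)\<^sup>2 + 2 * (norm b)\<^sup>2" for a b :: complex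
    proof -
      have "(norm (a + b))\<^sup>2 \<le> (norm a + norm b)\<^sup>2"
        by (intro power_mono norm_triangle_ineq) auto
      moreover have "0 \<le> (norm a - norm b)\<^sup>2" by simp
      ultimately show ?thesis by (simp add: power2_sum power2_diff)
    qed
    then show "AE x in M. norm ((norm (f x + g x))\<^sup>2) \<le> norm (2 * (norm (f x))\<^sup>2 + 2 * (norm (g x))\<^sup>2)"
      by (intro AE_I2) (metis norm_of_real abs_of_nonneg real_norm_def zero_le_power2 abs_ge_self order_trans)
  qed measurable
qed

lemma Lp_2_mult: "f \<in> Lp M 2 \<Longrightarrow> (\<lambda>x. c * f x) \<in> Lp M 2"
  by (auto simp: Lp_2_iff norm_mult power_mult_distrib)

lemma Lp_2_zero: "(\<lambda>x. 0) \<in> Lp M 2"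
  by (simp add: Lp_2_iff)

lemma Lp_2_minus: "f \<in> Lp M 2 \<Longrightarrow> (\<lambda>x. - f x) \<in> Lp M 2"
  by (simp add: Lp_2_iff)

lemma Lp_2_diff: "f \<in> Lp M 2 \<Longrightarrow> g \<in> Lp M 2 \<Longrightarrow> (\<lambda>x. f x - g x) \<in> Lp M 2"
  using Lp_2_add[OF _ Lp_2_minus, of f M g] by simp

lemma Lp_2_scaleR: "f \<in> Lp M 2 \<Longrightarrow> (\<lambda>x. r *\<^sub>R f x) \<in> Lp M 2"
  using Lp_2_mult[of f M "of_real r"] by (simp add: scaleR_conv_of_real)

lemma Lp_2_mono:
  assumes "g \<in> Lp M 2" "f \<in> borel_measurable M" "AE x in M. norm (f x) \<le> norm (g x)"
  shows "f \<in> Lp M 2"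
  unfolding Lp_2_iff
proof
  note [measurable] = assms(2)
  show "integrable M (\<lambda>x. (norm (f x))\<^sup>2)"
  proof (rule Bochner_Integration.integrable_bound)
    show "integrable M (\<lambda>x. (norm (g x))\<^sup>2)" using assms(1) by (simp add: Lp_2_iff)
    show "AE x in M. norm ((norm (f x))\<^sup>2) \<le> norm ((norm (g x))\<^sup>2)"
      using assms(3) by eventually_elim (simp add: power_mono)
  qed measurable
qed fact

lemma Lp_2_integrable_mult:
  assumes "f \<in> Lp M 2" "g \<in> Lp M 2"
  shows "integrable M (\<lambda>x. norm (f x) * norm (g x))"
proof (rule Bochner_Integration.integrable_bound)
  note [measurable] = Lp_2_measurable[OF assms(1)] Lp_2_measurable[OF assms(2)]
  show "integrable M (\<lambda>x. (norm (f x))\<^sup>2 + (norm (g x))\<^sup>2)"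
    using assms by (auto simp: Lp_2_iff)
  have "a * b \<le> a\<^sup>2 + b\<^sup>2" if "0 \<le> a" "0 \<le> b" for a b :: real
    using sum_squares_bound[of a b] that mult_nonneg_nonneg[OF that] by linarith
  then show "AE x in M. norm (norm (f x) * norm (g x)) \<le> norm ((norm (f x))\<^sup>2 + (norm (g x))\<^sup>2)"
    by (intro AE_I2) simp
  show "(\<lambda>x. norm (f x) * norm (g x)) \<in> borel_measurable M" by measurable
qed

lemma Lp_2_integrable_inner:
  assumes "f \<in> Lp M 2" "g \<in> Lp M 2"
  shows "integrable M (\<lambda>x. inner (f x) (g x))"
proof (rule Bochner_Integration.integrable_bound[OF Lp_2_integrable_mult[OF assms]])
  note [measurable] = Lp_2_measurable[OF assms(1)] Lp_2_measurable[OF assms(2)]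
  show "(\<lambda>x. inner (f x) (g x)) \<in> borel_measurable M" by measurable
  show "AE x in M. norm (inner (f x) (g x)) \<le> norm (norm (f x) * norm (g x))"
    using Cauchy_Schwarz_ineq2 by (intro AE_I2) simp
qed

text \<open>
  The idea behind completeness: the integral of the sum of \<open>2\<^sup>n \<bar>f\<^bsub>n+1\<^esub> - f\<^sub>n\<bar>\<^sup>2\<close> is finite, so this sum is
  finite almost everywhere, and there the differences \<open>f\<^bsub>n+1\<^esub> - f\<^sub>n\<close> are summable.
\<close>

lemma riesz_fischer_fast:
  fixes f :: "nat \<Rightarrow> 'a \<Rightarrow> complex"
  assumes L2: "\<And>n. f n \<in> Lp M 2"
    and fast: "\<And>n. Lp_norm M 2 (\<lambda>x. f (Suc n) x - f n x) \<le> (1/2) ^ n"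
  obtains g where "g \<in> borel_measurable M" "AE x in M. (\<lambda>n. f n x) \<longlonglongrightarrow> g x"
proof -
  have [measurable]: "f n \<in> borel_measurable M" for n
    using L2 Lp_2_measurable by blast
  define d where "d n x = norm (f (Suc n) x - f n x)" for n x
  have [measurable]: "d n \<in> borel_measurable M" for n unfolding d_def by measurable
  have int: "(\<integral>\<^sup>+x. ennreal (2 ^ n * (d n x)\<^sup>2) \<partial>M) \<le> ennreal ((1/2) ^ n)" for n
  proof -
    have D: "(\<lambda>x. f (Suc n) x - f n x) \<in> Lp M 2" by (intro Lp_2_diff L2)
    then have "integrable M (\<lambda>x. 2 ^ n * (d n x)\<^sup>2)" by (simp add: Lp_2_iff d_def)
    then have "(\<integral>\<^sup>+x. ennreal (2 ^ n * (d n x)\<^sup>2) \<partial>M) = ennreal (2 ^ n * (LINT x|M. (d n x)\<^sup>2))"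
      by (subst nn_integral_eq_integral) (auto simp: d_def)
    also have "(LINT x|M. (d n x)\<^sup>2) \<le> ((1/2) ^ n)\<^sup>2"
      using fast[of n] unfolding Lp_norm_2 d_def by (rule sqrt_le_D)
    then have "2 ^ n * (LINT x|M. (d n x)\<^sup>2) \<le> 2 ^ n * ((1/2) ^ n)\<^sup>2"
      by (intro mult_left_mono) auto
    also have "(2::real) ^ n * ((1/2) ^ n)\<^sup>2 = (1/2) ^ n"
      by (simp add: power_divide power2_eq_square)
    finally show ?thesis by (simp add: ennreal_leI)
  qed
  have "(\<integral>\<^sup>+x. (\<Sum>n. ennreal (2 ^ n * (d n x)\<^sup>2)) \<partial>M) = (\<Sum>n. \<integral>\<^sup>+x. ennreal (2 ^ n * (d n x)\<^sup>2) \<partial>M)"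
    by (intro nn_integral_suminf) measurable
  also have "\<dots> \<le> (\<Sum>n. ennreal ((1/2) ^ n))"
    by (intro suminf_le int) auto
  also have "\<dots> = ennreal (\<Sum>n. (1/2) ^ n)"
    by (intro suminf_ennreal2) (auto intro: summable_geometric)
  finally have "(\<integral>\<^sup>+x. (\<Sum>n. ennreal (2 ^ n * (d n x)\<^sup>2)) \<partial>M) \<noteq> \<infinity>"
    by (auto simp: top_unique)
  then have "AE x in M. (\<Sum>n. ennreal (2 ^ n * (d n x)\<^sup>2)) \<noteq> \<infinity>"
    by (intro nn_integral_PInf_AE) measurable
  then have "AE x in M. convergent (\<lambda>n. f n x)"
  proof eventually_elim
    case (elim x)
    have 1: "summable (\<lambda>n. 2 ^ n * (d n x)\<^sup>2)"
      by (rule summable_suminf_not_top) (use elim in auto)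
    have "summable (\<lambda>n. norm (f (Suc n) x - f n x))"
    proof (rule summable_comparison_test')
      show "summable (\<lambda>n. 2 ^ n * (d n x)\<^sup>2 + (1/2) ^ n)"
        by (intro summable_add 1 summable_geometric) auto
      fix n :: nat
      have "d n x \<le> 2 ^ n * (d n x)\<^sup>2 + (1/2) ^ n"
      proof -
        let ?s = "sqrt (2 ^ n)"
        have pos: "0 < ?s" "0 \<le> d n x" "?s\<^sup>2 = 2 ^ n" by (simp_all add: d_def)
        \<comment> \<open>the arithmetic-geometric mean inequality for \<open>2\<^bsup>n/2\<^esup> d\<close> and \<open>2\<^bsup>-n/2\<^esup>\<close>\<close>
        have "2 * (?s * d n x) * (1 / ?s) \<le> (?s * d n x)\<^sup>2 + (1 / ?s)\<^sup>2"
          by (rule sum_squares_bound)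
        also have "2 * (?s * d n x) * (1 / ?s) = 2 * d n x" using pos by simp
        also have "(?s * d n x)\<^sup>2 + (1 / ?s)\<^sup>2 = 2 ^ n * (d n x)\<^sup>2 + (1/2) ^ n"
          using pos(3) by (simp add: power_mult_distrib power_divide)
        finally show ?thesis using pos(2) by linarith
      qed
      then show "norm (norm (f (Suc n) x - f n x)) \<le> 2 ^ n * (d n x)\<^sup>2 + (1/2) ^ n"
        by (simp add: d_def)
    qed
    then have "summable (\<lambda>n. f (Suc n) x - f n x)" by (rule summable_norm_cancel)
    then have "(\<lambda>n. \<Sum>i<n. f (Suc i) x - f i x) \<longlonglongrightarrow> (\<Sum>n. f (Suc n) x - f n x)"
      by (rule summable_LIMSEQ)
    then have "(\<lambda>n. f n x - f 0 x) \<longlonglongrightarrow> (\<Sum>n. f (Suc n) x - f n x)"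
      by (simp only: sum_lessThan_telescope[of "\<lambda>i. f i x"])
    from tendsto_add[OF this tendsto_const[of "f 0 x"]] show ?case
      by (auto intro: convergentI)
  qed
  then have "AE x in M. (\<lambda>n. f n x) \<longlonglongrightarrow> lim (\<lambda>n. f n x)"
    by eventually_elim (simp add: convergent_LIMSEQ_iff)
  moreover have "(\<lambda>x. lim (\<lambda>n. f n x)) \<in> borel_measurable M" by measurable
  ultimately show thesis using that by blast
qed

text \<open>
  The function \<open>h\<close> is a member of the sequence in the proof of completeness, and a candidate for the
  limit when two limits are to be identified.
\<close>

lemma Lp_2_fatou:
  assumes L2: "\<And>n. f n \<in> Lp M 2" and [measurable]: "g \<in> borel_measurable M"
    and lim: "AE x in M. (\<lambda>n. f n x) \<longlonglongrightarrow> g x"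
    and h: "h \<in> Lp M 2" and "0 \<le> e"
    and close: "\<forall>\<^sub>F n in sequentially. Lp_norm M 2 (\<lambda>x. h x - f n x) \<le> e"
  shows "g \<in> Lp M 2" "Lp_norm M 2 (\<lambda>x. h x - g x) \<le> e"
proof -
  note [measurable] = Lp_2_measurable[OF L2] Lp_2_measurable[OF h]
  have "(\<integral>\<^sup>+x. ennreal ((norm (h x - g x))\<^sup>2) \<partial>M)
      = (\<integral>\<^sup>+x. liminf (\<lambda>n. ennreal ((norm (h x - f n x))\<^sup>2)) \<partial>M)"
  proof (rule nn_integral_cong_AE)
    show "AE x in M. ennreal ((norm (h x - g x))\<^sup>2) = liminf (\<lambda>n. ennreal ((norm (h x - f n x))\<^sup>2))"
      using lim
    proof eventually_elim
      case (elim x)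
      then have "(\<lambda>n. ennreal ((norm (h x - f n x))\<^sup>2)) \<longlonglongrightarrow> ennreal ((norm (h x - g x))\<^sup>2)"
        by (intro tendsto_intros tendsto_ennrealI)
      then show ?case by (rule lim_imp_Liminf[OF trivial_limit_sequentially, symmetric])
    qed
  qed
  also have "\<dots> \<le> liminf (\<lambda>n. \<integral>\<^sup>+x. ennreal ((norm (h x - f n x))\<^sup>2) \<partial>M)"
    by (intro nn_integral_liminf) measurable
  also have "\<dots> \<le> ennreal (e\<^sup>2)"
  proof (rule order_trans[OF Liminf_mono Liminf_const[THEN eq_refl]])
    show "\<forall>\<^sub>F n in sequentially. (\<integral>\<^sup>+x. ennreal ((norm (h x - f n x))\<^sup>2) \<partial>M) \<le> ennreal (e\<^sup>2)"
      using close
    proof eventually_elim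
      case (elim n)
      have "(\<lambda>x. h x - f n x) \<in> Lp M 2" by (intro Lp_2_diff h L2)
      then have "(\<integral>\<^sup>+x. ennreal ((norm (h x - f n x))\<^sup>2) \<partial>M) = ennreal (LINT x|M. (norm (h x - f n x))\<^sup>2)"
        by (intro nn_integral_eq_integral) (auto simp: Lp_2_iff)
      also have "\<dots> \<le> ennreal (e\<^sup>2)"
        using elim unfolding Lp_norm_2 by (intro ennreal_leI sqrt_le_D)
      finally show ?case .
    qed
  qed simp
  finally have le: "(\<integral>\<^sup>+x. ennreal ((norm (h x - g x))\<^sup>2) \<partial>M) \<le> ennreal (e\<^sup>2)" .
  then have D: "(\<lambda>x. h x - g x) \<in> Lp M 2"
    by (simp add: Lp_2_iff_nn_integral le_less_trans[OF le])
  from Lp_2_diff[OF h this] show "g \<in> Lp M 2" by simp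
  have "ennreal (LINT x|M. (norm (h x - g x))\<^sup>2) \<le> ennreal (e\<^sup>2)"
    using le D by (subst (asm) nn_integral_eq_integral) (auto simp: Lp_2_iff)
  then have "(LINT x|M. (norm (h x - g x))\<^sup>2) \<le> e\<^sup>2" by simp
  then show "Lp_norm M 2 (\<lambda>x. h x - g x) \<le> e"
    unfolding Lp_norm_2 using \<open>0 \<le> e\<close> by (simp add: real_le_lsqrt)
qed

text \<open>
  Square-integrable functions modulo null sets, as a real Hilbert space: the inner product is the real
  part of the complex one, which has the same norm.
\<close>

quotient_type 'n l2 = "real ^ 'n \<Rightarrow> complex" / partial:
  "\<lambda>f g. f \<in> L2 \<and> g \<in> L2 \<and> (AE x in lborel. f x = g x)"
proof (rule part_equivpI)
  show "\<exists>f::real ^ 'n \<Rightarrow> complex. f \<in> L2 \<and> f \<in> L2 \<and> (AE x in lborel. f x = f x)"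
    using Lp_2_zero by auto
qed (auto simp: symp_def transp_def elim: AE_mp)

instantiation l2 :: (finite) real_inner
begin

lift_definition zero_l2 :: "'a l2" is "\<lambda>_. 0"
  by (simp add: Lp_2_zero)
lift_definition plus_l2 :: "'a l2 \<Rightarrow> 'a l2 \<Rightarrow> 'a l2" is "\<lambda>f g x. f x + g x"
  by (auto intro: Lp_2_add)
lift_definition minus_l2 :: "'a l2 \<Rightarrow> 'a l2 \<Rightarrow> 'a l2" is "\<lambda>f g x. f x - g x"
  by (auto intro: Lp_2_diff)
lift_definition uminus_l2 :: "'a l2 \<Rightarrow> 'a l2" is "\<lambda>f x. - f x"
  by (auto intro: Lp_2_minus)
lift_definition scaleR_l2 :: "real \<Rightarrow> 'a l2 \<Rightarrow> 'a l2" is "\<lambda>r f x. r *\<^sub>R f x"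
  by (auto intro: Lp_2_scaleR)
lift_definition inner_l2 :: "'a l2 \<Rightarrow> 'a l2 \<Rightarrow> real" is "\<lambda>f g. LINT x|lborel. inner (f x) (g x)"
  by (intro integral_cong_AE borel_measurable_inner)
    (auto simp: Lp_2_iff elim: eventually_elim2)

definition norm_l2 :: "'a l2 \<Rightarrow> real" where "norm_l2 F = sqrt (inner F F)"
definition dist_l2 :: "'a l2 \<Rightarrow> 'a l2 \<Rightarrow> real" where "dist_l2 F K = norm (F - K)"
definition sgn_l2 :: "'a l2 \<Rightarrow> 'a l2" where "sgn_l2 F = scaleR (inverse (norm F)) F"
definition uniformity_l2 :: "('a l2 \<times> 'a l2) filter" where
  "uniformity_l2 = (INF e\<in>{0<..}. principal {(F, K). dist F K < e})"
definition open_l2 :: "'a l2 set \<Rightarrow> bool" where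
  "open_l2 U \<longleftrightarrow> (\<forall>F\<in>U. \<forall>\<^sub>F (F', K) in uniformity. F' = F \<longrightarrow> K \<in> U)"

instance
proof
  fix F K L :: "'a l2" and r s :: real
  show "F + K + L = F + (K + L)"
    by transfer (auto intro: Lp_2_add simp: add.assoc)
  show "F + K = K + F"
    by transfer (auto intro: Lp_2_add simp: add.commute)
  show "0 + F = F"
    by transfer auto
  show "- F + F = 0"
    by transfer (auto intro: Lp_2_zero)
  show "F - K = F + - K"
    by transfer (auto intro: Lp_2_diff)
  show "r *\<^sub>R (F + K) = r *\<^sub>R F + r *\<^sub>R K"
    by transfer (auto intro: Lp_2_add Lp_2_scaleR simp: scaleR_add_right)
  show "(r + s) *\<^sub>R F = r *\<^sub>R F + s *\<^sub>R F"
    by transfer (auto intro: Lp_2_add Lp_2_scaleR simp: scaleR_add_left)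
  show "r *\<^sub>R s *\<^sub>R F = (r * s) *\<^sub>R F"
    by transfer (auto intro: Lp_2_scaleR)
  show "1 *\<^sub>R F = F"
    by transfer auto
  show "inner F K = inner K F"
    by transfer (simp add: inner_commute)
  show "inner (F + K) L = inner F L + inner K L"
    by transfer (auto simp: inner_add_left Lp_2_integrable_inner)
  show "inner (r *\<^sub>R F) K = r * inner F K"
    by transfer simp
  show "0 \<le> inner F F"
    by transfer simp
  show "inner F F = 0 \<longleftrightarrow> F = 0"
  proof transfer
    fix f :: "real ^ 'a \<Rightarrow> complex"
    assume "f \<in> L2 \<and> f \<in> L2 \<and> (AE x in lborel. f x = f x)"
    then have f: "f \<in> L2" by simp
    have "(LINT x|lborel. inner (f x) (f x)) = 0 \<longleftrightarrow> (AE x in lborel. inner (f x) (f x) = 0)"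
      by (rule integral_nonneg_eq_0_iff_AE[OF Lp_2_integrable_inner[OF f f]]) simp
    then show "((LINT x|lborel. inner (f x) (f x)) = 0) \<longleftrightarrow>
        (f \<in> L2 \<and> (\<lambda>x. 0) \<in> L2 \<and> (AE x in lborel. f x = 0))"
      using f by (simp add: Lp_2_zero)
  qed
qed (fact norm_l2_def dist_l2_def sgn_l2_def uniformity_l2_def open_l2_def)+

end

lemma rep_l2_in_L2: "rep_l2 F \<in> L2"
  using Quotient_rep_reflp[OF Quotient_l2] by blast

lemma abs_rep_l2 [simp]: "abs_l2 (rep_l2 F) = F"
  by (rule Quotient_abs_rep[OF Quotient_l2])

lemma rep_abs_l2: "f \<in> L2 \<Longrightarrow> AE x in lborel. rep_l2 (abs_l2 f) x = f x"
  using Quotient_rep_abs[OF Quotient_l2, of f] by simp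

lemma abs_l2_eq_iff: "f \<in> L2 \<Longrightarrow> g \<in> L2 \<Longrightarrow> abs_l2 f = abs_l2 g \<longleftrightarrow> (AE x in lborel. f x = g x)"
  using Quotient_rel[OF Quotient_l2, of f g] by simp

lemma abs_l2_surj: obtains f where "f \<in> L2" "F = abs_l2 f"
  using rep_l2_in_L2 abs_rep_l2 by metis

lemma abs_l2_add: "f \<in> L2 \<Longrightarrow> g \<in> L2 \<Longrightarrow> abs_l2 f + abs_l2 g = abs_l2 (\<lambda>x. f x + g x)"
  by (simp add: plus_l2.abs_eq)

lemma abs_l2_diff: "f \<in> L2 \<Longrightarrow> g \<in> L2 \<Longrightarrow> abs_l2 f - abs_l2 g = abs_l2 (\<lambda>x. f x - g x)"
  by (simp add: minus_l2.abs_eq)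

lemma abs_l2_minus: "f \<in> L2 \<Longrightarrow> - abs_l2 f = abs_l2 (\<lambda>x. - f x)"
  by (simp add: uminus_l2.abs_eq)

lemma abs_l2_scaleR: "f \<in> L2 \<Longrightarrow> r *\<^sub>R abs_l2 f = abs_l2 (\<lambda>x. r *\<^sub>R f x)"
  by (simp add: scaleR_l2.abs_eq)

lemma inner_abs_l2: "f \<in> L2 \<Longrightarrow> g \<in> L2 \<Longrightarrow> inner (abs_l2 f) (abs_l2 g) = (LINT x|lborel. inner (f x) (g x))"
  by (simp add: inner_l2.abs_eq)

lemma norm_abs_l2: "f \<in> L2 \<Longrightarrow> norm (abs_l2 f) = L2_norm f"
  by (simp add: norm_l2_def inner_abs_l2 Lp_norm_2 power2_norm_eq_inner)

text \<open>
  The complex structure, as a family of real-linear operators.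
\<close>

lift_definition cmul_l2 :: "complex \<Rightarrow> ('n::finite) l2 \<Rightarrow> 'n l2" is "\<lambda>c f x. c * f x"
  by (auto intro: Lp_2_mult)

lemma cmul_abs_l2: "f \<in> L2 \<Longrightarrow> cmul_l2 c (abs_l2 f) = abs_l2 (\<lambda>x. c * f x)"
  by (simp add: cmul_l2.abs_eq)

lemma norm_cmul_l2: "norm (cmul_l2 c F) = norm c * norm F"
proof (rule abs_l2_surj[of F])
  fix f assume "f \<in> L2" "F = abs_l2 f"
  then show ?thesis
    by (simp add: cmul_abs_l2 norm_abs_l2 Lp_2_mult Lp_norm_2 norm_mult power_mult_distrib real_sqrt_mult)
qed

lemma bounded_linear_cmul_l2: "bounded_linear (cmul_l2 c :: ('n::finite) l2 \<Rightarrow> 'n l2)"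
proof (rule bounded_linear_intro)
  fix F K :: "'n l2" and r :: real
  show "cmul_l2 c (F + K) = cmul_l2 c F + cmul_l2 c K"
    by transfer (auto intro: Lp_2_add Lp_2_mult simp: distrib_left)
  show "cmul_l2 c (r *\<^sub>R F) = r *\<^sub>R cmul_l2 c F"
    by transfer (auto intro: Lp_2_scaleR Lp_2_mult)
  show "norm (cmul_l2 c F) \<le> norm F * norm c"
    by (simp add: norm_cmul_l2)
qed

text \<open>
  A subsequence with rapidly decreasing distances converges almost everywhere by
  \<open>riesz_fischer_fast\<close>, and Fatou's lemma turns this into convergence in norm.
\<close>

instance l2 :: (finite) banach
proof
  fix X :: "nat \<Rightarrow> 'a l2" assume X: "Cauchy X"
  then have "\<exists>N. \<forall>k\<ge>N. \<forall>l\<ge>N. dist (X k) (X l) < (1/2) ^ n" for n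
    by (intro metric_CauchyD) auto
  then obtain N where N: "\<And>n k l. N n \<le> k \<Longrightarrow> N n \<le> l \<Longrightarrow> dist (X k) (X l) < (1/2) ^ n"
    by metis
  define r where "r n = n + (\<Sum>i\<le>n. N i)" for n
  have "strict_mono r" by (rule strict_monoI_Suc) (simp add: r_def)
  have "N n \<le> r n" for n
    unfolding r_def by (intro trans_le_add2 member_le_sum) auto
  moreover have "r n \<le> r m" if "n \<le> m" for n m
    using \<open>strict_mono r\<close> that by (simp add: strict_mono_less_eq)
  ultimately have r: "dist (X (r k)) (X (r l)) < (1/2) ^ n" if "n \<le> k" "n \<le> l" for k l n
    using that by (intro N) (meson order_trans)+
  define f where "f n = rep_l2 (X (r n))" for n
  have f: "f n \<in> L2" "abs_l2 (f n) = X (r n)" for n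
    unfolding f_def by (auto simp: rep_l2_in_L2)
  have dist: "Lp_norm lborel 2 (\<lambda>x. f k x - f l x) = dist (X (r k)) (X (r l))" for k l
    unfolding dist_norm f(2)[symmetric] using f(1) by (simp add: abs_l2_diff norm_abs_l2 Lp_2_diff)
  obtain g where g: "g \<in> borel_measurable lborel" "AE x in lborel. (\<lambda>n. f n x) \<longlonglongrightarrow> g x"
  proof (rule riesz_fischer_fast[OF f(1)])
    show "L2_norm (\<lambda>x. f (Suc n) x - f n x) \<le> (1/2) ^ n" for n
      unfolding dist using r[of n "Suc n" n] by simp
  qed
  have close: "g \<in> L2" "L2_norm (\<lambda>x. f k x - g x) \<le> (1/2) ^ n" if "n \<le> k" for k n
  proof -
    have ev: "\<forall>\<^sub>F l in sequentially. L2_norm (\<lambda>x. f k x - f l x) \<le> (1/2) ^ n"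
      using eventually_ge_at_top[of n]
      by eventually_elim (use r that in \<open>auto simp: dist intro: less_imp_le\<close>)
    show "g \<in> L2" "L2_norm (\<lambda>x. f k x - g x) \<le> (1/2) ^ n"
      by (rule Lp_2_fatou[OF f(1) g f(1) _ ev]; simp)+
  qed
  have "(\<lambda>n. X (r n)) \<longlonglongrightarrow> abs_l2 g"
  proof (rule metric_LIMSEQ_I)
    fix e :: real assume "0 < e"
    then obtain n where n: "(1/2) ^ n < e" using real_arch_pow_inv[of e "1/2"] by auto
    have "dist (X (r k)) (abs_l2 g) < e" if "n \<le> k" for k
    proof -
      have "dist (X (r k)) (abs_l2 g) = L2_norm (\<lambda>x. f k x - g x)"
        unfolding dist_norm f(2)[symmetric] using close(1)[of 0 0] f(1)
        by (simp add: abs_l2_diff norm_abs_l2 Lp_2_diff)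
      then show ?thesis using close(2)[OF that] n by simp
    qed
    then show "\<exists>n. \<forall>k\<ge>n. dist (X (r k)) (abs_l2 g) < e" by blast
  qed
  then have "X \<longlonglongrightarrow> abs_l2 g"
    using Cauchy_converges_subseq[OF X \<open>strict_mono r\<close>] by (simp add: o_def)
  then show "convergent X" by (rule convergentI)
qed

lemma indicator_ball_in_L2: "(indicator (ball 0 r) :: real ^ 'n \<Rightarrow> complex) \<in> L2"
proof -
  have "integrable lborel (indicator (ball 0 r) :: real ^ 'n \<Rightarrow> real)"
    using emeasure_lborel_ball_finite[of "0 :: real ^ 'n" r]
    by (intro integrable_real_indicator) (simp_all add: infinity_ennreal_def)
  moreover have "(norm (indicator A x :: complex))\<^sup>2 = indicator A x" for A and x :: "real ^ 'n"
    by (auto simp: indicator_def)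
  moreover have "(indicator (ball 0 r) :: real ^ 'n \<Rightarrow> complex) \<in> borel_measurable lborel"
    by (intro borel_measurable_indicator) simp
  ultimately show ?thesis unfolding Lp_2_iff by simp
qed

text \<open>
  The space is not trivial: it contains the indicator function of the unit ball.
\<close>

instance l2 :: (finite) perfect_space
proof
  fix F :: "'a l2"
  define u :: "real ^ 'a \<Rightarrow> complex" where "u = indicator (ball 0 1)"
  have u: "u \<in> L2" unfolding u_def by (rule indicator_ball_in_L2)
  have "\<not> (AE x in lborel. u x = 0)"
  proof
    assume "AE x in lborel. u x = 0"
    then have "AE x in lborel. x \<notin> ball (0::real ^ 'a) 1"
      by eventually_elim (auto simp: u_def indicator_def split: if_splits)
    then have "emeasure lborel (ball (0::real ^ 'a) 1) = 0"
      by (subst (asm) AE_iff_measurable[of "ball 0 1"]) auto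
    then show False
      using content_ball_pos[of 1 "0::real ^ 'a"] by (simp add: measure_def)
  qed
  then have ne: "abs_l2 u \<noteq> 0"
    unfolding zero_l2_def by (simp add: abs_l2_eq_iff u Lp_2_zero)
  show "\<not> open {F}"
  proof
    assume "open {F}"
    then obtain e where "0 < e" and e: "ball F e \<subseteq> {F}"
      by (auto simp: open_contains_ball)
    define K where "K = F + (e / 2 / norm (abs_l2 u)) *\<^sub>R abs_l2 u"
    have "K \<in> ball F e" using \<open>0 < e\<close> ne by (simp add: K_def dist_norm)
    then have "K = F" using e by blast
    then show False using \<open>0 < e\<close> ne by (simp add: K_def)
  qed
qed

section \<open>Transfer between functions and the Hilbert space\<close>

lemma inner_complex_eq_Re: "inner z w = Re (z * cnj w)"
  by (simp add: inner_complex_def)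

lemma L2_integrable_mult_cnj:
  assumes "f \<in> L2" "g \<in> L2"
  shows "integrable lborel (\<lambda>x. f x * cnj (g x))"
proof (rule Bochner_Integration.integrable_bound[OF Lp_2_integrable_mult[OF assms]])
  note [measurable] = Lp_2_measurable[OF assms(1)] Lp_2_measurable[OF assms(2)]
  have [measurable]: "cnj \<in> borel_measurable borel"
    by (intro borel_measurable_continuous_onI continuous_on_cnj continuous_on_id)
  show "(\<lambda>x. f x * cnj (g x)) \<in> borel_measurable lborel" by measurable
qed (simp add: norm_mult)

lemma Re_L2_inner: "f \<in> L2 \<Longrightarrow> g \<in> L2 \<Longrightarrow> Re (L2_inner f g) = inner (abs_l2 f) (abs_l2 g)"
  unfolding L2_inner_def
  by (subst integral_Re[symmetric]) (simp_all add: L2_integrable_mult_cnj inner_abs_l2 inner_complex_eq_Re)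

lemma L2_inner_mult_left: "L2_inner (\<lambda>x. c * f x) g = c * L2_inner f g"
  by (simp add: L2_inner_def mult.assoc)

lemma L2_inner_mult_right: "L2_inner f (\<lambda>x. c * g x) = cnj c * L2_inner f g"
  by (simp add: L2_inner_def mult.left_commute)

text \<open>
  The operator on classes of functions. For self-adjoint \<open>H\<close> it determines \<open>H\<close>, as \<open>H\<close> is then
  saturated for almost everywhere equality.
\<close>

definition l2_graph :: "('n::finite) graph \<Rightarrow> ('n l2 \<times> 'n l2) set" where
  "l2_graph H = {(abs_l2 f, abs_l2 g) | f g. (f, g) \<in> H}"

context
  fixes H :: "('n::finite) graph"
  assumes H: "self_adjoint H"
begin

lemma self_adjoint_mem_iff:
  "(f, g) \<in> H \<longleftrightarrow> f \<in> L2 \<and> g \<in> L2 \<and> (\<forall>(u, v)\<in>H. L2_inner v f = L2_inner u g)"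
proof -
  have "(f, g) \<in> H \<longleftrightarrow> (f, g) \<in> adjoint_graph H"
    using H by (simp add: self_adjoint_def)
  then show ?thesis by (simp add: adjoint_graph_def)
qed

lemma self_adjoint_in_L2: "(f, g) \<in> H \<Longrightarrow> f \<in> L2 \<and> g \<in> L2"
  using self_adjoint_mem_iff by blast

lemma self_adjoint_cmult:
  assumes "(f, g) \<in> H"
  shows "((\<lambda>x. c * f x), (\<lambda>x. c * g x)) \<in> H"
proof (subst self_adjoint_mem_iff, intro conjI ballI)
  show "(\<lambda>x. c * f x) \<in> L2" "(\<lambda>x. c * g x) \<in> L2"
    using self_adjoint_in_L2[OF assms] by (auto intro: Lp_2_mult)
  have "L2_inner v f = L2_inner u g" if "(u, v) \<in> H" for u v
    using assms that self_adjoint_mem_iff[of f g] by blast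
  then show "case p of (u, v) \<Rightarrow> L2_inner v (\<lambda>x. c * f x) = L2_inner u (\<lambda>x. c * g x)" if "p \<in> H" for p
    using that by (cases p) (simp add: L2_inner_mult_right)
qed

text \<open>
  Real parts of inner products suffice to test membership in the adjoint, since the graph is invariant
  under multiplication by \<open>\<i>\<close>.
\<close>

lemma self_adjoint_mem_iff_Re:
  assumes "f \<in> L2" "g \<in> L2"
  shows "(f, g) \<in> H \<longleftrightarrow> (\<forall>u v. (u, v) \<in> H \<longrightarrow> Re (L2_inner v f) = Re (L2_inner u g))"
proof
  assume Re: "\<forall>u v. (u, v) \<in> H \<longrightarrow> Re (L2_inner v f) = Re (L2_inner u g)"
  have "L2_inner v f = L2_inner u g" if "(u, v) \<in> H" for u v
  proof (rule complex_eqI)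
    show "Re (L2_inner v f) = Re (L2_inner u g)" using Re that by blast
    have "Re (L2_inner (\<lambda>x. \<i> * v x) f) = Re (L2_inner (\<lambda>x. \<i> * u x) g)"
      using Re self_adjoint_cmult[OF that] by blast
    then show "Im (L2_inner v f) = Im (L2_inner u g)" by (simp add: L2_inner_mult_left)
  qed
  then have "\<forall>(u, v)\<in>H. L2_inner v f = L2_inner u g" by blast
  then show "(f, g) \<in> H" using assms self_adjoint_mem_iff by blast
next
  assume "(f, g) \<in> H"
  then have "\<forall>(u, v)\<in>H. L2_inner v f = L2_inner u g" using self_adjoint_mem_iff by blast
  then show "\<forall>u v. (u, v) \<in> H \<longrightarrow> Re (L2_inner v f) = Re (L2_inner u g)" by auto
qed

lemma abs_l2_graph_iff_inner:
  assumes "f \<in> L2" "g \<in> L2"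
  shows "(f, g) \<in> H \<longleftrightarrow> (\<forall>(U, V)\<in>l2_graph H. inner V (abs_l2 f) = inner U (abs_l2 g))"
proof -
  have "(\<forall>(U, V)\<in>l2_graph H. inner V (abs_l2 f) = inner U (abs_l2 g))
      \<longleftrightarrow> (\<forall>u v. (u, v) \<in> H \<longrightarrow> inner (abs_l2 v) (abs_l2 f) = inner (abs_l2 u) (abs_l2 g))"
    unfolding l2_graph_def by blast
  also have "\<dots> \<longleftrightarrow> (\<forall>u v. (u, v) \<in> H \<longrightarrow> Re (L2_inner v f) = Re (L2_inner u g))"
    using self_adjoint_in_L2 Re_L2_inner[OF _ assms(1)] Re_L2_inner[OF _ assms(2)] by metis
  finally show ?thesis by (simp add: self_adjoint_mem_iff_Re assms)
qed

lemma abs_l2_graph_iff: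
  assumes "f \<in> L2" "g \<in> L2"
  shows "(abs_l2 f, abs_l2 g) \<in> l2_graph H \<longleftrightarrow> (f, g) \<in> H"
proof
  assume "(abs_l2 f, abs_l2 g) \<in> l2_graph H"
  then obtain f' g' where fg': "(f', g') \<in> H" "abs_l2 f = abs_l2 f'" "abs_l2 g = abs_l2 g'"
    unfolding l2_graph_def by blast
  then show "(f, g) \<in> H"
    using self_adjoint_in_L2[OF fg'(1)] abs_l2_graph_iff_inner[OF assms] abs_l2_graph_iff_inner[of f' g'] by simp
next
  assume "(f, g) \<in> H"
  then show "(abs_l2 f, abs_l2 g) \<in> l2_graph H" unfolding l2_graph_def by blast
qed

lemma self_adjoint_graph_l2: "self_adjoint_graph (l2_graph H)"
proof
  fix F K :: "'n l2"
  obtain f where f: "f \<in> L2" "F = abs_l2 f" by (rule abs_l2_surj)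
  obtain g where g: "g \<in> L2" "K = abs_l2 g" by (rule abs_l2_surj)
  show "(F, K) \<in> l2_graph H \<longleftrightarrow> (\<forall>(U, V)\<in>l2_graph H. inner V F = inner U K)"
    unfolding f(2) g(2) abs_l2_graph_iff[OF f(1) g(1)] by (rule abs_l2_graph_iff_inner[OF f(1) g(1)])
next
  have "F \<in> closure (Domain (l2_graph H))" for F
    unfolding closure_approachable
  proof (intro allI impI)
    fix e :: real assume "0 < e"
    obtain f where f: "f \<in> L2" "F = abs_l2 f" by (rule abs_l2_surj)
    obtain u v where uv: "(u, v) \<in> H" "L2_norm (\<lambda>x. f x - u x) < e"
      using H f(1) \<open>0 < e\<close> unfolding self_adjoint_def densely_defined_def by blast
    moreover have "dist F (abs_l2 u) = L2_norm (\<lambda>x. f x - u x)"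
      using self_adjoint_in_L2[OF uv(1)] f by (simp add: dist_norm abs_l2_diff norm_abs_l2 Lp_2_diff)
    ultimately have "dist (abs_l2 u) F < e" by (simp add: dist_commute)
    moreover have "abs_l2 u \<in> Domain (l2_graph H)"
      using uv(1) unfolding l2_graph_def by blast
    ultimately show "\<exists>U\<in>Domain (l2_graph H). dist U F < e" by blast
  qed
  then show "closure (Domain (l2_graph H)) = UNIV" by blast
qed

lemma cmul_l2_graph: "(F, K) \<in> l2_graph H \<Longrightarrow> (cmul_l2 c F, cmul_l2 c K) \<in> l2_graph H"
proof -
  assume "(F, K) \<in> l2_graph H"
  then obtain f g where fg: "(f, g) \<in> H" "F = abs_l2 f" "K = abs_l2 g"
    unfolding l2_graph_def by blast
  have L2: "f \<in> L2" "g \<in> L2" using self_adjoint_in_L2[OF fg(1)] by auto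
  show ?thesis
    unfolding fg(2,3) cmul_abs_l2[OF L2(1)] cmul_abs_l2[OF L2(2)]
    using self_adjoint_cmult[OF fg(1), of c] unfolding l2_graph_def by blast
qed

end

text \<open>
  \<open>T\<close> acts on square-integrable functions as \<open>S\<close> does on their classes. A semigroup \<open>T\<close> yields
  a semigroup \<open>S\<close>, and conversely if \<open>S\<close> is complex linear, with corresponding generators.
\<close>

definition represents :: "(real \<Rightarrow> ('n::finite) fn \<Rightarrow> 'n fn) \<Rightarrow> (real \<Rightarrow> 'n l2 \<Rightarrow> 'n l2) \<Rightarrow> bool" where
  "represents T S \<longleftrightarrow> (\<forall>t\<ge>0. \<forall>f\<in>L2. T t f \<in> L2 \<and> abs_l2 (T t f) = S t (abs_l2 f))"

lemma representsD:
  assumes "represents T S" "0 \<le> t" "f \<in> L2"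
  shows "T t f \<in> L2" "abs_l2 (T t f) = S t (abs_l2 f)"
  using assms by (auto simp: represents_def)

lemma represents_continuous_iff:
  assumes "represents T S" "f \<in> L2"
  shows "((\<lambda>h. L2_norm (\<lambda>x. T h f x - f x)) \<longlongrightarrow> 0) (at_right 0)
    \<longleftrightarrow> ((\<lambda>h. S h (abs_l2 f)) \<longlongrightarrow> abs_l2 f) (at_right 0)"
proof -
  have "\<forall>\<^sub>F h in at_right (0::real). L2_norm (\<lambda>x. T h f x - f x) = norm (S h (abs_l2 f) - abs_l2 f)"
    using eventually_at_right_less[of "0::real"]
  proof eventually_elim
    case (elim h)
    note D = representsD[OF assms(1) less_imp_le[OF elim] assms(2)]
    show ?case
      unfolding D(2)[symmetric] using D(1) assms(2) by (simp add: abs_l2_diff norm_abs_l2 Lp_2_diff)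
  qed
  then have "((\<lambda>h. L2_norm (\<lambda>x. T h f x - f x)) \<longlongrightarrow> 0) (at_right 0)
      \<longleftrightarrow> ((\<lambda>h. norm (S h (abs_l2 f) - abs_l2 f)) \<longlongrightarrow> 0) (at_right 0)"
    by (rule tendsto_cong)
  then show ?thesis by (simp add: tendsto_norm_zero_iff LIM_zero_iff)
qed

lemma represents_generator_iff:
  assumes "represents T S" "f \<in> L2" "g \<in> L2"
  shows "(f, g) \<in> generator T \<longleftrightarrow> (abs_l2 f, abs_l2 g) \<in> c0_generator S"
proof -
  have "\<forall>\<^sub>F h in at_right (0::real). L2_norm (\<lambda>x. (T h f x - f x) / complex_of_real h - g x)
      = norm ((S h (abs_l2 f) - abs_l2 f) /\<^sub>R h - abs_l2 g)"
    using eventually_at_right_less[of "0::real"]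
  proof eventually_elim
    case (elim h)
    note D = representsD[OF assms(1) less_imp_le[OF elim] assms(2)]
    have "(\<lambda>x. (T h f x - f x) / complex_of_real h - g x) = (\<lambda>x. (T h f x - f x) /\<^sub>R h - g x)"
      by (simp add: scaleR_conv_of_real divide_inverse mult.commute)
    then show ?case
      unfolding D(2)[symmetric] using D(1) assms(2,3)
      by (simp add: abs_l2_diff norm_abs_l2 Lp_2_diff abs_l2_scaleR Lp_2_scaleR)
  qed
  then have "((\<lambda>h. L2_norm (\<lambda>x. (T h f x - f x) / complex_of_real h - g x)) \<longlongrightarrow> 0) (at_right 0)
      \<longleftrightarrow> ((\<lambda>h. norm ((S h (abs_l2 f) - abs_l2 f) /\<^sub>R h - abs_l2 g)) \<longlongrightarrow> 0) (at_right 0)"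
    by (rule tendsto_cong)
  then show ?thesis
    unfolding generator_def c0_generator_def mem_Collect_eq prod.case tendsto_norm_zero_iff LIM_zero_iff
    using assms by blast
qed

lemma C0_semigroup_of_represents:
  assumes R: "represents T S" and S: "c0_semigroup S"
    and complex: "\<And>t c F. 0 \<le> t \<Longrightarrow> S t (cmul_l2 c F) = cmul_l2 c (S t F)"
  shows "C0_semigroup T"
proof -
  note R1 = representsD(1)[OF R] and R2 = representsD(2)[OF R]
  have lin: "bounded_linear (S t)" if "0 \<le> t" for t using S that by (simp add: c0_semigroup_def)
  have zero: "S 0 F = F" for F using S by (simp add: c0_semigroup_def)
  have semi: "S (s + t) F = S s (S t F)" if "0 \<le> s" "0 \<le> t" for s t F
    using S that by (simp add: c0_semigroup_def)
  show ?thesis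
    unfolding C0_semigroup_def
  proof (intro conjI allI impI ballI)
    fix t :: real assume t: "0 \<le> t"
    show "L2_linear (T t)"
      unfolding L2_linear_def
    proof (intro ballI allI)
      fix f g :: "'a fn" and a b assume f: "f \<in> L2" and g: "g \<in> L2"
      let ?h = "\<lambda>y. a * f y + b * g y"
      have h: "?h \<in> L2" by (intro Lp_2_add Lp_2_mult f g)
      have "abs_l2 (T t ?h) = S t (abs_l2 ?h)" by (rule R2[OF t h])
      also have "abs_l2 ?h = cmul_l2 a (abs_l2 f) + cmul_l2 b (abs_l2 g)"
        by (simp add: cmul_abs_l2 abs_l2_add f g Lp_2_mult)
      also have "S t \<dots> = cmul_l2 a (S t (abs_l2 f)) + cmul_l2 b (S t (abs_l2 g))"
        by (simp add: linear_add bounded_linear.linear[OF lin[OF t]] complex[OF t])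
      also have "\<dots> = cmul_l2 a (abs_l2 (T t f)) + cmul_l2 b (abs_l2 (T t g))"
        by (simp only: R2[OF t f] R2[OF t g])
      also have "\<dots> = abs_l2 (\<lambda>x. a * T t f x + b * T t g x)"
        by (simp add: cmul_abs_l2 abs_l2_add R1[OF t] f g Lp_2_mult)
      finally show "AE x in lborel. T t ?h x = a * T t f x + b * T t g x"
        by (subst (asm) abs_l2_eq_iff) (auto intro!: R1[OF t] h f g Lp_2_add Lp_2_mult)
    qed
    obtain K where K: "\<And>F. norm (S t F) \<le> norm F * K"
      using bounded_linear.bounded[OF lin[OF t]] by blast
    have "L2_norm (T t f) \<le> K * L2_norm f" if "f \<in> L2" for f
      using K[of "abs_l2 f"] unfolding R2[OF t that, symmetric] norm_abs_l2[OF that] norm_abs_l2[OF R1[OF t that]]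
      by (simp add: mult.commute)
    then show "bounded_map L2 L2_norm L2 L2_norm (T t)"
      unfolding bounded_map_def using R1[OF t] by blast
  next
    fix f :: "'a fn" assume f: "f \<in> L2"
    have "abs_l2 (T 0 f) = abs_l2 f" using R2[of 0, OF _ f] zero by simp
    then show "AE x in lborel. T 0 f x = f x"
      by (subst (asm) abs_l2_eq_iff) (auto intro: R1 f)
    show "((\<lambda>h. L2_norm (\<lambda>x. T h f x - f x)) \<longlongrightarrow> 0) (at_right 0)"
      using S unfolding represents_continuous_iff[OF R f] c0_semigroup_def by blast
  next
    fix f :: "'a fn" and s t :: real assume f: "f \<in> L2" and st: "0 \<le> s" "0 \<le> t"
    have "abs_l2 (T (s + t) f) = abs_l2 (T s (T t f))"
      using R2[of "s + t", OF _ f] R2[OF st(2) f] R2[OF st(1) R1[OF st(2) f]] semi[OF st] st by simp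
    then show "AE x in lborel. T (s + t) f x = T s (T t f) x"
      by (subst (asm) abs_l2_eq_iff) (use st in \<open>auto intro: R1 f\<close>)
  qed
qed

lemma C0_semigroup_in_L2: "C0_semigroup T \<Longrightarrow> 0 \<le> t \<Longrightarrow> f \<in> L2 \<Longrightarrow> T t f \<in> L2"
  unfolding C0_semigroup_def bounded_map_def by blast

lemma C0_semigroup_bounded:
  assumes "C0_semigroup T" "0 \<le> t"
  obtains C where "0 \<le> C" "\<And>f. f \<in> L2 \<Longrightarrow> L2_norm (T t f) \<le> C * L2_norm f"
proof -
  obtain C where C: "\<And>f. f \<in> L2 \<Longrightarrow> L2_norm (T t f) \<le> C * L2_norm f"
    using assms unfolding C0_semigroup_def bounded_map_def by blast
  have "L2_norm (T t f) \<le> max C 0 * L2_norm f" if "f \<in> L2" for f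
  proof -
    have "C * L2_norm f \<le> max C 0 * L2_norm f"
      by (intro mult_right_mono) (auto simp: Lp_norm_2)
    then show ?thesis using C[OF that] by simp
  qed
  then show thesis using that[of "max C 0"] by simp
qed

lemma C0_semigroup_linear:
  assumes "C0_semigroup T" "0 \<le> t" "f \<in> L2" "g \<in> L2"
  shows "AE x in lborel. T t (\<lambda>y. a * f y + b * g y) x = a * T t f x + b * T t g x"
  using assms unfolding C0_semigroup_def L2_linear_def by blast

lemma C0_semigroup_diff:
  assumes "C0_semigroup T" "0 \<le> t" "f \<in> L2" "g \<in> L2"
  shows "AE x in lborel. T t (\<lambda>y. f y - g y) x = T t f x - T t g x"
  using C0_semigroup_linear[OF assms, of 1 "- 1"] by simp

text \<open>
  The operators respect almost everywhere equality, because a function of norm zero is mapped to one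
  of norm zero.
\<close>

lemma C0_semigroup_cong:
  assumes "C0_semigroup T" "0 \<le> t" "f \<in> L2" "g \<in> L2" "AE x in lborel. f x = g x"
  shows "AE x in lborel. T t f x = T t g x"
proof -
  note T = C0_semigroup_in_L2[OF assms(1,2)]
  obtain C where C: "\<And>f. f \<in> L2 \<Longrightarrow> L2_norm (T t f) \<le> C * L2_norm f"
    using C0_semigroup_bounded[OF assms(1,2)] by blast
  have fg: "(\<lambda>y. f y - g y) \<in> L2" by (intro Lp_2_diff assms)
  have "abs_l2 f = abs_l2 g" using assms by (simp add: abs_l2_eq_iff)
  then have "L2_norm (\<lambda>y. f y - g y) = 0"
    using norm_abs_l2[OF fg] abs_l2_diff[OF assms(3,4)] by simp
  then have "norm (abs_l2 (T t (\<lambda>y. f y - g y))) \<le> 0"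
    using C[OF fg] by (simp add: norm_abs_l2 T fg)
  then have "AE x in lborel. T t (\<lambda>y. f y - g y) x = 0"
    using T[OF fg] by (simp add: zero_l2_def abs_l2_eq_iff Lp_2_zero)
  with C0_semigroup_diff[OF assms(1-4)] show ?thesis
    by eventually_elim simp
qed

lemma represents_of_C0_semigroup:
  assumes T: "C0_semigroup T"
  defines "S \<equiv> \<lambda>t F. abs_l2 (T t (rep_l2 F))"
  shows "represents T S" "c0_semigroup S"
proof -
  note T2 = C0_semigroup_in_L2[OF T]
  show R: "represents T S"
    unfolding represents_def
  proof (intro allI impI ballI conjI)
    fix t :: real and f :: "'a fn" assume t: "0 \<le> t" and f: "f \<in> L2"
    show "T t f \<in> L2" by (rule T2[OF t f])
    have "AE x in lborel. T t (rep_l2 (abs_l2 f)) x = T t f x"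
      by (rule C0_semigroup_cong[OF T t rep_l2_in_L2 f rep_abs_l2[OF f]])
    then show "abs_l2 (T t f) = S t (abs_l2 f)"
      unfolding S_def abs_l2_eq_iff[OF T2[OF t f] T2[OF t rep_l2_in_L2]]
      by eventually_elim (rule sym)
  qed
  note R2 = representsD(2)[OF R]
  show "c0_semigroup S"
    unfolding c0_semigroup_def
  proof (intro conjI allI impI)
    fix t :: real assume t: "0 \<le> t"
    obtain C where C: "\<And>f. f \<in> L2 \<Longrightarrow> L2_norm (T t f) \<le> C * L2_norm f"
      using C0_semigroup_bounded[OF T t] by blast
    show "bounded_linear (S t)"
    proof (rule bounded_linear_intro)
      fix F K :: "'a l2" and r :: real
      obtain f where f: "f \<in> L2" "F = abs_l2 f" by (rule abs_l2_surj)
      obtain g where g: "g \<in> L2" "K = abs_l2 g" by (rule abs_l2_surj)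
      have fg: "(\<lambda>x. f x + g x) \<in> L2" "(\<lambda>x. r *\<^sub>R f x) \<in> L2"
        by (intro Lp_2_add Lp_2_scaleR f g)+
      have "abs_l2 (T t (\<lambda>x. f x + g x)) = abs_l2 (\<lambda>x. T t f x + T t g x)"
        using C0_semigroup_linear[OF T t f(1) g(1), of 1 1]
        by (subst abs_l2_eq_iff) (auto intro!: T2 t f g Lp_2_add)
      then show "S t (F + K) = S t F + S t K"
        unfolding f(2) g(2) abs_l2_add[OF f(1) g(1)] R2[OF t f(1), symmetric] R2[OF t g(1), symmetric]
          R2[OF t fg(1), symmetric] abs_l2_add[OF T2[OF t f(1)] T2[OF t g(1)]] .
      have "abs_l2 (T t (\<lambda>x. r *\<^sub>R f x)) = abs_l2 (\<lambda>x. r *\<^sub>R T t f x)"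
        using C0_semigroup_linear[OF T t f(1) f(1), of "of_real r" 0]
        by (subst abs_l2_eq_iff) (auto intro!: T2 t f fg Lp_2_mult simp: scaleR_conv_of_real)
      then show "S t (r *\<^sub>R F) = r *\<^sub>R S t F"
        unfolding f(2) abs_l2_scaleR[OF f(1)] R2[OF t f(1), symmetric]
          R2[OF t fg(2), symmetric] abs_l2_scaleR[OF T2[OF t f(1)]] .
      show "norm (S t F) \<le> norm F * C"
        using C[OF f(1)] unfolding f(2) R2[OF t f(1), symmetric]
        by (simp add: norm_abs_l2 T2[OF t] f(1) mult.commute)
    qed
  next
    fix F :: "'a l2"
    obtain f where f: "f \<in> L2" "F = abs_l2 f" by (rule abs_l2_surj)
    have "AE x in lborel. T 0 f x = f x" using T f(1) by (simp add: C0_semigroup_def)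
    then have "abs_l2 (T 0 f) = abs_l2 f"
      by (subst abs_l2_eq_iff) (auto intro: T2 f)
    then show "S 0 F = F" using R2[of 0, OF _ f(1)] f(2) by simp
    show "((\<lambda>h. S h F) \<longlongrightarrow> F) (at_right 0)"
      using T f represents_continuous_iff[OF R f(1)] unfolding C0_semigroup_def by blast
  next
    fix s t :: real and F :: "'a l2" assume st: "0 \<le> s" "0 \<le> t"
    obtain f where f: "f \<in> L2" "F = abs_l2 f" by (rule abs_l2_surj)
    have "AE x in lborel. T (s + t) f x = T s (T t f) x"
      using T f(1) st unfolding C0_semigroup_def by blast
    then have "abs_l2 (T (s + t) f) = abs_l2 (T s (T t f))"
      by (subst abs_l2_eq_iff) (use st in \<open>auto intro: T2 f\<close>)
    then show "S (s + t) F = S s (S t F)"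
      using R2[of "s + t", OF _ f(1)] R2[OF st(2) f(1)] R2[OF st(1) T2[OF st(2) f(1)]] st f(2) by simp
  qed
qed

section \<open>Existence and symmetry of the exponential semigroup\<close>

lemma neg_graph_iff: "(f, g) \<in> neg_graph H \<longleftrightarrow> (f, \<lambda>x. - g x) \<in> H"
proof
  assume "(f, g) \<in> neg_graph H"
  then obtain f' where "\<exists>g'. (f, g) = (f', \<lambda>x. - g' x) \<and> (f', g') \<in> H"
    unfolding neg_graph_def mem_Collect_eq by (rule exE)
  then obtain g' where fg: "(f, g) = (f', \<lambda>x. - g' x) \<and> (f', g') \<in> H"
    by (rule exE)
  have f: "f = f'" and g: "g = (\<lambda>x. - g' x)"
    using fg[THEN conjunct1] by (simp_all only: prod.inject)
  show "(f, \<lambda>x. - g x) \<in> H"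
    using fg[THEN conjunct2] by (simp only: f g minus_minus)
next
  assume "(f, \<lambda>x. - g x) \<in> H"
  moreover have "(f, g) = (f, \<lambda>x. - (- g x))" by (simp only: minus_minus)
  ultimately show "(f, g) \<in> neg_graph H"
    unfolding neg_graph_def mem_Collect_eq
    by - (rule exI[of _ f], rule exI[of _ "\<lambda>x. - g x"], rule conjI)
qed

lemma generator_eq_neg_graph_iff:
  assumes H: "self_adjoint H" and R: "represents T S"
  shows "generator T = neg_graph H \<longleftrightarrow> (\<forall>F K. (F, K) \<in> c0_generator S \<longleftrightarrow> (F, - K) \<in> l2_graph H)"
proof -
  have 1: "f \<in> L2 \<and> g \<in> L2" if "(f, g) \<in> generator T" for f g
    using that by (simp add: generator_def)
  have 2: "f \<in> L2 \<and> g \<in> L2" if "(f, g) \<in> neg_graph H" for f g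
    using self_adjoint_in_L2[OF H that[unfolded neg_graph_iff]] Lp_2_minus[of "\<lambda>x. - g x" lborel] by simp
  have "generator T = neg_graph H
      \<longleftrightarrow> (\<forall>f\<in>L2. \<forall>g\<in>L2. (f, g) \<in> generator T \<longleftrightarrow> (f, g) \<in> neg_graph H)"
    (is "_ \<longleftrightarrow> ?R")
  proof
    assume R: ?R
    show "generator T = neg_graph H"
    proof (rule set_eqI)
      fix p :: "'a fn \<times> 'a fn"
      show "p \<in> generator T \<longleftrightarrow> p \<in> neg_graph H"
        using R 1[of "fst p" "snd p"] 2[of "fst p" "snd p"] by (cases p) auto
    qed
  qed simp
  also have "\<dots> \<longleftrightarrow> (\<forall>f\<in>L2. \<forall>g\<in>L2. (abs_l2 f, abs_l2 g) \<in> c0_generator S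
      \<longleftrightarrow> (abs_l2 f, - abs_l2 g) \<in> l2_graph H)"
    by (intro ball_cong refl)
      (simp add: represents_generator_iff[OF R] neg_graph_iff abs_l2_minus abs_l2_graph_iff[OF H] Lp_2_minus)
  also have "\<dots> \<longleftrightarrow> (\<forall>F K. (F, K) \<in> c0_generator S \<longleftrightarrow> (F, - K) \<in> l2_graph H)"
    (is "?L \<longleftrightarrow> ?R")
  proof
    assume L: ?L
    show ?R
    proof (intro allI)
      fix F K :: "'a l2"
      show "(F, K) \<in> c0_generator S \<longleftrightarrow> (F, - K) \<in> l2_graph H"
        using L[rule_format, OF rep_l2_in_L2 rep_l2_in_L2, of F K] by simp
    qed
  qed simp
  finally show ?thesis .
qed

theorem exp_semigroup_exists:
  fixes H :: "('n::finite) graph"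
  assumes H: "self_adjoint H" and below: "bounded_from_below H"
  shows "\<exists>T. C0_semigroup T \<and> generator T = neg_graph H"
proof -
  interpret G: self_adjoint_graph "l2_graph H" by (rule self_adjoint_graph_l2[OF H])
  obtain c where c: "\<And>f g. (f, g) \<in> H \<Longrightarrow> complex_of_real (c * (L2_norm f)\<^sup>2) \<le> L2_inner g f"
    using below unfolding bounded_from_below_def by blast
  have below': "c * (norm F)\<^sup>2 \<le> inner K F" if FK: "(F, K) \<in> l2_graph H" for F K
  proof -
    obtain f g where fg: "(f, g) \<in> H" "F = abs_l2 f" "K = abs_l2 g"
      using FK unfolding l2_graph_def by blast
    have L2: "f \<in> L2" "g \<in> L2" using self_adjoint_in_L2[OF H fg(1)] by auto
    show ?thesis
      using c[OF fg(1)] Re_L2_inner[OF L2(2,1)] norm_abs_l2[OF L2(1)] fg(2,3)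
      by (simp add: less_eq_complex_def)
  qed
  obtain S where S: "c0_semigroup S"
    and gen: "\<And>F K. (F, K) \<in> c0_generator S \<longleftrightarrow> (F, - K) \<in> l2_graph H"
    and comm: "\<And>J t F. bounded_linear J \<Longrightarrow> (\<And>F K. (F, K) \<in> l2_graph H \<Longrightarrow> (J F, J K) \<in> l2_graph H)
      \<Longrightarrow> 0 \<le> t \<Longrightarrow> S t (J F) = J (S t F)"
  proof (rule G.semigroup_exists[OF below'])
    fix S
    assume "c0_semigroup S" "\<And>F K. (F, K) \<in> c0_generator S \<longleftrightarrow> (F, - K) \<in> l2_graph H"
      "\<And>J t F. bounded_linear J \<Longrightarrow> (\<And>F K. (F, K) \<in> l2_graph H \<Longrightarrow> (J F, J K) \<in> l2_graph H)
      \<Longrightarrow> 0 \<le> t \<Longrightarrow> S t (J F) = J (S t F)"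
    then show thesis by (rule that)
  qed
  define T where "T t f = rep_l2 (S t (abs_l2 f))" for t and f :: "'n fn"
  have R: "represents T S" by (simp add: represents_def T_def rep_l2_in_L2)
  have "C0_semigroup T"
    by (rule C0_semigroup_of_represents[OF R S])
      (rule comm[OF bounded_linear_cmul_l2 cmul_l2_graph[OF H]])
  moreover have "generator T = neg_graph H"
    by (simp add: generator_eq_neg_graph_iff[OF H R] gen)
  ultimately show ?thesis by blast
qed

text \<open>
  The choice that defines \<open>exp_semigroup\<close> is made from a nonempty set by \<open>exp_semigroup_exists\<close>,
  and any choice is symmetric because its generator is \<open>-H\<close>.
\<close>

theorem exp_semigroup_symmetric_C0:
  fixes H :: "('n::finite) graph"
  assumes H: "self_adjoint H" and below: "bounded_from_below H"
  shows "C0_semigroup (exp_semigroup H)"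
    and "0 \<le> t \<Longrightarrow> f \<in> L2 \<Longrightarrow> g \<in> L2 \<Longrightarrow>
      (LINT x|lborel. inner (exp_semigroup H t f x) (g x)) = (LINT x|lborel. inner (f x) (exp_semigroup H t g x))"
proof -
  let ?T = "exp_semigroup H"
  have T: "C0_semigroup ?T" "generator ?T = neg_graph H"
    unfolding exp_semigroup_def using someI_ex[OF exp_semigroup_exists[OF assms]] by blast+
  then show "C0_semigroup ?T" by simp
  assume t: "0 \<le> t" and f: "f \<in> L2" and g: "g \<in> L2"
  interpret G: self_adjoint_graph "l2_graph H" by (rule self_adjoint_graph_l2[OF H])
  obtain S where R: "represents ?T S" and S: "c0_semigroup S"
    using represents_of_C0_semigroup[OF T(1)] by blast
  have gen: "(F, K) \<in> c0_generator S \<longleftrightarrow> (F, - K) \<in> l2_graph H" for F K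
    using T(2) generator_eq_neg_graph_iff[OF H R] by blast
  have "Domain (l2_graph H) \<subseteq> Domain (c0_generator S)"
  proof
    fix F assume "F \<in> Domain (l2_graph H)"
    then obtain K where "(F, K) \<in> l2_graph H" by blast
    then have "(F, - K) \<in> c0_generator S" by (simp add: gen)
    then show "F \<in> Domain (c0_generator S)" by blast
  qed
  then have "closure (Domain (c0_generator S)) = UNIV"
    using closure_mono G.dense by blast
  moreover have "inner K U = inner F V" if "(F, K) \<in> c0_generator S" "(U, V) \<in> c0_generator S" for F K U V
    using that G.symmetric[of U "- V" F "- K"] by (simp add: gen inner_commute)
  ultimately have "inner (S t (abs_l2 f)) (abs_l2 g) = inner (abs_l2 f) (S t (abs_l2 g))"
    by (intro semigroup_symmetric_of_generator[OF S] t)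
  then show "(LINT x|lborel. inner (?T t f x) (g x)) = (LINT x|lborel. inner (f x) (?T t g x))"
    unfolding representsD(2)[OF R t f, symmetric] representsD(2)[OF R t g, symmetric]
    by (simp add: representsD(1)[OF R t] f g inner_abs_l2)
qed

section \<open>Hoelder and Fatou in Lebesgue spaces\<close>

lemma Lp_norm_nonneg: "0 \<le> Lp_norm M p f"
  by (simp add: Lp_norm_def)

lemma Lp_norm_powr: "p \<noteq> 0 \<Longrightarrow> Lp_norm M p f powr p = (LINT x|M. norm (f x) powr p)"
  by (simp add: Lp_norm_def powr_powr)

lemma Lp_measurable: "f \<in> Lp M p \<Longrightarrow> f \<in> borel_measurable M"
  by (simp add: Lp_def)

lemma Lp_dominated:
  assumes "0 < p" "0 \<le> c" and g: "g \<in> Lp M p" and f: "f \<in> borel_measurable M"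
    and le: "AE x in M. norm (f x) \<le> c * norm (g x)"
  shows "f \<in> Lp M p" "Lp_norm M p f \<le> c * Lp_norm M p g"
proof -
  note [measurable] = f Lp_measurable[OF g]
  have int: "integrable M (\<lambda>x. c powr p * norm (g x) powr p)"
    using g by (simp add: Lp_def)
  have le': "AE x in M. norm (f x) powr p \<le> c powr p * norm (g x) powr p"
    using le
  proof eventually_elim
    case (elim x)
    then have "norm (f x) powr p \<le> (c * norm (g x)) powr p"
      using \<open>0 < p\<close> by (intro powr_mono2) auto
    then show ?case using \<open>0 \<le> c\<close> by (simp add: powr_mult)
  qed
  have intf: "integrable M (\<lambda>x. norm (f x) powr p)"
  proof (rule Bochner_Integration.integrable_bound[OF int])
    show "AE x in M. norm (norm (f x) powr p) \<le> norm (c powr p * norm (g x) powr p)"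
      using le' by eventually_elim (simp add: abs_mult)
  qed measurable
  then show "f \<in> Lp M p" using f by (simp add: Lp_def)
  have "(LINT x|M. norm (f x) powr p) \<le> (LINT x|M. c powr p * norm (g x) powr p)"
    by (rule integral_mono_AE[OF intf int le'])
  also have "\<dots> = (c * Lp_norm M p g) powr p"
    using assms by (simp add: powr_mult Lp_norm_nonneg Lp_norm_powr)
  finally have "Lp_norm M p f \<le> ((c * Lp_norm M p g) powr p) powr (1 / p)"
    unfolding Lp_norm_def[of M p f] using \<open>0 < p\<close> by (intro powr_mono2) auto
  then show "Lp_norm M p f \<le> c * Lp_norm M p g"
    using assms by (simp add: powr_powr Lp_norm_nonneg)
qed

lemma Lp_cong:
  assumes "0 < p" "g \<in> Lp M p" "f \<in> borel_measurable M" "AE x in M. f x = g x"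
  shows "f \<in> Lp M p" "Lp_norm M p f = Lp_norm M p g"
proof -
  have 1: "AE x in M. norm (f x) \<le> 1 * norm (g x)" "AE x in M. norm (g x) \<le> 1 * norm (f x)"
    using assms(4) by (eventually_elim, simp)+
  show f: "f \<in> Lp M p"
    by (rule Lp_dominated(1)[OF assms(1) _ assms(2,3) 1(1)]) simp
  have "Lp_norm M p f \<le> 1 * Lp_norm M p g"
    by (rule Lp_dominated(2)[OF assms(1) _ assms(2,3) 1(1)]) simp
  moreover have "Lp_norm M p g \<le> 1 * Lp_norm M p f"
    by (rule Lp_dominated(2)[OF assms(1) _ f Lp_measurable[OF assms(2)] 1(2)]) simp
  ultimately show "Lp_norm M p f = Lp_norm M p g" by simp
qed

lemma Lp_fatou:
  assumes "0 < p" and f: "\<And>n. f n \<in> Lp M p" and g: "g \<in> borel_measurable M"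
    and lim: "AE x in M. (\<lambda>n. f n x) \<longlonglongrightarrow> g x"
    and bound: "\<And>n. Lp_norm M p (f n) \<le> C"
  shows "g \<in> Lp M p"
proof -
  note [measurable] = g Lp_measurable[OF f]
  have "(\<integral>\<^sup>+x. ennreal (norm (g x) powr p) \<partial>M) = (\<integral>\<^sup>+x. liminf (\<lambda>n. ennreal (norm (f n x) powr p)) \<partial>M)"
  proof (rule nn_integral_cong_AE)
    show "AE x in M. ennreal (norm (g x) powr p) = liminf (\<lambda>n. ennreal (norm (f n x) powr p))"
      using lim
    proof eventually_elim
      case (elim x)
      have "(\<lambda>n. norm (f n x) powr p) \<longlonglongrightarrow> norm (g x) powr p"
        using \<open>0 < p\<close> by (intro tendsto_powr' tendsto_norm elim tendsto_const) auto
      then have "(\<lambda>n. ennreal (norm (f n x) powr p)) \<longlonglongrightarrow> ennreal (norm (g x) powr p)"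
        by (rule tendsto_ennrealI)
      then show ?case by (rule lim_imp_Liminf[OF trivial_limit_sequentially, symmetric])
    qed
  qed
  also have "\<dots> \<le> liminf (\<lambda>n. \<integral>\<^sup>+x. ennreal (norm (f n x) powr p) \<partial>M)"
    by (intro nn_integral_liminf) measurable
  also have "\<dots> \<le> ennreal (C powr p)"
  proof (rule order_trans[OF Liminf_mono Liminf_const[THEN eq_refl]])
    have "(\<integral>\<^sup>+x. ennreal (norm (f n x) powr p) \<partial>M) \<le> ennreal (C powr p)" for n
    proof -
      have "(\<integral>\<^sup>+x. ennreal (norm (f n x) powr p) \<partial>M) = ennreal (Lp_norm M p (f n) powr p)"
        using f[of n] \<open>0 < p\<close> by (subst nn_integral_eq_integral) (auto simp: Lp_def Lp_norm_powr)
      also have "\<dots> \<le> ennreal (C powr p)"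
        using \<open>0 < p\<close> by (intro ennreal_leI powr_mono2 bound Lp_norm_nonneg) auto
      finally show ?thesis .
    qed
    then show "\<forall>\<^sub>F n in sequentially. (\<integral>\<^sup>+x. ennreal (norm (f n x) powr p) \<partial>M) \<le> ennreal (C powr p)"
      by simp
  qed simp
  finally have "(\<integral>\<^sup>+x. ennreal (norm (g x) powr p) \<partial>M) < \<infinity>"
    by (rule le_less_trans) simp
  then have "integrable M (\<lambda>x. norm (g x) powr p)"
    by (intro integrableI_bounded) auto
  then show ?thesis using g by (simp add: Lp_def)
qed

lemma Lp_norm_zero_AE:
  assumes "0 < p" "f \<in> Lp M p" "Lp_norm M p f = 0"
  shows "AE x in M. f x = 0"
proof -
  have "(LINT x|M. norm (f x) powr p) = 0"
    using Lp_norm_powr[of p M f] assms by simp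
  then have "AE x in M. norm (f x) powr p = 0"
    using assms by (subst (asm) integral_nonneg_eq_0_iff_AE) (auto simp: Lp_def)
  then show ?thesis by simp
qed

text \<open>
  Young's inequality for the normalized functions, integrated.
\<close>

theorem Lp_Hoelder:
  assumes pq: "1 < p" "1 < q" "1 / p + 1 / q = 1" and f: "f \<in> Lp M p" and g: "g \<in> Lp M q"
  shows "(LINT x|M. norm (f x) * norm (g x)) \<le> Lp_norm M p f * Lp_norm M q g"
proof (cases "Lp_norm M p f = 0 \<or> Lp_norm M q g = 0")
  case True
  then have "AE x in M. norm (f x) * norm (g x) = 0"
  proof
    assume "Lp_norm M p f = 0"
    from Lp_norm_zero_AE[OF _ f this] pq(1) have "AE x in M. f x = 0" by simp
    then show ?thesis by eventually_elim simp
  next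
    assume "Lp_norm M q g = 0"
    from Lp_norm_zero_AE[OF _ g this] pq(2) have "AE x in M. g x = 0" by simp
    then show ?thesis by eventually_elim simp
  qed
  from integral_eq_zero_AE[OF this] show ?thesis by (simp add: Lp_norm_nonneg)
next
  case False
  define a where "a = Lp_norm M p f"
  define b where "b = Lp_norm M q g"
  have ab: "0 < a" "0 < b" using False Lp_norm_nonneg by (auto simp: a_def b_def less_le)
  note [measurable] = Lp_measurable[OF f] Lp_measurable[OF g]
  have young: "norm (f x) * norm (g x) / (a * b)
      \<le> (norm (f x) powr p / a powr p) / p + (norm (g x) powr q / b powr q) / q" for x
    using Youngs_inequality[OF pq, of "norm (f x) / a" "norm (g x) / b"] ab
    by (simp add: powr_divide)
  have intf: "integrable M (\<lambda>x. norm (f x) powr p)" and intg: "integrable M (\<lambda>x. norm (g x) powr q)"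
    using f g by (auto simp: Lp_def)
  have int: "integrable M (\<lambda>x. (norm (f x) powr p / a powr p) / p + (norm (g x) powr q / b powr q) / q)"
    using intf intg by auto
  have "integrable M (\<lambda>x. norm (f x) * norm (g x) / (a * b))"
  proof (rule Bochner_Integration.integrable_bound[OF int], measurable, rule AE_I2)
    fix x
    have "norm (norm (f x) * norm (g x) / (a * b)) = norm (f x) * norm (g x) / (a * b)"
      using ab by simp
    also note young[of x]
    also note abs_ge_self
    finally show "norm (norm (f x) * norm (g x) / (a * b))
        \<le> norm ((norm (f x) powr p / a powr p) / p + (norm (g x) powr q / b powr q) / q)"
      by simp
  qed
  then have "(LINT x|M. norm (f x) * norm (g x) / (a * b))
      \<le> (LINT x|M. (norm (f x) powr p / a powr p) / p + (norm (g x) powr q / b powr q) / q)"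
    by (intro integral_mono int young)
  also have "\<dots> = (a powr p / a powr p) / p + (b powr q / b powr q) / q"
    using intf intg pq by (simp add: a_def b_def Lp_norm_powr)
  also have "\<dots> = 1" using ab pq by simp
  finally have "(LINT x|M. norm (f x) * norm (g x)) / (a * b) \<le> 1" by simp
  then show ?thesis using ab by (simp add: divide_le_eq flip: a_def b_def)
qed

lemma Linf_iff: "f \<in> Linf M \<longleftrightarrow> f \<in> borel_measurable M \<and> (\<exists>C. AE x in M. norm (f x) \<le> C)"
proof (intro iffI conjI)
  assume f: "f \<in> Linf M"
  then show "f \<in> borel_measurable M" by (simp add: Linf_def)
  define e where "e = esssup M (\<lambda>x. ennreal (norm (f x)))"
  have "e < \<infinity>" using f by (simp add: Linf_def e_def)
  then have "e = ennreal (enn2real e)" by simp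
  moreover have "AE x in M. ennreal (norm (f x)) \<le> e"
    unfolding e_def by (rule esssup_AE)
  ultimately have "AE x in M. ennreal (norm (f x)) \<le> ennreal (enn2real e)" by simp
  then show "\<exists>C. AE x in M. norm (f x) \<le> C"
    by (intro exI[of _ "enn2real e"]) simp
next
  assume "f \<in> borel_measurable M \<and> (\<exists>C. AE x in M. norm (f x) \<le> C)"
  then obtain C where [measurable]: "f \<in> borel_measurable M" and C: "AE x in M. norm (f x) \<le> C" by blast
  have "AE x in M. ennreal (norm (f x)) \<le> ennreal C"
    using C by eventually_elim (rule ennreal_leI)
  then have "esssup M (\<lambda>x. ennreal (norm (f x))) \<le> ennreal C"
    by (intro esssup_I) simp_all
  then show "f \<in> Linf M" by (simp add: Linf_def le_less_trans)
qed

lemma Linf_mono: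
  assumes "g \<in> Linf M" "f \<in> borel_measurable M" "\<And>x. norm (f x) \<le> norm (g x)"
  shows "f \<in> Linf M"
proof -
  obtain C where "AE x in M. norm (g x) \<le> C" using assms(1) by (auto simp: Linf_iff)
  then have "AE x in M. norm (f x) \<le> C"
    by eventually_elim (use assms(3) order_trans in blast)
  then show ?thesis using assms(2) by (auto simp: Linf_iff)
qed

lemma truncate_le: "norm (truncate n f x) \<le> norm (f x)"
  by (simp add: truncate_def indicator_def)

lemma truncate_measurable:
  assumes "f \<in> borel_measurable lborel"
  shows "truncate n f \<in> borel_measurable lborel"
proof -
  have "(indicator (ball 0 (real n)) :: real ^ 'a \<Rightarrow> complex) \<in> borel_measurable lborel"
    by (intro borel_measurable_indicator) simp
  then show ?thesis
    unfolding truncate_def using assms by (intro borel_measurable_times)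
qed

lemma truncate_in_L2: "f \<in> L2 \<Longrightarrow> truncate n f \<in> L2"
  by (rule Lp_2_mono[OF _ truncate_measurable[OF Lp_2_measurable]]) (auto simp: truncate_le)

lemma truncate_tendsto_L2:
  assumes f: "f \<in> L2"
  shows "(\<lambda>n. L2_norm (\<lambda>x. f x - truncate n f x)) \<longlonglongrightarrow> 0"
proof -
  note [measurable] = Lp_2_measurable[OF f] truncate_measurable[OF Lp_2_measurable[OF f]]
  have "(\<lambda>n. LINT x|lborel. (norm (f x - truncate n f x))\<^sup>2) \<longlonglongrightarrow> (LINT x|(lborel :: (real ^ 'a) measure). 0)"
  proof (rule integral_dominated_convergence[where w = "\<lambda>x. (norm (f x))\<^sup>2"])
    show "integrable lborel (\<lambda>x. (norm (f x))\<^sup>2)" using f by (simp add: Lp_2_iff)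
    show "AE x in lborel. (\<lambda>n. (norm (f x - truncate n f x))\<^sup>2) \<longlonglongrightarrow> 0"
    proof (rule AE_I2)
      fix x :: "real ^ 'a"
      obtain N where N: "norm x < real N" using reals_Archimedean2 by blast
      have "(norm (f x - truncate n f x))\<^sup>2 = 0" if "N \<le> n" for n
      proof -
        have "norm x < real n" using N that by (meson le_less_trans less_le_trans of_nat_le_iff)
        then show ?thesis by (simp add: truncate_def dist_norm)
      qed
      then have "\<forall>\<^sub>F n in sequentially. (norm (f x - truncate n f x))\<^sup>2 = 0"
        by (rule eventually_sequentiallyI)
      then show "(\<lambda>n. (norm (f x - truncate n f x))\<^sup>2) \<longlonglongrightarrow> 0"
        by (rule tendsto_eventually)
    qed
    show "AE x in lborel. norm ((norm (f x - truncate n f x))\<^sup>2) \<le> (norm (f x))\<^sup>2" for n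
      by (intro AE_I2) (simp add: truncate_def indicator_def)
  qed measurable
  then have "(\<lambda>n. sqrt (LINT x|lborel. (norm (f x - truncate n f x))\<^sup>2)) \<longlonglongrightarrow> sqrt 0"
    by (intro tendsto_real_sqrt) simp
  then show ?thesis by (simp add: Lp_norm_2)
qed

text \<open>
  The truncations converge to \<open>f\<close> in \<open>L\<^sup>2\<close>, hence so do their images to \<open>T\<^sub>t f\<close>; the pointwise limit of the
  images is therefore the same function.
\<close>

lemma nonneg_ext_eq:
  assumes T: "C0_semigroup T" and t: "0 \<le> t" and lim: "Linf_limits_exist (T t)"
    and f: "f \<in> L2" "f \<in> Linf lborel" "\<And>x. 0 \<le> f x"
  shows "AE x in lborel. nonneg_ext (T t) f x = T t f x"
proof -
  note L2 = C0_semigroup_in_L2[OF T t]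
  let ?F = "\<lambda>n. T t (truncate n f)" and ?g = "nonneg_ext (T t) f"
  have F: "?F n \<in> L2" for n by (intro L2 truncate_in_L2 f)
  note [measurable] = Lp_2_measurable[OF F]
  have [measurable]: "?g \<in> borel_measurable lborel" unfolding nonneg_ext_def by measurable
  have "AE x in lborel. convergent (\<lambda>n. ?F n x)"
    using lim f unfolding Linf_limits_exist_def by auto
  then have conv: "AE x in lborel. (\<lambda>n. ?F n x) \<longlonglongrightarrow> ?g x"
    by eventually_elim (simp add: nonneg_ext_def convergent_LIMSEQ_iff)
  obtain C where C: "0 \<le> C" "\<And>f. f \<in> L2 \<Longrightarrow> L2_norm (T t f) \<le> C * L2_norm f"
    using C0_semigroup_bounded[OF T t] by blast
  have diff: "L2_norm (\<lambda>x. T t f x - ?F n x) \<le> C * L2_norm (\<lambda>x. f x - truncate n f x)" for n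
  proof -
    have D: "(\<lambda>x. f x - truncate n f x) \<in> L2" by (intro Lp_2_diff truncate_in_L2 f)
    have "AE x in lborel. T t f x - ?F n x = T t (\<lambda>x. f x - truncate n f x) x"
      using C0_semigroup_diff[OF T t f(1) truncate_in_L2[OF f(1), of n]] by eventually_elim simp
    from Lp_cong(2)[OF _ L2[OF D] _ this] have "L2_norm (\<lambda>x. T t f x - ?F n x) = L2_norm (T t (\<lambda>x. f x - truncate n f x))"
      using Lp_2_measurable[OF Lp_2_diff[OF L2[OF f(1)] F]] by simp
    then show ?thesis using C(2)[OF D] by simp
  qed
  have zero: "(\<lambda>n. C * L2_norm (\<lambda>x. f x - truncate n f x)) \<longlonglongrightarrow> C * 0"
    by (intro tendsto_intros truncate_tendsto_L2 f)
  have close: "L2_norm (\<lambda>x. T t f x - ?g x) \<le> e" "?g \<in> L2" if "0 < e" for e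
  proof -
    have "\<forall>\<^sub>F n in sequentially. C * L2_norm (\<lambda>x. f x - truncate n f x) < e"
      using zero that by (intro order_tendstoD) auto
    then have "\<forall>\<^sub>F n in sequentially. L2_norm (\<lambda>x. T t f x - ?F n x) \<le> e"
      by eventually_elim (use diff order_trans less_imp_le in blast)
    then show "L2_norm (\<lambda>x. T t f x - ?g x) \<le> e" "?g \<in> L2"
      using that by (intro Lp_2_fatou[OF F \<open>?g \<in> borel_measurable lborel\<close> conv L2[OF f(1)]]; simp)+
  qed
  have "L2_norm (\<lambda>x. T t f x - ?g x) \<le> 0"
    by (rule field_le_epsilon) (simp add: close(1))
  then have "L2_norm (\<lambda>x. T t f x - ?g x) = 0"
    using Lp_norm_nonneg by (rule antisym)
  then have "AE x in lborel. T t f x - ?g x = 0"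
    using Lp_2_diff[OF L2[OF f(1)] close(2)[of 1]] by (intro Lp_norm_zero_AE[of 2]) simp_all
  then show ?thesis by eventually_elim simp
qed

lemma Linf_ext_eq:
  assumes T: "C0_semigroup T" and t: "0 \<le> t" and lim: "Linf_limits_exist (T t)"
    and f: "f \<in> L2" "f \<in> Linf lborel"
  shows "AE x in lborel. Linf_ext (T t) f x = T t f x"
proof -
  note [measurable] = Lp_2_measurable[OF f(1)]
  let ?p = "\<lambda>r y. complex_of_real (max 0 (r (f y)))"
  have part: "?p r \<in> L2 \<and> ?p r \<in> Linf lborel \<and> (\<forall>x. 0 \<le> ?p r x)"
    if [measurable]: "r \<in> borel_measurable borel" and le: "\<And>z. r z \<le> norm z" for r
  proof -
    have "(\<lambda>x. max 0 (r (f x))) \<in> borel_measurable lborel" by measurable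
    then have m: "?p r \<in> borel_measurable lborel" by measurable
    have "norm (?p r x) \<le> norm (f x)" for x using le[of "f x"] by simp
    then show ?thesis
      using Lp_2_mono[OF f(1) m] Linf_mono[OF f(2) m] by (simp add: less_eq_complex_def)
  qed
  have Re_m: "Re \<in> borel_measurable borel" "(\<lambda>z. - Re z) \<in> borel_measurable borel"
    "Im \<in> borel_measurable borel" "(\<lambda>z. - Im z) \<in> borel_measurable borel"
    by measurable
  have "r z \<le> norm z" if "r \<in> {Re, \<lambda>z. - Re z, Im, \<lambda>z. - Im z}" for r z
    using that abs_Re_le_cmod[of z] abs_Im_le_cmod[of z] by auto
  then have P: "?p r \<in> L2 \<and> ?p r \<in> Linf lborel \<and> (\<forall>x. 0 \<le> ?p r x)"
    if "r \<in> {Re, \<lambda>z. - Re z, Im, \<lambda>z. - Im z}" for r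
    using that by (intro part) (auto intro: Re_m)
  define f1 f2 f3 f4 where defs: "f1 = ?p Re" "f2 = ?p (\<lambda>z. - Re z)" "f3 = ?p Im" "f4 = ?p (\<lambda>z. - Im z)"
  have L2: "f1 \<in> L2" "f2 \<in> L2" "f3 \<in> L2" "f4 \<in> L2"
    using P unfolding defs by auto
  have N: "AE x in lborel. nonneg_ext (T t) f1 x = T t f1 x" "AE x in lborel. nonneg_ext (T t) f2 x = T t f2 x"
    "AE x in lborel. nonneg_ext (T t) f3 x = T t f3 x" "AE x in lborel. nonneg_ext (T t) f4 x = T t f4 x"
    unfolding defs using P by (auto intro!: nonneg_ext_eq[OF T t lim])
  define g h where gh: "g = (\<lambda>x. 1 * f1 x + (- 1) * f2 x)" "h = (\<lambda>x. 1 * f3 x + (- 1) * f4 x)"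
  have L2': "g \<in> L2" "h \<in> L2" unfolding gh by (intro Lp_2_add Lp_2_mult L2)+
  have eq: "f = (\<lambda>x. 1 * g x + \<i> * h x)"
    unfolding gh defs by (auto simp: complex_eq_iff fun_eq_iff max_def)
  have "AE x in lborel. T t f x = 1 * T t g x + \<i> * T t h x"
    by (subst eq) (rule C0_semigroup_linear[OF T t L2'])
  moreover have "AE x in lborel. T t g x = 1 * T t f1 x + (- 1) * T t f2 x"
    unfolding gh by (rule C0_semigroup_linear[OF T t L2(1,2)])
  moreover have "AE x in lborel. T t h x = 1 * T t f3 x + (- 1) * T t f4 x"
    unfolding gh by (rule C0_semigroup_linear[OF T t L2(3,4)])
  moreover note N
  ultimately have "AE x in lborel. nonneg_ext (T t) f1 x - nonneg_ext (T t) f2 x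
      + \<i> * (nonneg_ext (T t) f3 x - nonneg_ext (T t) f4 x) = T t f x"
    by eventually_elim simp
  moreover have "Linf_ext (T t) f x = nonneg_ext (T t) f1 x - nonneg_ext (T t) f2 x
      + \<i> * (nonneg_ext (T t) f3 x - nonneg_ext (T t) f4 x)" for x
    by (simp add: Linf_ext_def defs)
  ultimately show ?thesis by simp
qed

text \<open>
  The negative and imaginary parts of the constant function vanish, so that its image is a single
  limit.
\<close>

lemma Linf_ext_one:
  fixes T :: "real \<Rightarrow> ('n::finite) fn \<Rightarrow> 'n fn"
  assumes T: "C0_semigroup T" and t: "0 \<le> t" and lim: "Linf_limits_exist (T t)"
  shows "AE x in lborel. (\<lambda>n. T t (truncate n (\<lambda>_. 1)) x) \<longlonglongrightarrow> Linf_ext (T t) (\<lambda>_. 1) x"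
proof -
  have one: "(\<lambda>_. 1) \<in> Linf lborel" by (auto simp: Linf_iff)
  have zero: "AE x in lborel. T t (\<lambda>_. 0) x = 0"
    using C0_semigroup_linear[OF T t Lp_2_zero Lp_2_zero, of 0 0] by simp
  have "AE x in lborel. convergent (\<lambda>n. T t (truncate n (\<lambda>_. 1)) x)"
    by (rule lim[unfolded Linf_limits_exist_def, rule_format, OF one]) (simp add: less_eq_complex_def)
  with zero show ?thesis
  proof eventually_elim
    case (elim x)
    have "truncate n (\<lambda>_. 0) = (\<lambda>_ :: real ^ 'n. 0)" for n by (simp add: truncate_def)
    then have "nonneg_ext (T t) (\<lambda>_. 0) x = 0"
      using elim(1) by (simp add: nonneg_ext_def)
    then have "Linf_ext (T t) (\<lambda>_. 1) x = nonneg_ext (T t) (\<lambda>_. 1) x"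
      by (simp add: Linf_ext_def)
    then show ?case using elim(2) by (simp add: nonneg_ext_def convergent_LIMSEQ_iff)
  qed
qed

section \<open>Intrinsic supercontractivity and ground state domination\<close>

text \<open>
  The part of the setting that gives a symmetric semigroup and a positive measurable \<open>\<phi>\<close>.
\<close>

locale ground_state_setting =
  fixes H :: "('n::finite) graph" and \<phi> :: "real ^ 'n \<Rightarrow> real"
  assumes self_adjoint: "self_adjoint H" and bounded_below: "bounded_from_below H"
    and ground_state: "ground_state H \<phi>"
begin

abbreviation T :: "real \<Rightarrow> 'n fn \<Rightarrow> 'n fn" where "T \<equiv> exp_semigroup H"
abbreviation \<mu> :: "(real ^ 'n) measure" where "\<mu> \<equiv> gs_measure \<phi>"
abbreviation E\<^sub>0 :: real where "E\<^sub>0 \<equiv> inf_spectrum H"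

lemma semigroup: "C0_semigroup T"
  by (rule exp_semigroup_symmetric_C0(1)[OF self_adjoint bounded_below])

lemmas T_L2 = C0_semigroup_in_L2[OF semigroup]

lemma T_symmetric:
  "0 \<le> t \<Longrightarrow> f \<in> L2 \<Longrightarrow> g \<in> L2 \<Longrightarrow>
    (LINT x|lborel. inner (T t f x) (g x)) = (LINT x|lborel. inner (f x) (T t g x))"
  by (rule exp_semigroup_symmetric_C0(2)[OF self_adjoint bounded_below])

lemma T_double:
  assumes "0 \<le> s" "f \<in> L2"
  shows "AE x in lborel. T (s + s) f x = T s (T s f) x"
  using semigroup assms unfolding C0_semigroup_def by blast

lemma complex_phi_measurable [measurable]: "(\<lambda>x. complex_of_real (\<phi> x)) \<in> borel_measurable borel"
proof -
  have "(\<lambda>x. complex_of_real (\<phi> x)) \<in> L2"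
    using ground_state self_adjoint_in_L2[OF self_adjoint]
    unfolding ground_state_def eigenspace_def by blast
  from Lp_2_measurable[OF this] show ?thesis by simp
qed

lemma phi_measurable [measurable]: "\<phi> \<in> borel_measurable borel"
proof -
  have "(\<lambda>x. Re (complex_of_real (\<phi> x))) \<in> borel_measurable borel" by measurable
  then show ?thesis by simp
qed

lemma phi_pos: "AE x in lborel. 0 < \<phi> x"
  using ground_state by (simp add: ground_state_def)

lemma measurable_mu [simp]: "borel_measurable \<mu> = borel_measurable borel"
  by (rule measurable_cong_sets) (simp_all add: gs_measure_def)

lemma AE_mu: "(AE x in lborel. P x) \<Longrightarrow> AE x in \<mu>. P x"
  unfolding gs_measure_def by (subst AE_density) auto

lemma integrable_mu:
  fixes f :: "real ^ 'n \<Rightarrow> real"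
  assumes "f \<in> borel_measurable borel"
  shows "integrable \<mu> f \<longleftrightarrow> integrable lborel (\<lambda>x. (\<phi> x)\<^sup>2 * f x)"
  unfolding gs_measure_def using assms by (subst integrable_density) auto

lemma integral_mu:
  fixes f :: "real ^ 'n \<Rightarrow> real"
  assumes "f \<in> borel_measurable borel"
  shows "(LINT x|\<mu>. f x) = (LINT x|lborel. (\<phi> x)\<^sup>2 * f x)"
  unfolding gs_measure_def using assms by (subst integral_density) auto

text \<open>
  The isometry from \<open>L\<^sup>2(dx)\<close> to \<open>L\<^sup>2(\<mu>)\<close> that intertwines the two semigroups up to the factor
  \<open>e\<^bsup>Et\<^esup>\<close> with \<open>E\<close> the ground state energy.
\<close>

definition over_phi :: "'n fn \<Rightarrow> 'n fn" where
  "over_phi u = (\<lambda>x. u x / complex_of_real (\<phi> x))"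

lemma over_phi_measurable: "u \<in> borel_measurable borel \<Longrightarrow> over_phi u \<in> borel_measurable borel"
  unfolding over_phi_def by (intro borel_measurable_divide complex_phi_measurable)

lemma over_phi_Lp_2:
  assumes "u \<in> L2"
  shows "over_phi u \<in> Lp \<mu> 2" "Lp_norm \<mu> 2 (over_phi u) = L2_norm u"
proof -
  have u [measurable]: "u \<in> borel_measurable borel" using Lp_2_measurable[OF assms] by simp
  have o [measurable]: "over_phi u \<in> borel_measurable borel" by (rule over_phi_measurable[OF u])
  have eq: "AE x in lborel. (\<phi> x)\<^sup>2 * (norm (over_phi u x))\<^sup>2 = (norm (u x))\<^sup>2"
    using phi_pos by eventually_elim (simp add: over_phi_def norm_divide power_divide)
  have "integrable lborel (\<lambda>x. (\<phi> x)\<^sup>2 * (norm (over_phi u x))\<^sup>2)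
      \<longleftrightarrow> integrable lborel (\<lambda>x. (norm (u x))\<^sup>2)"
    by (rule integrable_cong_AE[OF _ _ eq]) measurable
  then show "over_phi u \<in> Lp \<mu> 2"
    using assms o by (simp add: Lp_2_iff integrable_mu)
  have "(LINT x|lborel. (\<phi> x)\<^sup>2 * (norm (over_phi u x))\<^sup>2) = (LINT x|lborel. (norm (u x))\<^sup>2)"
    by (rule integral_cong_AE[OF _ _ eq]) measurable
  then show "Lp_norm \<mu> 2 (over_phi u) = L2_norm u"
    by (simp add: Lp_norm_2 integral_mu)
qed

lemma times_phi_L2:
  assumes "f \<in> Lp \<mu> 2"
  shows "(\<lambda>x. f x * complex_of_real (\<phi> x)) \<in> L2"
    "L2_norm (\<lambda>x. f x * complex_of_real (\<phi> x)) = Lp_norm \<mu> 2 f"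
proof -
  have f [measurable]: "f \<in> borel_measurable borel" using Lp_2_measurable[OF assms] by simp
  have "(norm (f x * complex_of_real (\<phi> x)))\<^sup>2 = (\<phi> x)\<^sup>2 * (norm (f x))\<^sup>2" for x
    by (simp add: norm_mult power_mult_distrib)
  then show "(\<lambda>x. f x * complex_of_real (\<phi> x)) \<in> L2"
    "L2_norm (\<lambda>x. f x * complex_of_real (\<phi> x)) = Lp_norm \<mu> 2 f"
    using assms by (simp_all add: Lp_2_iff Lp_norm_2 integrable_mu integral_mu)
qed

lemma gs_semigroup_over_phi:
  assumes "0 \<le> t" "u \<in> L2"
  shows "AE x in lborel. gs_semigroup H \<phi> t (over_phi u) x
    = complex_of_real (exp (E\<^sub>0 * t)) * over_phi (T t u) x"
proof -
  have "AE x in lborel. over_phi u x * complex_of_real (\<phi> x) = u x"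
    using phi_pos by eventually_elim (simp add: over_phi_def)
  then have "AE x in lborel. T t (\<lambda>x. over_phi u x * complex_of_real (\<phi> x)) x = T t u x"
    by (rule C0_semigroup_cong[OF semigroup assms(1) times_phi_L2(1)[OF over_phi_Lp_2(1)[OF assms(2)]] assms(2)])
  then show ?thesis
    by eventually_elim (simp add: gs_semigroup_def over_phi_def)
qed

text \<open>
  Supercontractivity in terms of the original semigroup.
\<close>

lemma ISC_over_phi:
  assumes "ISC H \<phi>" "2 < p" "0 < t"
  obtains C where "0 \<le> C"
    "\<And>u. u \<in> L2 \<Longrightarrow> over_phi (T t u) \<in> Lp \<mu> p \<and> Lp_norm \<mu> p (over_phi (T t u)) \<le> C * L2_norm u"
proof -
  obtain C where C: "\<And>f. f \<in> Lp \<mu> 2 \<Longrightarrow> gs_semigroup H \<phi> t f \<in> Lp \<mu> p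
      \<and> Lp_norm \<mu> p (gs_semigroup H \<phi> t f) \<le> C * Lp_norm \<mu> 2 f"
    using assms unfolding ISC_def bounded_map_def by blast
  define K where "K = exp (- (E\<^sub>0 * t)) * max C 0"
  have "over_phi (T t u) \<in> Lp \<mu> p \<and> Lp_norm \<mu> p (over_phi (T t u)) \<le> K * L2_norm u" if u: "u \<in> L2" for u
  proof -
    let ?S = "gs_semigroup H \<phi> t (over_phi u)"
    have S: "?S \<in> Lp \<mu> p" "Lp_norm \<mu> p ?S \<le> C * L2_norm u"
      using C[OF over_phi_Lp_2(1)[OF u]] over_phi_Lp_2(2)[OF u] by auto
    have Tu: "T t u \<in> L2" using assms u by (intro T_L2) auto
    have meas: "over_phi (T t u) \<in> borel_measurable \<mu>"
      using over_phi_measurable Lp_2_measurable[OF Tu] by simp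
    have le: "AE x in \<mu>. norm (over_phi (T t u) x) \<le> exp (- (E\<^sub>0 * t)) * norm (?S x)"
      using AE_mu[OF gs_semigroup_over_phi[OF less_imp_le[OF assms(3)] u]]
      by eventually_elim (simp add: norm_mult flip: mult.assoc exp_add)
    have "over_phi (T t u) \<in> Lp \<mu> p"
      "Lp_norm \<mu> p (over_phi (T t u)) \<le> exp (- (E\<^sub>0 * t)) * Lp_norm \<mu> p ?S"
      using assms by (intro Lp_dominated[OF _ _ S(1) meas le]; simp)+
    moreover have "Lp_norm \<mu> p ?S \<le> max C 0 * L2_norm u"
      using S(2) mult_right_mono[of C "max C 0" "L2_norm u"] Lp_norm_nonneg[of lborel 2 u] by simp
    then have "exp (- (E\<^sub>0 * t)) * Lp_norm \<mu> p ?S \<le> K * L2_norm u"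
      unfolding K_def mult.assoc by (rule mult_left_mono) simp
    ultimately show ?thesis by simp
  qed
  moreover have "0 \<le> K" by (simp add: K_def)
  ultimately show thesis using that by blast
qed

text \<open>
  The dual estimate: \<open>\<parallel>T\<^sub>s u\<parallel>\<^sup>2 = \<langle>T\<^sub>s T\<^sub>s u, u\<rangle>\<close> is estimated by Hoelder's inequality for \<open>\<mu>\<close>, then
  supercontractivity with the conjugate exponent of \<open>1 + \<delta>\<close> is applied to \<open>T\<^sub>s u\<close>, and one factor
  \<open>\<parallel>T\<^sub>s u\<parallel>\<close> is cancelled. The conjugate exponent exceeds \<open>2\<close> because \<open>\<delta> < 1\<close>.
\<close>

lemma ISC_dual:
  assumes "ISC H \<phi>" "0 < \<delta>" "\<delta> < 1" "0 < s"
  obtains C where "0 \<le> C"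
    "\<And>u. u \<in> L2 \<Longrightarrow> over_phi u \<in> Lp \<mu> (1 + \<delta>) \<Longrightarrow> L2_norm (T s u) \<le> C * Lp_norm \<mu> (1 + \<delta>) (over_phi u)"
proof -
  define q where "q = (1 + \<delta>) / \<delta>"
  have q: "2 < q" "1 / q + 1 / (1 + \<delta>) = 1"
    using assms by (auto simp: q_def field_simps)
  obtain C where C: "0 \<le> C"
    "\<And>u. u \<in> L2 \<Longrightarrow> over_phi (T s u) \<in> Lp \<mu> q \<and> Lp_norm \<mu> q (over_phi (T s u)) \<le> C * L2_norm u"
    using ISC_over_phi[OF assms(1) q(1) assms(4)] by blast
  have "L2_norm (T s u) \<le> C * Lp_norm \<mu> (1 + \<delta>) (over_phi u)"
    if u: "u \<in> L2" and ou: "over_phi u \<in> Lp \<mu> (1 + \<delta>)" for u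
  proof -
    have s: "0 \<le> s" using assms by simp
    have v: "T s u \<in> L2" by (intro T_L2 s u)
    have w: "T s (T s u) \<in> L2" by (intro T_L2 s v)
    have meas [measurable]: "u \<in> borel_measurable borel" "T s (T s u) \<in> borel_measurable borel"
      using Lp_2_measurable[OF u] Lp_2_measurable[OF w] by simp_all
    note [measurable] = over_phi_measurable[OF meas(1)] over_phi_measurable[OF meas(2)]
    have "(L2_norm (T s u))\<^sup>2 = (LINT x|lborel. inner (T s u x) (T s u x))"
      by (simp add: Lp_norm_2 power2_norm_eq_inner)
    also have "\<dots> = (LINT x|lborel. inner (T s (T s u) x) (u x))"
      by (rule T_symmetric[OF s v u, symmetric])
    also have "\<dots> \<le> (LINT x|lborel. norm (T s (T s u) x) * norm (u x))"
      by (intro integral_mono Lp_2_integrable_inner Lp_2_integrable_mult w u norm_cauchy_schwarz)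
    also have "\<dots> = (LINT x|lborel. (\<phi> x)\<^sup>2 * (norm (over_phi (T s (T s u)) x) * norm (over_phi u x)))"
    proof (rule integral_cong_AE)
      show "AE x in lborel. norm (T s (T s u) x) * norm (u x)
          = (\<phi> x)\<^sup>2 * (norm (over_phi (T s (T s u)) x) * norm (over_phi u x))"
        using phi_pos by eventually_elim (simp add: over_phi_def norm_divide power2_eq_square)
    qed measurable
    also have "\<dots> = (LINT x|\<mu>. norm (over_phi (T s (T s u)) x) * norm (over_phi u x))"
      by (rule integral_mu[symmetric]) measurable
    also have "\<dots> \<le> Lp_norm \<mu> q (over_phi (T s (T s u))) * Lp_norm \<mu> (1 + \<delta>) (over_phi u)"
      using C(2)[OF v] q assms(2) by (intro Lp_Hoelder ou) auto
    also have "\<dots> \<le> C * L2_norm (T s u) * Lp_norm \<mu> (1 + \<delta>) (over_phi u)"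
      using C(2)[OF v] by (intro mult_right_mono Lp_norm_nonneg) auto
    finally have "L2_norm (T s u) * L2_norm (T s u) \<le> (C * Lp_norm \<mu> (1 + \<delta>) (over_phi u)) * L2_norm (T s u)"
      by (simp add: power2_eq_square mult_ac)
    then show ?thesis
      using C(1) Lp_norm_nonneg[of lborel 2 "T s u"] Lp_norm_nonneg[of \<mu> "1 + \<delta>" "over_phi u"]
      by (cases "L2_norm (T s u) = 0") (auto simp: mult_le_cancel_right)
  qed
  then show thesis using that C(1) by blast
qed

text \<open>
  The integrability hypothesis on \<open>\<phi>\<close> enters here: \<open>\<phi>\<^sup>2 \<phi>\<^bsup>-(1+\<delta>)\<^esup> = \<phi>\<^bsup>1-\<delta>\<^esup>\<close>. The bound does not depend
  on the radius \<open>n\<close> of the ball.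
\<close>

lemma over_phi_truncate_one:
  assumes "0 < \<delta>" and int: "integrable lborel (\<lambda>x. \<phi> x powr (1 - \<delta>))"
  shows "over_phi (truncate n (\<lambda>_. 1)) \<in> Lp \<mu> (1 + \<delta>)"
    "Lp_norm \<mu> (1 + \<delta>) (over_phi (truncate n (\<lambda>_. 1)))
      \<le> (LINT x|lborel. \<phi> x powr (1 - \<delta>)) powr (1 / (1 + \<delta>))"
proof -
  let ?u = "truncate n (\<lambda>_. 1) :: 'n fn"
  have [measurable]: "over_phi ?u \<in> borel_measurable borel"
    using truncate_measurable[of "\<lambda>_. 1" n] by (intro over_phi_measurable) simp
  have le: "AE x in lborel. (\<phi> x)\<^sup>2 * norm (over_phi ?u x) powr (1 + \<delta>) \<le> \<phi> x powr (1 - \<delta>)"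
    using phi_pos
  proof eventually_elim
    case (elim x)
    have "norm (over_phi ?u x) \<le> 1 / \<phi> x"
      using elim truncate_le[of n "\<lambda>_. 1" x] by (simp add: over_phi_def norm_divide divide_right_mono)
    then have "norm (over_phi ?u x) powr (1 + \<delta>) \<le> (1 / \<phi> x) powr (1 + \<delta>)"
      using assms by (intro powr_mono2) auto
    then have "(\<phi> x)\<^sup>2 * norm (over_phi ?u x) powr (1 + \<delta>) \<le> (\<phi> x)\<^sup>2 * (1 / \<phi> x) powr (1 + \<delta>)"
      by (intro mult_left_mono) auto
    also have "\<dots> = \<phi> x powr 2 * \<phi> x powr - (1 + \<delta>)"
      using elim powr_minus_divide[of "\<phi> x" "1 + \<delta>"]
      by (simp only: powr_numeral[OF less_imp_le[OF elim]] powr_divide powr_one_eq_one)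
    also have "\<dots> = \<phi> x powr (1 - \<delta>)"
      by (simp flip: powr_add)
    finally show ?case .
  qed
  have i: "integrable lborel (\<lambda>x. (\<phi> x)\<^sup>2 * norm (over_phi ?u x) powr (1 + \<delta>))"
  proof (rule Bochner_Integration.integrable_bound[OF int])
    show "AE x in lborel. norm ((\<phi> x)\<^sup>2 * norm (over_phi ?u x) powr (1 + \<delta>)) \<le> norm (\<phi> x powr (1 - \<delta>))"
      using le by eventually_elim simp
  qed measurable
  then show "over_phi ?u \<in> Lp \<mu> (1 + \<delta>)"
    unfolding Lp_def by (simp add: integrable_mu)
  have "(LINT x|\<mu>. norm (over_phi ?u x) powr (1 + \<delta>)) \<le> (LINT x|lborel. \<phi> x powr (1 - \<delta>))"
    by (subst integral_mu) (auto intro: integral_mono_AE[OF i int le])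
  then show "Lp_norm \<mu> (1 + \<delta>) (over_phi ?u) \<le> (LINT x|lborel. \<phi> x powr (1 - \<delta>)) powr (1 / (1 + \<delta>))"
    unfolding Lp_norm_def using assms by (intro powr_mono2) auto
qed

lemma truncate_one_in_L2: "(truncate n (\<lambda>_. 1) :: 'n fn) \<in> L2"
  using indicator_ball_in_L2[of "real n"] by (simp add: truncate_def)

text \<open>
  Half of the time is spent on the dual estimate, from \<open>L\<^bsup>1+\<delta>\<^esup>(\<mu>)\<close> to \<open>L\<^sup>2\<close>, and the other half on
  supercontractivity, from \<open>L\<^sup>2\<close> to \<open>L\<^sup>p(\<mu>)\<close>. This bounds the images of the indicator functions of balls
  uniformly in \<open>L\<^sup>p(\<mu>)\<close>, and Fatou's lemma carries the bound to their limit.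
\<close>

theorem ISC_imp_Lp_GSD:
  assumes isc: "ISC H \<phi>" and \<delta>: "0 < \<delta>" "\<delta> < 1" and int: "integrable lborel (\<lambda>x. \<phi> x powr (1 - \<delta>))"
    and Linf: "\<And>t. 0 < t \<Longrightarrow> bounded_on_Linf (T t)" and "2 < p"
  shows "Lp_GSD p H \<phi>"
  unfolding Lp_GSD_def Lp_GSD_op_def
proof (intro allI impI)
  fix t :: real assume "0 < t"
  define s where "s = t / 2"
  have s: "0 < s" "0 \<le> s" "s + s = t" using \<open>0 < t\<close> by (auto simp: s_def)
  obtain C where C: "0 \<le> C"
    "\<And>u. u \<in> L2 \<Longrightarrow> over_phi (T s u) \<in> Lp \<mu> p \<and> Lp_norm \<mu> p (over_phi (T s u)) \<le> C * L2_norm u"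
    using ISC_over_phi[OF isc \<open>2 < p\<close> s(1)] by blast
  obtain D where D: "0 \<le> D"
    "\<And>u. u \<in> L2 \<Longrightarrow> over_phi u \<in> Lp \<mu> (1 + \<delta>) \<Longrightarrow> L2_norm (T s u) \<le> D * Lp_norm \<mu> (1 + \<delta>) (over_phi u)"
    using ISC_dual[OF isc \<delta> s(1)] by blast
  define I where "I = (LINT x|lborel. \<phi> x powr (1 - \<delta>)) powr (1 / (1 + \<delta>))"
  let ?u = "\<lambda>n. truncate n (\<lambda>_. 1) :: 'n fn"
  let ?P = "Linf_ext (T t) (\<lambda>_. 1)"
  have bound: "over_phi (T t (?u n)) \<in> Lp \<mu> p \<and> Lp_norm \<mu> p (over_phi (T t (?u n))) \<le> C * (D * I)" for n
  proof -
    note u = truncate_one_in_L2[of n]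
    have v: "T s (?u n) \<in> L2" by (intro T_L2 s u)
    have "L2_norm (T s (?u n)) \<le> D * Lp_norm \<mu> (1 + \<delta>) (over_phi (?u n))"
      by (intro D(2) u over_phi_truncate_one \<delta> int)
    also have "\<dots> \<le> D * I"
      unfolding I_def by (intro mult_left_mono over_phi_truncate_one \<delta> int D)
    finally have "C * L2_norm (T s (?u n)) \<le> C * (D * I)"
      by (rule mult_left_mono) (rule C)
    then have 1: "over_phi (T s (T s (?u n))) \<in> Lp \<mu> p" "Lp_norm \<mu> p (over_phi (T s (T s (?u n)))) \<le> C * (D * I)"
      using C(2)[OF v] by auto
    have Tt: "T t (?u n) \<in> L2" using \<open>0 < t\<close> by (intro T_L2 u) simp
    have m: "over_phi (T t (?u n)) \<in> borel_measurable \<mu>"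
      using Lp_2_measurable[OF Tt] over_phi_measurable by simp
    have "AE x in lborel. over_phi (T t (?u n)) x = over_phi (T s (T s (?u n))) x"
      using T_double[OF s(2) u] unfolding s(3) by eventually_elim (simp add: over_phi_def)
    from Lp_cong[OF _ 1(1) m AE_mu[OF this]] 1(2) \<open>2 < p\<close> show ?thesis by simp
  qed
  have Linf_T: "bounded_on_Linf (T t)" by (rule Linf[OF \<open>0 < t\<close>])
  have "over_phi ?P \<in> Lp \<mu> p"
  proof (rule Lp_fatou)
    show "0 < p" using \<open>2 < p\<close> by simp
    show "over_phi (T t (?u n)) \<in> Lp \<mu> p" "Lp_norm \<mu> p (over_phi (T t (?u n))) \<le> C * (D * I)" for n
      using bound by auto
    have "(\<lambda>_. 1) \<in> Linf (lborel :: (real ^ 'n) measure)" by (auto simp: Linf_iff)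
    then have "?P \<in> Linf lborel"
      using Linf_T unfolding bounded_on_Linf_def bounded_map_def by blast
    then show "over_phi ?P \<in> borel_measurable \<mu>"
      using over_phi_measurable by (simp add: Linf_iff)
    have "Linf_limits_exist (T t)" using Linf_T by (simp add: bounded_on_Linf_def)
    from Linf_ext_one[OF semigroup _ this] \<open>0 < t\<close>
    have "AE x in lborel. (\<lambda>n. T t (?u n) x) \<longlonglongrightarrow> ?P x" by simp
    with phi_pos have "AE x in lborel. (\<lambda>n. over_phi (T t (?u n)) x) \<longlonglongrightarrow> over_phi ?P x"
      unfolding over_phi_def by eventually_elim (intro tendsto_intros, auto)
    then show "AE x in \<mu>. (\<lambda>n. over_phi (T t (?u n)) x) \<longlonglongrightarrow> over_phi ?P x" by (rule AE_mu)
  qed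
  then show "(\<lambda>x. ?P x / complex_of_real (\<phi> x)) \<in> Lp \<mu> p" by (simp add: over_phi_def)
qed

text \<open>
  After half of the time the function is bounded by a multiple of its norm, and during the other half
  a bounded function stays below that multiple of the image of the constant function \<open>1\<close>.
\<close>

theorem Lp_GSD_imp_ISC:
  assumes gsd: "\<And>p. 2 < p \<Longrightarrow> Lp_GSD p H \<phi>" and ultra: "ultracontractive H"
    and Linf: "\<And>t. 0 < t \<Longrightarrow> bounded_on_Linf (T t)" and dom: "\<And>t. 0 < t \<Longrightarrow> dominated_by_one (T t)"
  shows "ISC H \<phi>"
  unfolding ISC_def
proof (intro allI impI)
  fix p t :: real assume "2 < p" "0 < t"
  define s where "s = t / 2"
  have s: "0 < s" "0 \<le> s" "s + s = t" using \<open>0 < t\<close> by (auto simp: s_def)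
  let ?P = "Linf_ext (T s) (\<lambda>_. 1)"
  have G: "over_phi ?P \<in> Lp \<mu> p"
    using gsd[OF \<open>2 < p\<close>] s(1) by (simp add: Lp_GSD_def Lp_GSD_op_def over_phi_def)
  obtain C where C: "\<And>u. u \<in> L2 \<Longrightarrow> T s u \<in> Linf lborel \<and> Linf_norm lborel (T s u) \<le> C * L2_norm u"
    using ultra s(1) unfolding ultracontractive_def bounded_L2_Linf_def bounded_map_def by blast
  define D where "D = exp (E\<^sub>0 * t) * max C 0"
  have "gs_semigroup H \<phi> t f \<in> Lp \<mu> p
      \<and> Lp_norm \<mu> p (gs_semigroup H \<phi> t f) \<le> (D * Lp_norm \<mu> p (over_phi ?P)) * Lp_norm \<mu> 2 f"
    if f: "f \<in> Lp \<mu> 2" for f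
  proof -
    define u where "u = (\<lambda>x. f x * complex_of_real (\<phi> x))"
    have u: "u \<in> L2" "L2_norm u = Lp_norm \<mu> 2 f" unfolding u_def by (rule times_phi_L2[OF f])+
    define v where "v = T s u"
    have v: "v \<in> L2" "v \<in> Linf lborel" "Linf_norm lborel v \<le> max C 0 * L2_norm u"
    proof -
      show "v \<in> L2" unfolding v_def by (intro T_L2 s u)
      show "v \<in> Linf lborel" using C[OF u(1)] by (simp add: v_def)
      have "C * L2_norm u \<le> max C 0 * L2_norm u"
        by (intro mult_right_mono Lp_norm_nonneg) simp
      then show "Linf_norm lborel v \<le> max C 0 * L2_norm u"
        using C[OF u(1)] by (simp add: v_def)
    qed
    have Tt: "T t u \<in> L2" using \<open>0 < t\<close> by (intro T_L2 u) simp
    have lim: "Linf_limits_exist (T s)" using Linf[OF s(1)] by (simp add: bounded_on_Linf_def)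
    have "AE x in lborel. complex_of_real (norm (Linf_ext (T s) v x))
        \<le> ?P x * complex_of_real (Linf_norm lborel v)"
      using dom[OF s(1)] v(2) unfolding dominated_by_one_def by blast
    with T_double[OF s(2) u(1)] Linf_ext_eq[OF semigroup s(2) lim v(1,2)]
    have pointwise: "AE x in lborel. norm (gs_semigroup H \<phi> t f x) \<le> (D * L2_norm u) * norm (over_phi ?P x)"
      using phi_pos
    proof eventually_elim
      case (elim x)
      have "norm (T t u x) = norm (Linf_ext (T s) v x)"
        using elim(1,2) s(3) by (simp add: v_def)
      also have "\<dots> \<le> Re (?P x) * Linf_norm lborel v"
        using elim(3) by (simp add: less_eq_complex_def)
      also have "\<dots> \<le> norm (?P x) * (max C 0 * L2_norm u)"
        using v(3) complex_Re_le_cmod by (intro mult_mono) (auto simp: Linf_norm_def)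
      finally have *: "norm (T t u x) \<le> norm (?P x) * (max C 0 * L2_norm u)" .
      have "norm (gs_semigroup H \<phi> t f x) = exp (E\<^sub>0 * t) / \<phi> x * norm (T t u x)"
        using elim(4) by (simp add: gs_semigroup_def u_def norm_mult norm_divide)
      also have "\<dots> \<le> exp (E\<^sub>0 * t) / \<phi> x * (norm (?P x) * (max C 0 * L2_norm u))"
        using elim(4) by (intro mult_left_mono *) simp
      also have "\<dots> = (D * L2_norm u) * norm (over_phi ?P x)"
        using elim(4) by (simp add: D_def over_phi_def norm_divide)
      finally show ?case .
    qed
    have m: "gs_semigroup H \<phi> t f \<in> borel_measurable \<mu>"
    proof -
      have [measurable]: "T t u \<in> borel_measurable borel" using Lp_2_measurable[OF Tt] by simp
      have "(\<lambda>x. complex_of_real (exp (E\<^sub>0 * t) / \<phi> x) * T t u x) \<in> borel_measurable borel" by measurable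
      then show ?thesis by (simp add: gs_semigroup_def u_def)
    qed
    have "0 \<le> D * L2_norm u" by (simp add: D_def Lp_norm_nonneg)
    from Lp_dominated[OF _ this G m AE_mu[OF pointwise]] \<open>2 < p\<close> show ?thesis
      by (simp add: u(2) mult_ac)
  qed
  then show "bounded_map (Lp \<mu> 2) (Lp_norm \<mu> 2) (Lp \<mu> p) (Lp_norm \<mu> p) (gs_semigroup H \<phi> t)"
    unfolding bounded_map_def by blast
qed

end

theorem theorem2p2:
  fixes H :: "('n::finite) graph" and \<phi>\<^sub>0 :: "real ^ 'n \<Rightarrow> real"
  assumes "self_adjoint H" and "bounded_from_below H"
    and a: "nondegenerate_eigenvalue H (complex_of_real (inf_spectrum H))"
    and b: "\<forall>t>0. positivity_improving (exp_semigroup H t)"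
    and c: "\<forall>t>0. bounded_on_Linf (exp_semigroup H t) \<and> dominated_by_one (exp_semigroup H t)"
    and d: "\<exists>t\<^sub>b>0. bounded_L2_Linf (exp_semigroup H t\<^sub>b)"
    and "ground_state H \<phi>\<^sub>0"
  shows "(ISC H \<phi>\<^sub>0 \<and> (\<exists>\<delta>::real. 0 < \<delta> \<and> \<delta> < 1 \<and> integrable lborel (\<lambda>x. \<phi>\<^sub>0 x powr (1 - \<delta>)))
            \<longrightarrow> (\<forall>p>2. Lp_GSD p H \<phi>\<^sub>0))
       \<and> ((\<forall>p>2. Lp_GSD p H \<phi>\<^sub>0) \<and> ultracontractive H \<longrightarrow> ISC H \<phi>\<^sub>0)"
proof -
  interpret ground_state_setting H \<phi>\<^sub>0
    by standard (fact assms)+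
  show ?thesis
    using ISC_imp_Lp_GSD Lp_GSD_imp_ISC c by blast
qed

end
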